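(* Let $d\ge1$ be an integer and let $f_c(z)=z^{d+1}+cz$. For $\gamma\in\mathbb{C}$, assume that $f_\gamma(z)=z^{d+1}+\gamma z$ has a parabolic periodic point in $\mathbb{C}$. Then $\gamma\in\overline{\mathbb{Q}}$ and $$H(\gamma)\le(2d+2)^{1/d}(d+1).$$
   Context: A periodic point $\alpha\in\mathbb{C}$ of $f_\gamma$ of period $m$ is parabolic if its multiplier $(f_\gamma^{\circ m})'(\alpha)$ is a root of unity. $H$ is the absolute multiplicative height: for a number field $K$ and $a\in K$, $H(a)=\left(\prod_{v\in M_K}\max\{1,\|a\|_v\}\right)^{1/[K:\mathbb{Q}]}$, where $M_K$ is the set of absolute values on $K$ extending the standard $p$-adic and archimedean absolute values on $\mathbb{Q}$ and $\|a\|_v=|a|_v^{n_v}$ with $n_v$ the local degree at $v$; this does not depend on the choice of $K\ni a$. *)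

theory Defs
  imports
    "HOL-Analysis.Analysis"
    "HOL-Algebra.Algebra"
    "HOL-Algebra.Algebraic_Closure_Type"
    "HOL-Computational_Algebra.Computational_Algebra"
begin

section \<open>Number fields\<close>

text \<open>Number fields are taken as subfields of the complex numbers.\<close>

definition number_field :: "complex set \<Rightarrow> bool" where
  "number_field K \<longleftrightarrow>
     subfield K (ring_of_type_algebra :: complex ring) \<and>
     ring.finite_dimension (ring_of_type_algebra :: complex ring) \<rat> K"

definition field_degree :: "complex set \<Rightarrow> nat" where
  "field_degree K = ring.dim (ring_of_type_algebra :: complex ring) \<rat> K"


section \<open>Absolute values\<close>

definition padic_abs :: "nat \<Rightarrow> rat \<Rightarrow> real" where
  "padic_abs p q = (if q = 0 then 0 else
     (case quotient_of q of (a, b) \<Rightarrow>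
        real p ^ multiplicity (int p) b / real p ^ multiplicity (int p) a))"

definition absolute_value_on :: "complex set \<Rightarrow> (complex \<Rightarrow> real) \<Rightarrow> bool" where
  "absolute_value_on K v \<longleftrightarrow>
     (\<forall>x\<in>K. 0 \<le> v x \<and> (v x = 0 \<longleftrightarrow> x = 0)) \<and>
     (\<forall>x\<in>K. \<forall>y\<in>K. v (x * y) = v x * v y) \<and>
     (\<forall>x\<in>K. \<forall>y\<in>K. v (x + y) \<le> v x + v y)"

text \<open>
  Membership in \<^term>\<open>extensional K\<close> pins the values outside \<open>K\<close>, so that every absolute
  value on \<open>K\<close> is represented by exactly one function.
\<close>

definition abs_values :: "complex set \<Rightarrow> (complex \<Rightarrow> real) set" where
  "abs_values K = {v \<in> extensional K. absolute_value_on K v \<and>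
     ((\<forall>q. v (of_rat q) = \<bar>of_rat q\<bar>) \<or>
      (\<exists>p. Factorial_Ring.prime p \<and> (\<forall>q. v (of_rat q) = padic_abs p q)))}"


section \<open>Completions and local degrees\<close>

definition cauchy_seqs :: "complex set \<Rightarrow> (complex \<Rightarrow> real) \<Rightarrow> (nat \<Rightarrow> complex) set" where
  "cauchy_seqs K v = {s. (\<forall>n. s n \<in> K) \<and>
     (\<forall>e>0. \<exists>N. \<forall>m\<ge>N. \<forall>n\<ge>N. v (s m - s n) < e)}"

definition null_seqs :: "complex set \<Rightarrow> (complex \<Rightarrow> real) \<Rightarrow> (nat \<Rightarrow> complex) set" where
  "null_seqs K v = {s. (\<forall>n. s n \<in> K) \<and> (\<forall>e>0. \<exists>N. \<forall>n\<ge>N. v (s n) < e)}"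

definition cauchy_ring :: "complex set \<Rightarrow> (complex \<Rightarrow> real) \<Rightarrow> (nat \<Rightarrow> complex) ring" where
  "cauchy_ring K v = \<lparr>
     carrier = cauchy_seqs K v,
     monoid.mult = (\<lambda>s t n. s n * t n),
     one = (\<lambda>n. 1),
     ring.zero = (\<lambda>n. 0),
     add = (\<lambda>s t n. s n + t n) \<rparr>"

definition completion :: "complex set \<Rightarrow> (complex \<Rightarrow> real) \<Rightarrow> (nat \<Rightarrow> complex) set ring" where
  "completion K v = cauchy_ring K v Quot null_seqs K v"

text \<open>
  The completion \<open>\<rat>\<^sub>v\<close>, embedded in \<open>K\<^sub>v\<close> as the classes of the Cauchy sequences of rationals.
\<close>

definition rat_completion :: "complex set \<Rightarrow> (complex \<Rightarrow> real) \<Rightarrow> (nat \<Rightarrow> complex) set set" where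
  "rat_completion K v =
     (\<lambda>s. null_seqs K v +>\<^bsub>cauchy_ring K v\<^esub> s) ` cauchy_seqs \<rat> v"

definition local_degree :: "complex set \<Rightarrow> (complex \<Rightarrow> real) \<Rightarrow> nat" where
  "local_degree K v =
     ring.dim (completion K v) (rat_completion K v) (carrier (completion K v))"


section \<open>The absolute multiplicative height\<close>

definition normalized_abs :: "complex set \<Rightarrow> (complex \<Rightarrow> real) \<Rightarrow> complex \<Rightarrow> real" where
  "normalized_abs K v a = v a ^ local_degree K v"

text \<open>
  All but finitely many factors of the product over \<^term>\<open>abs_values K\<close> are 1. As a product over
  an infinite index set is 1 by convention in HOL, it is restricted to the factors different from 1.
\<close>

definition height :: "complex set \<Rightarrow> complex \<Rightarrow> real" where
  "height K a =
     (\<Prod>v \<in> {v \<in> abs_values K. max 1 (normalized_abs K v a) \<noteq> 1}. max 1 (normalized_abs K v a))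
       powr (1 / real (field_degree K))"


section \<open>Parabolic periodic points\<close>

definition fmap :: "nat \<Rightarrow> complex \<Rightarrow> complex \<Rightarrow> complex" where
  "fmap d c z = z ^ (d + 1) + c * z"

definition root_of_unity :: "complex \<Rightarrow> bool" where
  "root_of_unity z \<longleftrightarrow> (\<exists>n\<ge>1. z ^ n = 1)"

text \<open>
  The period \<open>m\<close> need not be minimal: the multiplier for a multiple of the minimal period
  is a power of the multiplier for the minimal one, so this does not affect parabolicity.
\<close>

definition parabolic_periodic_point :: "(complex \<Rightarrow> complex) \<Rightarrow> complex \<Rightarrow> bool" where
  "parabolic_periodic_point f \<alpha> \<longleftrightarrow>
     (\<exists>m\<ge>1. (f ^^ m) \<alpha> = \<alpha> \<and> root_of_unity (deriv (f ^^ m) \<alpha>))"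

end

theory Submission
  imports Defs "HOL-Complex_Analysis.Complex_Analysis" "Subresultants.Subresultant_Gcd"
begin

text \<open>
  The height is a product over the places \<open>v\<close> of a number field, so the theorem follows from a bound
  for \<open>|\<gamma>|\<^sub>v\<close> at each place. With \<open>C = (1 + 1/d) (2d + 2)\<^bsup>1/d\<^esup>\<close> the bounds are \<open>|\<gamma>|\<^sub>v \<le> C\<close> at the archimedean
  places and \<open>|\<gamma>|\<^sub>v \<le> 1/|d|\<^sub>v\<close> at the others. Raised to the local degrees they multiply to at most
  \<open>(C d)\<^bsup>[K:\<rat>]\<^esup>\<close>, by the factorization of \<open>d\<close> into primes and because the local degrees of the
  places above one place of \<open>\<rat>\<close> add up to at most \<open>[K:\<rat>]\<close>; and \<open>C d\<close> is the bound of the theorem.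

  Archimedean places. If \<open>|c| > C\<close>, all critical values of \<open>f(z) = z\<^bsup>d+1\<^esup> + c z\<close> lie outside the
  disc of radius \<open>R = (2|c|)\<^bsup>1/d\<^esup>\<close>, whereas the preimage of this disc is relatively compact in it.
  Such a map strictly expands the hyperbolic metric of the disc, so every cycle has a multiplier of
  modulus greater than 1 (\<open>multiplier_gt_1_if_critical_values_outside\<close>). Expansion is proved without inverse
  branches: the hyperbolic derivative attains its minimum, and at a minimum below 1 the maximum
  modulus principle gives a contradiction (\<open>hyperbolic_deriv_at_minimum\<close>), as in Ahlfors' proof of the
  Schwarz lemma. For other archimedean places one needs the same bound for the conjugates of \<open>\<gamma>\<close>. These are
  roots of a resultant whose roots are exactly the parameters with a cycle of the given kind
  (\<open>poly_parabolic_resultant_eq_0_iff\<close>), and a bound for all roots of a rational polynomial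
  bounds every archimedean absolute value of each root (\<open>v_le_if_conjugates_le\<close>).

  Finite places. The bound says that \<open>d \<gamma>\<close> is an algebraic integer. Otherwise some valuation ring does
  not contain \<open>d \<gamma>\<close> (\<open>not_algebraic_int_imp_valuation_subring\<close>), and with respect to it the
  derivative of \<open>f\<close> at each point of a cycle has absolute value greater than 1, so the multiplier is
  not a root of unity (\<open>algebraic_int_parabolic_parameter\<close>). The use of general valuation rings of
  \<open>\<complex>\<close> makes it unnecessary to extend \<open>p\<close>-adic absolute values to the field generated by the cycle.

  Local degrees. Vectors that are independent over the completion of \<open>\<rat>\<close> in the completions of \<open>K\<close> at
  several places above one place of \<open>\<rat>\<close> are approximated, by weak approximation, by elements of \<open>K\<close>
  that are small at the other places. A rational relation between the approximations contradicts a
  lower bound for linear combinations of independent vectors, so their number is at most \<open>[K:\<rat>]\<close>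
  (\<open>sum_card_cauchy_independent_le_field_degree\<close>).
\<close>

(* From here on, the unqualified polynomial notions refer to the type 'a poly. *)
hide_const (open) up_ring.coeff up_ring.monom module.smult Polynomials.degree Polynomials.lead_coeff

section \<open>Expansion in the hyperbolic metric\<close>

text \<open>
  The norm of the derivative of \<open>f\<close> at \<open>z\<close> from the hyperbolic metric of the disc of radius \<open>r\<close> to
  that of the disc of radius \<open>R\<close>.
\<close>
definition hyperbolic_deriv :: "real \<Rightarrow> real \<Rightarrow> (complex \<Rightarrow> complex) \<Rightarrow> complex \<Rightarrow> real" where
  "hyperbolic_deriv r R f z =
     (norm (deriv f z) * R * (r\<^sup>2 - (norm z)\<^sup>2)) / (r * (R\<^sup>2 - (norm (f z))\<^sup>2))"

text \<open>
  Divided by the square of the modulus of \<open>r\<^sup>2 - cnj w * z\<close>, this expresses the density of the hyperbolic metric by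
  the pseudo-hyperbolic distance of \<open>z\<close> and \<open>w\<close>.
\<close>
lemma disc_metric_identity:
  fixes z w :: complex and r :: real
  shows "(r\<^sup>2 - (norm z)\<^sup>2) * (r\<^sup>2 - (norm w)\<^sup>2)
           = (norm (of_real (r\<^sup>2) - cnj w * z))\<^sup>2 - r\<^sup>2 * (norm (z - w))\<^sup>2"
  unfolding cmod_power2 by (simp add: power2_eq_square algebra_simps)

text \<open>
  The minimum modulus principle: otherwise \<open>1/P\<close> would have a strict local maximum of its modulus.
\<close>
lemma norm_le_near_if_nonzero:
  assumes "open U" "z0 \<in> U" "P holomorphic_on U" "\<And>z. z \<in> U \<Longrightarrow> P z \<noteq> 0"
  shows "\<exists>z\<in>U. z \<noteq> z0 \<and> norm (P z) \<le> norm (P z0)"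
proof (rule ccontr)
  assume "\<not> ?thesis"
  hence gt: "\<And>z. z \<in> U \<Longrightarrow> z \<noteq> z0 \<Longrightarrow> norm (P z0) < norm (P z)"
    by force
  obtain e where e: "e > 0" "ball z0 e \<subseteq> U"
    using assms(1,2) by (meson openE)
  have "(\<lambda>z. inverse (P z)) constant_on ball z0 e"
  proof (rule maximum_modulus_principle[where U = "ball z0 e" and \<xi> = z0])
    show "(\<lambda>z. inverse (P z)) holomorphic_on ball z0 e"
      using assms(3,4) e by (intro holomorphic_on_inverse) (auto)
    show "norm (inverse (P z)) \<le> norm (inverse (P z0))" if "z \<in> ball z0 e" for z
    proof -
      have "norm (P z0) \<le> norm (P z)"
        using gt[of z] that e by (cases "z = z0") auto
      thus ?thesis
        using assms(2,4) by (simp add: norm_inverse le_imp_inverse_le)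
    qed
  qed (use e in auto)
  then obtain c where c: "\<And>z. z \<in> ball z0 e \<Longrightarrow> inverse (P z) = c"
    by (auto simp: constant_on_def)
  define z1 where "z1 = z0 + of_real (e / 2)"
  have z1: "z1 \<in> ball z0 e" "z1 \<noteq> z0"
    using e by (auto simp: z1_def dist_norm)
  have "inverse (P z1) = inverse (P z0)"
    using c[of z1] c[of z0] z1 e by simp
  hence "P z1 = P z0" by simp
  thus False using gt[of z1] z1 e by auto
qed

text \<open>
  The Laplacian of the logarithm of a hyperbolic density is proportional to the square of the density,
  which excludes a minimum \<open>q < 1\<close> of a quotient of two densities. Concretely: in coordinates centred at \<open>z0\<close> and
  \<open>f z0\<close>, the quotient is the modulus of a zero-free holomorphic function \<open>P\<close> times
  \<open>(1 - s\<^sup>2) / (1 - t\<^sup>2)\<close>, where \<open>s\<close> and \<open>t\<close> are the pseudo-hyperbolic distances of \<open>z\<close> to \<open>z0\<close> and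
  of \<open>f z\<close> to \<open>f z0\<close>. As \<open>t/s\<close> tends to \<open>q < 1\<close>, the second factor drops below 1 away from \<open>z0\<close>, and
  the first one does not increase in some direction.
\<close>
lemma hyperbolic_deriv_at_minimum:
  assumes "open U" "z0 \<in> U" "f holomorphic_on U" and r: "0 < r" "0 < R"
    and nz: "\<And>z. z \<in> U \<Longrightarrow> deriv f z \<noteq> 0"
    and dom: "\<And>z. z \<in> U \<Longrightarrow> norm z < r" and ran: "\<And>z. z \<in> U \<Longrightarrow> norm (f z) < R"
    and min: "\<And>z. z \<in> U \<Longrightarrow> hyperbolic_deriv r R f z0 \<le> hyperbolic_deriv r R f z"
  shows "1 \<le> hyperbolic_deriv r R f z0"
proof (rule ccontr)
  define q where "q = hyperbolic_deriv r R f z0"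
  assume "\<not> ?thesis"
  hence q1: "q < 1" by (simp add: q_def)
  define A where "A = (\<lambda>z. of_real (r\<^sup>2) - cnj z0 * z)"
  define B where "B = (\<lambda>z. of_real (R\<^sup>2) - cnj (f z0) * f z)"
  define P where "P = (\<lambda>z. deriv f z * (A z / B z)\<^sup>2)"
  have sqlt: "(norm z)\<^sup>2 < r\<^sup>2" "(norm (f z))\<^sup>2 < R\<^sup>2" if "z \<in> U" for z
    using dom[OF that] ran[OF that] by (simp_all add: power_strict_mono)
  have A0: "norm (A z) \<noteq> 0" if "z \<in> U" for z
    using disc_metric_identity[of r z z0] sqlt[OF that] sqlt[OF assms(2)] r
    unfolding A_def by (smt (verit, del_insts) mult_pos_pos zero_eq_power2 zero_le_mult_iff zero_le_power2)
  have B0: "norm (B z) \<noteq> 0" if "z \<in> U" for z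
    using disc_metric_identity[of R "f z" "f z0"] sqlt[OF that] sqlt[OF assms(2)] r
    unfolding B_def by (smt (verit, del_insts) mult_pos_pos zero_eq_power2 zero_le_mult_iff zero_le_power2)
  have Az0: "A z0 = of_real (r\<^sup>2 - (norm z0)\<^sup>2)" "B z0 = of_real (R\<^sup>2 - (norm (f z0))\<^sup>2)"
    unfolding A_def B_def of_real_diff complex_norm_square by (simp_all only: mult.commute)
  have nA: "norm (A z0) = r\<^sup>2 - (norm z0)\<^sup>2" "norm (B z0) = R\<^sup>2 - (norm (f z0))\<^sup>2"
    unfolding Az0 using sqlt[OF assms(2)] by (simp_all only: norm_of_real)
  have holA: "A holomorphic_on U" "B holomorphic_on U"
    unfolding A_def B_def using assms(3) by (auto intro!: holomorphic_intros)
  have holP: "P holomorphic_on U"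
    unfolding P_def using assms(1,3) holA B0
    by (auto intro!: holomorphic_intros holomorphic_deriv)
  have P0: "P z \<noteq> 0" if "z \<in> U" for z
    using nz[OF that] A0[OF that] B0[OF that] by (auto simp: P_def)
  \<comment> \<open>the ratio of the pseudo-hyperbolic distances tends to q\<close>
  have dq: "((\<lambda>z. norm ((f z - f z0) / (z - z0)) * norm (A z) / norm (B z) * (R / r)) \<longlongrightarrow> q) (at z0)"
  proof -
    have "(f has_field_derivative deriv f z0) (at z0)"
      using assms(1-3) holomorphic_derivI by blast
    hence 1: "((\<lambda>z. (f z - f z0) / (z - z0)) \<longlongrightarrow> deriv f z0) (at z0)"
      by (simp add: has_field_derivative_iff)
    have "isCont A z0" "isCont B z0"
      using holA assms(1,2) by (meson continuous_on_eq_continuous_at holomorphic_on_imp_continuous_on)+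
    hence 2: "(A \<longlongrightarrow> A z0) (at z0)" "(B \<longlongrightarrow> B z0) (at z0)"
      by (simp_all add: isCont_def)
    have "q = norm (deriv f z0) * norm (A z0) / norm (B z0) * (R / r)"
      using r unfolding q_def hyperbolic_deriv_def nA by (simp add: field_simps)
    thus ?thesis
      using B0[OF assms(2)] r by (auto intro!: tendsto_intros 1 2)
  qed
  define h where "h = (\<lambda>z. norm ((f z - f z0) / (z - z0)) * norm (A z) / norm (B z) * (R / r))"
  have "eventually (\<lambda>z. h z < 1) (at z0)"
    unfolding h_def by (rule order_tendstoD(2)[OF dq q1])
  then obtain \<delta> where \<delta>: "\<delta> > 0" "\<And>z. z \<noteq> z0 \<Longrightarrow> dist z z0 < \<delta> \<Longrightarrow> h z < 1"
    unfolding eventually_at by blast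
  define V where "V = ball z0 \<delta>"
  have V: "open V" "z0 \<in> V" "\<And>z. z \<in> V \<Longrightarrow> z \<noteq> z0 \<Longrightarrow> h z < 1"
    using \<delta> by (auto simp: V_def dist_commute)
  obtain z where z: "z \<in> U \<inter> V" "z \<noteq> z0" "norm (P z) \<le> norm (P z0)"
  proof -
    have "\<exists>z\<in>U \<inter> V. z \<noteq> z0 \<and> norm (P z) \<le> norm (P z0)"
      using assms(1,2) V P0 by (intro norm_le_near_if_nonzero) (auto intro: holomorphic_on_subset[OF holP])
    thus ?thesis using that by blast
  qed
  define s where "s = r * norm (z - z0) / norm (A z)"
  define t where "t = R * norm (f z - f z0) / norm (B z)"
  have zU: "z \<in> U" using z by simp
  have s0: "s > 0" using z r A0[OF zU] by (simp add: s_def)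
  have ts: "t < s"
  proof -
    have "t / s < 1"
      using V(3)[of z] z unfolding s_def t_def h_def by (simp add: norm_divide field_simps)
    thus ?thesis using s0 by simp
  qed
  have t0: "t \<ge> 0" using r by (simp add: t_def)
  have id1: "(r\<^sup>2 - (norm z)\<^sup>2) * norm (A z0) = (norm (A z))\<^sup>2 * (1 - s\<^sup>2)"
  proof -
    have "(norm (A z))\<^sup>2 * s\<^sup>2 = r\<^sup>2 * (norm (z - z0))\<^sup>2"
      using A0[OF zU] by (simp add: s_def power_mult_distrib power_divide)
    thus ?thesis
      using disc_metric_identity[of r z z0] unfolding nA by (simp add: A_def right_diff_distrib)
  qed
  have id2: "(R\<^sup>2 - (norm (f z))\<^sup>2) * norm (B z0) = (norm (B z))\<^sup>2 * (1 - t\<^sup>2)"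
  proof -
    have "(norm (B z))\<^sup>2 * t\<^sup>2 = R\<^sup>2 * (norm (f z - f z0))\<^sup>2"
      using B0[OF zU] by (simp add: t_def power_mult_distrib power_divide)
    thus ?thesis
      using disc_metric_identity[of R "f z" "f z0"] unfolding nA by (simp add: B_def right_diff_distrib)
  qed
  have A00: "norm (A z0) > 0" "norm (B z0) > 0" using A0 B0 assms(2) by auto
  have s1: "s\<^sup>2 < 1"
  proof -
    have "0 < (norm (A z))\<^sup>2 * (1 - s\<^sup>2)"
      unfolding id1[symmetric] using A00 sqlt[OF zU] by simp
    thus ?thesis by (simp add: zero_less_mult_iff)
  qed
  have tt: "t\<^sup>2 < s\<^sup>2" using ts t0 by (simp add: power_strict_mono)
  define k where "k = R * norm (B z0) / (r * norm (A z0))"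
  have k0: "k > 0" using r A00 by (simp add: k_def)
  have "hyperbolic_deriv r R f z = norm (P z) * k * ((1 - s\<^sup>2) / (1 - t\<^sup>2))"
  proof -
    have e1: "r\<^sup>2 - (norm z)\<^sup>2 = (norm (A z))\<^sup>2 * (1 - s\<^sup>2) / norm (A z0)"
      using id1 A00 by (simp add: field_simps)
    have e2: "R\<^sup>2 - (norm (f z))\<^sup>2 = (norm (B z))\<^sup>2 * (1 - t\<^sup>2) / norm (B z0)"
      using id2 A00 by (simp add: field_simps)
    show ?thesis
      unfolding hyperbolic_deriv_def e1 e2 P_def k_def norm_mult norm_power norm_divide
      using A00 B0[OF zU] r by (simp add: field_simps)
  qed
  also have "\<dots> < norm (P z) * k * 1"
    using P0[OF zU] k0 s1 tt by (intro mult_strict_left_mono) auto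
  also have "\<dots> \<le> norm (P z0) * k"
    using z k0 by simp
  also have "\<dots> = hyperbolic_deriv r R f z0"
    unfolding hyperbolic_deriv_def P_def k_def norm_mult norm_power norm_divide nA[symmetric]
    using A00 r by (simp add: field_simps power2_eq_square)
  finally show False using min[OF zU] by simp
qed

text \<open>
  The minimum exists because the hyperbolic derivative tends to infinity where \<open>f z\<close> approaches the
  circle of radius \<open>R\<close>: the preimage of the closed disc of radius \<open>R\<close> is a compact subset of the disc
  of radius \<open>r\<close> without critical points.
\<close>
lemma hyperbolic_deriv_ge_1:
  assumes "f holomorphic_on UNIV" and r: "0 < r" "0 < R"
    and K: "\<And>z. norm (f z) \<le> R \<Longrightarrow> norm z < r \<and> deriv f z \<noteq> 0"
    and x: "norm (f x) < R"
  shows "1 \<le> hyperbolic_deriv r R f x"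
proof -
  define K where "K = {z. norm (f z) \<le> R}"
  define g where "g = (\<lambda>z. (r * (R\<^sup>2 - (norm (f z))\<^sup>2)) / (norm (deriv f z) * R * (r\<^sup>2 - (norm z)\<^sup>2)))"
  have contf: "continuous_on UNIV f" "continuous_on UNIV (deriv f)"
    using assms(1) by (auto intro!: holomorphic_on_imp_continuous_on holomorphic_deriv)
  have "compact K"
  proof -
    have "closed K" unfolding K_def by (intro closed_Collect_le continuous_intros contf)
    moreover have "bounded K" unfolding bounded_iff K_def using K by (meson less_imp_le mem_Collect_eq)
    ultimately show ?thesis by (simp add: compact_eq_bounded_closed)
  qed
  have den: "norm (deriv f z) * R * (r\<^sup>2 - (norm z)\<^sup>2) > 0" if "z \<in> K" for z
    using K[of z] that r by (auto simp: K_def power_strict_mono)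
  have "continuous_on K g"
    unfolding g_def using den
    by (intro continuous_intros continuous_on_subset[OF contf(1)] continuous_on_subset[OF contf(2)]) (auto simp: less_le)
  moreover have "x \<in> K" using x by (simp add: K_def)
  ultimately obtain z0 where z0: "z0 \<in> K" "\<And>z. z \<in> K \<Longrightarrow> g z \<le> g z0"
    using continuous_attains_sup[OF \<open>compact K\<close>, of g] by blast
  have gpos: "g z > 0" if "norm (f z) < R" for z
    unfolding g_def using den[of z] that r by (auto simp: K_def power_strict_mono intro!: divide_pos_pos)
  have "g z0 > 0" using gpos[OF x] z0(2)[OF \<open>x \<in> K\<close>] by simp
  hence "norm (f z0) < R"
    using z0(1) den[OF z0(1)] r unfolding g_def K_def by (cases "norm (f z0) = R") auto
  have inv: "hyperbolic_deriv r R f z = inverse (g z)" for z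
    unfolding hyperbolic_deriv_def g_def by simp
  have "1 \<le> hyperbolic_deriv r R f z0"
  proof (rule hyperbolic_deriv_at_minimum[where U = "{z. norm (f z) < R}"])
    show "open {z. norm (f z) < R}"
      by (intro open_Collect_less continuous_intros contf)
    show "hyperbolic_deriv r R f z0 \<le> hyperbolic_deriv r R f z" if "z \<in> {z. norm (f z) < R}" for z
      unfolding inv using that z0(2)[of z] gpos[of z] by (intro le_imp_inverse_le) (auto simp: K_def)
  qed (use assms \<open>norm (f z0) < R\<close> in \<open>auto intro: holomorphic_on_subset\<close>)
  also have "\<dots> \<le> hyperbolic_deriv r R f x"
    unfolding inv using z0(2)[OF \<open>x \<in> K\<close>] gpos[OF x] by (intro le_imp_inverse_le) auto
  finally show ?thesis .
qed

lemma deriv_funpow: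
  assumes "f holomorphic_on UNIV"
  shows "deriv (f ^^ m) z = (\<Prod>i<m. deriv f ((f ^^ i) z))"
proof -
  have f: "(f has_field_derivative deriv f x) (at x)" for x
    using assms by (simp add: holomorphic_derivI)
  have "((f ^^ m) has_field_derivative (\<Prod>i<m. deriv f ((f ^^ i) z))) (at z)"
  proof (induction m)
    case 0
    show ?case by (simp add: id_def)
  next
    case (Suc m)
    show ?case
      using DERIV_chain[OF f Suc] by (simp add: comp_def mult.commute)
  qed
  thus ?thesis by (rule DERIV_imp_deriv)
qed

lemma prod_telescope_cycle:
  fixes h :: "'a \<Rightarrow> real"
  assumes "(f ^^ m) z = z"
  shows "(\<Prod>i<m. h (f ((f ^^ i) z))) = (\<Prod>i<m. h ((f ^^ i) z))"
proof (cases m)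
  case 0
  thus ?thesis by simp
next
  case (Suc k)
  have fz: "f ((f ^^ k) z) = z" using assms Suc by simp
  have "(\<Prod>i<m. h (f ((f ^^ i) z))) = (\<Prod>i<k. h ((f ^^ Suc i) z)) * h z"
    by (simp add: Suc fz)
  also have "\<dots> = (\<Prod>i<m. h ((f ^^ i) z))"
    unfolding Suc prod.lessThan_Suc_shift by (simp add: mult.commute)
  finally show ?thesis .
qed

text \<open>
  Passing from the metric of the disc of radius \<open>r\<close> to that of the larger disc of radius \<open>R\<close> makes
  the expansion strict. Along a cycle the densities cancel, so that only the multiplier remains.
\<close>
lemma multiplier_gt_1_if_critical_values_outside:
  assumes hol: "f holomorphic_on UNIV" and r: "0 < r" "r < R"
    and K: "\<And>z. norm (f z) \<le> R \<Longrightarrow> norm z < r \<and> deriv f z \<noteq> 0"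
    and cyc: "m \<ge> 1" "(f ^^ m) z = z" and inside: "\<And>i. norm ((f ^^ i) z) < R"
  shows "norm (deriv (f ^^ m) z) > 1"
proof -
  define \<rho> where "\<rho> = (\<lambda>z::complex. R\<^sup>2 - (norm z)\<^sup>2)"
  have \<rho>: "\<rho> w > 0" if "norm w < R" for w
    using that by (simp add: \<rho>_def power_strict_mono)
  have step: "\<rho> (f w) < norm (deriv f w) * \<rho> w" if w: "norm w < R" "norm (f w) < R" for w
  proof -
    have 1: "norm (deriv f w) * R * (r\<^sup>2 - (norm w)\<^sup>2) \<ge> r * \<rho> (f w)"
      using hyperbolic_deriv_ge_1[OF hol r(1) _ K w(2)] r \<rho>[OF w(2)]
      by (simp add: hyperbolic_deriv_def \<rho>_def field_simps)
    have nz: "norm (deriv f w) > 0" using K[of w] w by simp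
    have "R * (r\<^sup>2 - (norm w)\<^sup>2) < r * \<rho> w"
    proof -
      have "r * \<rho> w - R * (r\<^sup>2 - (norm w)\<^sup>2) = (R - r) * (R * r + (norm w)\<^sup>2)"
        by (simp add: \<rho>_def power2_eq_square algebra_simps)
      moreover have "\<dots> > 0" using r by (intro mult_pos_pos add_pos_nonneg) auto
      ultimately show ?thesis by simp
    qed
    hence "norm (deriv f w) * (R * (r\<^sup>2 - (norm w)\<^sup>2)) < norm (deriv f w) * (r * \<rho> w)"
      using nz by simp
    with 1 have "r * \<rho> (f w) < r * (norm (deriv f w) * \<rho> w)"
      by (simp add: mult_ac)
    thus ?thesis using r by simp
  qed
  have in': "norm (f ((f ^^ i) z)) < R" for i using inside[of "Suc i"] by simp
  have nzd: "norm (deriv f ((f ^^ i) z)) > 0" for i using K[of "(f ^^ i) z"] in'[of i] by simp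
  have "(\<Prod>i<m. \<rho> (f ((f ^^ i) z))) < (\<Prod>i<m. norm (deriv f ((f ^^ i) z)) * \<rho> ((f ^^ i) z))"
    using cyc(1) inside[of 0] in'[of 0]
    by (intro prod_mono_strict[where i = 0]) (auto intro!: step inside in' less_imp_le[OF \<rho>] less_imp_le[OF step] \<rho> mult_pos_pos nzd)
  also have "\<dots> = norm (deriv (f ^^ m) z) * (\<Prod>i<m. \<rho> ((f ^^ i) z))"
    by (simp add: deriv_funpow[OF hol] prod.distrib prod_norm)
  finally have "1 * (\<Prod>i<m. \<rho> ((f ^^ i) z)) < norm (deriv (f ^^ m) z) * (\<Prod>i<m. \<rho> ((f ^^ i) z))"
    unfolding prod_telescope_cycle[OF cyc(2)] by simp
  moreover have "(\<Prod>i<m. \<rho> ((f ^^ i) z)) > 0"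
    by (intro prod_pos) (auto intro: \<rho> inside)
  ultimately show ?thesis by (simp only: mult_less_cancel_right_pos)
qed

section \<open>Parabolic parameters in the complex plane\<close>

lemma fmap_holomorphic: "fmap d c holomorphic_on A"
  unfolding fmap_def by (intro holomorphic_intros)

lemma deriv_fmap: "deriv (fmap d c) z = of_nat (d + 1) * z ^ d + c"
  proof -
  have "((\<lambda>z. z ^ (d + 1)) has_field_derivative of_nat (d + 1) * z ^ d) (at z)"
    using DERIV_power[OF DERIV_ident, of "d + 1" z UNIV] by simp
  from DERIV_add[OF this DERIV_cmult[OF DERIV_ident, of c]] show ?thesis
    unfolding fmap_def by (intro DERIV_imp_deriv) simp
qed

text \<open>
  An orbit that starts outside the disc has strictly increasing norms and never returns.
\<close>
lemma periodic_point_norm_less: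
  assumes R: "R > 0" and out: "\<And>w. R \<le> norm w \<Longrightarrow> norm w < norm (f w)"
    and cyc: "m \<ge> 1" "(f ^^ m) z = z"
  shows "norm (z::complex) < R"
proof (rule ccontr)
  assume z: "\<not> norm z < R"
  have "norm z \<le> norm ((f ^^ i) z) \<and> (i > 0 \<longrightarrow> norm z < norm ((f ^^ i) z))" for i
  proof (induction i)
    case (Suc i)
    thus ?case using out[of "(f ^^ i) z"] z by auto
  qed auto
  from this[of m] cyc show False by auto
qed

text \<open>
  The bound is the threshold above which the \<open>d\<close>-th power of the modulus of every critical value
  exceeds \<open>2|c|\<close>.
\<close>
theorem norm_parabolic_parameter_le:
  assumes d: "d \<ge> 1" and par: "parabolic_periodic_point (fmap d c) z"
  shows "norm c \<le> (2 * real d + 2) powr (1 / real d) * (real d + 1) / real d"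
proof (rule ccontr)
  define f where "f = fmap d c"
  define x where "x = norm c"
  assume "\<not> ?thesis"
  hence "(2 * real d + 2) powr (1 / real d) < x * real d / (real d + 1)"
    using d by (simp add: x_def not_le pos_divide_less_eq pos_less_divide_eq)
  hence "((2 * real d + 2) powr (1 / real d)) ^ d < (x * real d / (real d + 1)) ^ d"
    using d by (intro power_strict_mono) auto
  hence big: "2 * real d + 2 < (x * real d / (real d + 1)) ^ d"
    using d by (simp add: powr_realpow[symmetric] powr_powr)
  have x1: "x > 1"
  proof (rule ccontr)
    assume "\<not> x > 1"
    hence "x * real d \<le> 1 * real d" by (intro mult_right_mono) auto
    hence "x * real d / (real d + 1) \<le> 1" by (simp add: divide_le_eq)
    hence "(x * real d / (real d + 1)) ^ d \<le> 1"
      by (intro power_le_one) (auto simp: x_def)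
    thus False using big by simp
  qed
  \<comment> \<open>R^d = 2|c| exceeds |c| + 1, so cycles stay inside; every critical value has modulus above R\<close>
  define R where "R = root d (2 * x)"
  have Rd: "R ^ d = 2 * x" and R0: "R > 0"
    using d x1 by (auto simp: R_def)
  have f_norm: "norm (f w) \<ge> norm w * x" if "R \<le> norm w" "norm w * x > norm w" for w
  proof -
    have "norm (w ^ d) \<ge> 2 * x"
      using that(1) R0 unfolding Rd[symmetric] norm_power by (intro power_mono) auto
    hence "x \<le> norm (w ^ d + c)"
      using norm_diff_ineq[of "w ^ d" c] unfolding x_def by linarith
    hence "norm w * x \<le> norm w * norm (w ^ d + c)" by (intro mult_left_mono) auto
    also have "\<dots> = norm (f w)" proof -
      have "f w = w * (w ^ d + c)" by (simp add: f_def fmap_def algebra_simps)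
      thus ?thesis by (simp add: norm_mult)
    qed
    finally show ?thesis .
  qed
  have out: "norm w < norm (f w)" if "R \<le> norm w" for w
  proof -
    have "norm w > 0" using that R0 by linarith
    hence "norm w * 1 < norm w * x" using x1 by (intro mult_strict_left_mono) auto
    thus ?thesis using f_norm[of w] that by simp
  qed
  have crit: "norm (f w) > R" if "deriv f w = 0" for w
  proof -
    have "of_nat (d + 1) * w ^ d = - c"
      using that by (simp add: f_def deriv_fmap add_eq_0_iff2 del: of_nat_add)
    hence c: "c = - (of_nat (d + 1) * w ^ d)" by simp
    have wd: "norm w ^ d = x / (real d + 1)"
    proof -
      have "x = norm (of_nat (d + 1) * w ^ d)" unfolding x_def c norm_minus_cancel ..
      also have "\<dots> = (real d + 1) * norm w ^ d"
        unfolding norm_mult norm_power norm_of_nat by simp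
      finally show ?thesis by (simp add: field_simps)
    qed
    have "f w = - (of_nat d * (w ^ d * w))"
      by (simp add: f_def fmap_def c algebra_simps)
    hence "norm (f w) = real d * (norm w ^ d * norm w)"
      by (simp add: norm_mult norm_power)
    hence "norm (f w) = (x * real d / (real d + 1)) * norm w"
      unfolding wd by simp
    hence "norm (f w) ^ d = (x * real d / (real d + 1)) ^ d * (x / (real d + 1))"
      by (simp only: power_mult_distrib wd)
    also have "\<dots> > (2 * real d + 2) * (x / (real d + 1))"
      using big x1 by (intro mult_strict_right_mono) auto
    also have "(2 * real d + 2) * (x / (real d + 1)) = R ^ d"
      unfolding Rd by (simp add: field_simps)
    finally show ?thesis by (rule power_less_imp_less_base) auto
  qed
  define K where "K = {w. norm (f w) \<le> R}"
  have contf: "continuous_on UNIV f"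
    unfolding f_def by (rule holomorphic_on_imp_continuous_on[OF fmap_holomorphic])
  have KR: "norm w < R" if "w \<in> K" for w
    using out[of w] that by (force simp: K_def)
  have "compact K"
  proof -
    have "closed K" unfolding K_def by (intro closed_Collect_le continuous_intros contf)
    moreover have "bounded K" unfolding bounded_iff using KR by (meson less_imp_le)
    ultimately show ?thesis by (simp add: compact_eq_bounded_closed)
  qed
  moreover have "0 \<in> K" using R0 by (simp add: K_def f_def fmap_def)
  ultimately obtain w0 where w0: "w0 \<in> K" "\<And>w. w \<in> K \<Longrightarrow> norm w \<le> norm w0"
    using continuous_attains_sup[of K norm] by (auto intro: continuous_intros)
  \<comment> \<open>w0 is a point of largest modulus in the preimage of the disc\<close>
  define r where "r = (norm w0 + R) / 2"
  have r: "0 < r" "r < R" using KR[OF w0(1)] R0 by (auto simp: r_def add_nonneg_pos)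
  have Kr: "norm w < r \<and> deriv f w \<noteq> 0" if "norm (f w) \<le> R" for w
    using w0(2)[of w] KR[OF w0(1)] crit[of w] that by (auto simp: r_def K_def)
  obtain m n where m: "m \<ge> 1" "(f ^^ m) z = z" and n: "n \<ge> 1" "(deriv (f ^^ m) z) ^ n = 1"
    using par unfolding parabolic_periodic_point_def root_of_unity_def f_def by blast
  have per: "(f ^^ m) ((f ^^ i) z) = (f ^^ i) z" for i
    by (metis add.commute comp_apply funpow_add m(2))
  have "norm (deriv (f ^^ m) z) > 1"
    by (rule multiplier_gt_1_if_critical_values_outside[OF _ r Kr m])
      (auto simp: f_def[symmetric] intro: periodic_point_norm_less[OF R0 out m(1) per] fmap_holomorphic[of d c, folded f_def])
  hence "norm (deriv (f ^^ m) z) ^ n > 1" using n(1) by (simp add: one_less_power)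
  thus False using n(2) by (simp flip: norm_power)
qed

section \<open>Valuation rings and integrality\<close>

definition is_subring :: "'a::comm_ring_1 set \<Rightarrow> bool" where
  "is_subring B \<longleftrightarrow> 1 \<in> B \<and> (\<forall>a\<in>B. \<forall>b\<in>B. a - b \<in> B \<and> a * b \<in> B)"

lemma is_subringD:
  assumes "is_subring B"
  shows "0 \<in> B" "1 \<in> B" "a \<in> B \<Longrightarrow> b \<in> B \<Longrightarrow> a - b \<in> B" "a \<in> B \<Longrightarrow> b \<in> B \<Longrightarrow> a + b \<in> B"
    "a \<in> B \<Longrightarrow> b \<in> B \<Longrightarrow> a * b \<in> B" "a \<in> B \<Longrightarrow> - a \<in> B" "a \<in> B \<Longrightarrow> a ^ n \<in> B" "of_nat n \<in> B"
proof -
  have sub: "a - b \<in> B" "a * b \<in> B" if "a \<in> B" "b \<in> B" for a b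
    using assms that by (auto simp: is_subring_def)
  show 1: "1 \<in> B" using assms by (simp add: is_subring_def)
  show 0: "0 \<in> B" using sub(1)[OF 1 1] by simp
  show minus: "- a \<in> B" if "a \<in> B" for a using sub(1)[OF 0 that] by simp
  show add: "a + b \<in> B" if "a \<in> B" "b \<in> B" for a b using sub(1)[OF that(1) minus[OF that(2)]] by simp
  show "a - b \<in> B" "a * b \<in> B" if "a \<in> B" "b \<in> B" using sub that by auto
  show "a ^ n \<in> B" if "a \<in> B" using that by (induction n) (auto intro: sub 1)
  show "of_nat n \<in> B" by (induction n) (auto intro: add 0 1)
qed

lemma is_subring_sum:
  assumes "is_subring B" "\<And>i. i \<in> A \<Longrightarrow> g i \<in> B"
  shows "sum g A \<in> B"
  using assms(2) by (induction A rule: infinite_finite_induct) (auto intro: is_subringD[OF assms(1)])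

definition adjoin :: "'a::comm_ring_1 set \<Rightarrow> 'a \<Rightarrow> 'a set" where
  "adjoin B u = {poly q u | q. \<forall>i. coeff q i \<in> B}"

lemma adjoin:
  assumes "is_subring B"
  shows "is_subring (adjoin B u)" "B \<subseteq> adjoin B u" "u \<in> adjoin B u"
proof -
  note B = is_subringD[OF assms]
  show sub: "B \<subseteq> adjoin B u"
  proof
    fix b assume "b \<in> B"
    hence "poly [:b:] u \<in> adjoin B u"
      unfolding adjoin_def using B(1) by (auto simp: coeff_pCons split: nat.splits intro!: exI[of _ "[:b:]"])
    thus "b \<in> adjoin B u" by simp
  qed
  have "poly [:0, 1:] u \<in> adjoin B u"
    unfolding adjoin_def using B(1,2) by (auto simp: coeff_pCons split: nat.splits intro!: exI[of _ "[:0, 1:]"])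
  thus "u \<in> adjoin B u" by simp
  have "a - b \<in> adjoin B u \<and> a * b \<in> adjoin B u" if ab: "a \<in> adjoin B u" "b \<in> adjoin B u" for a b
  proof -
    obtain p q where p: "a = poly p u" "\<And>i. coeff p i \<in> B" and q: "b = poly q u" "\<And>i. coeff q i \<in> B"
      using ab unfolding adjoin_def by blast
    have "\<And>i. coeff (p - q) i \<in> B" "\<And>i. coeff (p * q) i \<in> B"
      using p q B by (auto simp: coeff_mult intro!: is_subring_sum[OF assms])
    moreover have "a - b = poly (p - q) u" "a * b = poly (p * q) u" using p q by auto
    ultimately show ?thesis unfolding adjoin_def by blast
  qed
  thus "is_subring (adjoin B u)"
    using sub B(2) by (auto simp: is_subring_def)
qed

definition valuation_subring :: "'a::field set \<Rightarrow> bool" where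
  "valuation_subring V \<longleftrightarrow> is_subring V \<and> (\<forall>u. u \<in> V \<or> inverse u \<in> V)"

text \<open>
  By maximality, every \<open>u\<close> outside \<open>B\<close> satisfies a relation \<open>x = p(u)\<close> with coefficients in \<open>B\<close>. If
  neither \<open>u\<close> nor its inverse is in \<open>B\<close>, there are such relations for both. After division by \<open>x\<close> the
  one of lower degree can be solved for the highest power of \<open>u\<close> (or \<open>1/u\<close>), because the elements
  \<open>1 - b/x\<close> are units of \<open>B\<close>, and it reduces the degree of the other one; this descent does not end.
\<close>
lemma maximal_subring_avoiding_is_valuation_subring:
  fixes x :: "'a::field"
  assumes B: "is_subring B" and x: "x \<notin> B" "inverse x \<in> B"
    and max: "\<And>C. is_subring C \<Longrightarrow> B \<subseteq> C \<Longrightarrow> x \<notin> C \<Longrightarrow> C = B"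
  shows "valuation_subring B"
proof -
  note cl = is_subringD[OF B]
  define y where "y = inverse x"
  have x0: "x \<noteq> 0" using x cl(1) by auto
  have y: "y \<in> B" "x * y = 1" using x x0 by (auto simp: y_def)
  have grow: "\<exists>q. (\<forall>i. coeff q i \<in> B) \<and> poly q u = x" if "u \<notin> B" for u
  proof -
    have "adjoin B u \<noteq> B" using adjoin(3)[OF B, of u] that by auto
    hence "x \<in> adjoin B u" using max adjoin[OF B, of u] by blast
    thus ?thesis unfolding adjoin_def by blast
  qed
  have unit: "inverse (1 - y * b) \<in> B" "1 - y * b \<noteq> 0" if b: "b \<in> B" for b
  proof -
    define t where "t = 1 - y * b"
    show t0: "1 - y * b \<noteq> 0"
    proof
      assume "1 - y * b = 0"
      hence "x * (y * b) = x" by simp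
      hence "b = x" using y(2) by (simp flip: mult.assoc)
      thus False using b x by simp
    qed
    show "inverse (1 - y * b) \<in> B"
    proof (rule ccontr)
      assume "inverse (1 - y * b) \<notin> B"
      then obtain q where q: "\<And>i. coeff q i \<in> B" "poly q (inverse t) = x"
        using grow[of "inverse t"] unfolding t_def by blast
      have tB: "t \<in> B" unfolding t_def using y b by (intro cl)
      have "\<exists>b'\<in>B. t ^ k = 1 - y * b'" for k
      proof (induction k)
        case 0
        show ?case using cl(1) by (intro bexI[of _ 0]) auto
      next
        case (Suc k)
        then obtain b' where b': "b' \<in> B" "t ^ k = 1 - y * b'" by blast
        have "t ^ Suc k = t * (1 - y * b')" by (simp add: b')
        also have "\<dots> = 1 - y * (b + b' - y * b * b')"
          by (simp add: t_def algebra_simps)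
        finally have "t ^ Suc k = 1 - y * (b + b' - y * b * b')" .
        thus ?case using b b' y cl by (intro bexI[of _ "b + b' - y * b * b'"]) auto
      qed
      then obtain b' where b': "b' \<in> B" "t ^ degree q = 1 - y * b'" by blast
      have "t \<noteq> 0" using t0 by (simp add: t_def)
      hence "poly (reflect_poly q) t = t ^ degree q * x"
        using q(2) by (simp add: poly_reflect_poly_nz)
      also have "\<dots> = x - b'"
        using y(2) by (simp add: b' algebra_simps)
      finally have "x = poly (reflect_poly q) t + b'" by simp
      moreover have "poly (reflect_poly q) t \<in> B"
        unfolding poly_altdef
        by (intro is_subring_sum[OF B] cl tB) (auto simp: coeff_reflect_poly q(1) cl(1))
      ultimately show False using x b' cl(4) by blast
    qed
  qed
  have red: "\<exists>p'. (\<forall>i. coeff p' i \<in> B) \<and> poly p' u = x \<and> degree p' < degree p"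
    if u: "u \<noteq> 0" and p: "\<And>i. coeff p i \<in> B" "poly p u = x" "degree q \<le> degree p"
      and q: "\<And>i. coeff q i \<in> B" "poly q (inverse u) = x" for p q u
  proof -
    define n where "n = degree q"
    define m where "m = degree p"
    have n: "n > 0"
    proof (rule ccontr)
      assume "\<not> n > 0"
      then obtain a where "q = [:a:]" by (metis n_def degree_eq_zeroE gr0I)
      thus False using q(1)[of 0] q(2) x by simp
    qed
    define t where "t = inverse (1 - y * coeff q 0)"
    have tB: "t \<in> B" "t * (1 - y * coeff q 0) = 1"
      using unit[OF q(1)[of 0]] by (auto simp: t_def)
    define r where "r = smult (t * y) (reflect_poly q - monom (coeff q 0) n)"
    have rB: "coeff r i \<in> B" for i
      using tB y q(1) cl by (auto simp: r_def coeff_reflect_poly)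
    have r_n: "coeff r i = 0" if "i \<ge> n" for i
      using that by (auto simp: r_def coeff_reflect_poly n_def)
    have ru: "poly r u = u ^ n"
    proof -
      have "poly r u = t * y * (u ^ n * x - coeff q 0 * u ^ n)"
        using u q(2) by (simp add: r_def poly_reflect_poly_nz poly_monom n_def)
      also have "\<dots> = t * (x * y - y * coeff q 0) * u ^ n" by (simp add: algebra_simps)
      also have "\<dots> = u ^ n" using tB y by simp
      finally show ?thesis .
    qed
    define p' where "p' = p - monom (coeff p m) m + smult (coeff p m) (monom 1 (m - n) * r)"
    have nm: "n \<le> m" using p(3) by (simp add: n_def m_def)
    have "coeff p' i \<in> B" for i
      using p(1) rB cl by (auto simp: p'_def coeff_monom_mult)
    moreover have "poly p' u = x"
      using p(2) nm by (simp add: p'_def poly_monom ru flip: power_add)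
    moreover have "degree p' < m"
    proof -
      have "coeff p' i = 0" if "i \<ge> m" for i
        using that nm n r_n by (cases "i = m") (auto simp: p'_def coeff_monom_mult coeff_eq_0 m_def)
      hence "degree p' \<le> m - 1" by (intro degree_le) (use nm n in auto)
      thus ?thesis using nm n by linarith
    qed
    ultimately show ?thesis unfolding m_def by blast
  qed
  have no_pair: False if "u \<noteq> 0" "\<And>i. coeff p i \<in> B" "poly p u = x"
    "\<And>i. coeff q i \<in> B" "poly q (inverse u) = x" for p q u
    using that
  proof (induction "degree p + degree q" arbitrary: p q u rule: less_induct)
    case less
    show False
    proof (cases "degree q \<le> degree p")
      case True
      then obtain p' where "\<forall>i. coeff p' i \<in> B" "poly p' u = x" "degree p' < degree p"
        using red[of u p q] less.prems by blast
      thus False using less.hyps[of p' q u] less.prems by auto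
    next
      case False
      then obtain q' where "\<forall>i. coeff q' i \<in> B" "poly q' (inverse u) = x" "degree q' < degree q"
        using red[of "inverse u" q p] less.prems by auto
      thus False using less.hyps[of p q' u] less.prems by auto
    qed
  qed
  have "u \<in> B \<or> inverse u \<in> B" for u
  proof (rule ccontr)
    assume "\<not> ?thesis"
    moreover from this have "u \<noteq> 0" using cl(1) by auto
    ultimately show False using grow[of u] grow[of "inverse u"] no_pair[of u] by blast
  qed
  thus ?thesis using B by (auto simp: valuation_subring_def)
qed

text \<open>
  \<open>x\<close> is integral if and only if it is a polynomial in \<open>1/x\<close> with integer coefficients. Otherwise
  Zorn's lemma yields a maximal subring that contains \<open>1/x\<close> but not \<open>x\<close>.
\<close>
theorem not_algebraic_int_imp_valuation_subring:
  fixes x :: "'a::field_char_0"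
  assumes "\<not> algebraic_int x"
  obtains V where "valuation_subring V" "x \<notin> V"
proof -
  have x0: "x \<noteq> 0" using assms by auto
  define B0 where "B0 = adjoin (range (of_int :: int \<Rightarrow> 'a)) (inverse x)"
  have Z: "is_subring (range (of_int :: int \<Rightarrow> 'a))"
    unfolding is_subring_def by (auto simp flip: of_int_diff of_int_mult intro: rev_image_eqI[of 1])
  have B0: "is_subring B0" "inverse x \<in> B0" unfolding B0_def by (intro adjoin Z)+
  have "x \<notin> B0"
  proof
    assume "x \<in> B0"
    then obtain q where q: "\<And>i. coeff q i \<in> range (of_int :: int \<Rightarrow> 'a)" "poly q (inverse x) = x"
      unfolding B0_def adjoin_def mem_Collect_eq by metis
    define n where "n = degree q"
    define r where "r = monom 1 (Suc n) - reflect_poly q"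
    have c: "coeff r (Suc n) = 1" "\<And>i. i > Suc n \<Longrightarrow> coeff r i = 0"
      by (auto simp: r_def coeff_reflect_poly n_def)
    have "degree r = Suc n"
      by (rule antisym) (use c in \<open>auto intro!: degree_le le_degree\<close>)
    hence "lead_coeff r = 1" using c by simp
    moreover have "coeff r i \<in> \<int>" for i
      using q(1) by (auto simp: r_def coeff_reflect_poly Ints_def[symmetric] intro!: Ints_diff)
    moreover have "poly r x = 0"
      using x0 q(2) by (simp add: r_def poly_monom poly_reflect_poly_nz n_def)
    ultimately have "algebraic_int x" by (intro algebraic_int.intros) auto
    with assms show False by contradiction
  qed
  define \<F> where "\<F> = {B. is_subring B \<and> inverse x \<in> B \<and> x \<notin> B}"
  have "\<exists>M\<in>\<F>. \<forall>C\<in>\<F>. M \<subseteq> C \<longrightarrow> C = M"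
  proof (rule subset_Zorn_nonempty)
    show "\<F> \<noteq> {}" using B0 \<open>x \<notin> B0\<close> by (auto simp: \<F>_def)
    show "\<Union>\<C> \<in> \<F>" if \<C>: "\<C> \<noteq> {}" "subset.chain \<F> \<C>" for \<C>
    proof -
      have sub: "is_subring B" "inverse x \<in> B" "x \<notin> B" if "B \<in> \<C>" for B
        using \<C>(2) that by (auto simp: subset_chain_def \<F>_def)
      have "a - b \<in> \<Union>\<C> \<and> a * b \<in> \<Union>\<C>" if ab: "a \<in> \<Union>\<C>" "b \<in> \<Union>\<C>" for a b
      proof -
        obtain A B where AB: "a \<in> A" "A \<in> \<C>" "b \<in> B" "B \<in> \<C>" using ab by blast
        hence "A \<subseteq> B \<or> B \<subseteq> A" using \<C>(2) by (auto simp: subset_chain_def)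
        then obtain D where "D \<in> \<C>" "a \<in> D" "b \<in> D" using AB by blast
        thus ?thesis using is_subringD(3,5)[OF sub(1)] by blast
      qed
      moreover have "1 \<in> \<Union>\<C>" using \<C>(1) is_subringD(2)[OF sub(1)] by blast
      ultimately show ?thesis using sub \<C>(1) by (auto simp: \<F>_def is_subring_def)
    qed
  qed
  then obtain M where M: "M \<in> \<F>" "\<And>C. C \<in> \<F> \<Longrightarrow> M \<subseteq> C \<Longrightarrow> C = M" by blast
  have "valuation_subring M"
    by (rule maximal_subring_avoiding_is_valuation_subring[of M x]) (use M in \<open>auto simp: \<F>_def\<close>)
  moreover have "x \<notin> M" using M by (auto simp: \<F>_def)
  ultimately show ?thesis using that by blast
qed

context
  fixes V :: "'a::field set"
  assumes V: "valuation_subring V"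
begin

lemma valuation_subring_is_subring: "is_subring V"
  using V by (simp add: valuation_subring_def)

lemmas valuation_subring_closed = is_subringD[OF valuation_subring_is_subring]

lemma inverse_in_valuation_subring: "a \<notin> V \<Longrightarrow> inverse a \<in> V"
  using V by (auto simp: valuation_subring_def)

lemma mult_notin_valuation_subring:
  assumes "a \<notin> V" "b \<notin> V"
  shows "a * b \<notin> V"
proof
  assume "a * b \<in> V"
  hence "a * b * inverse b \<in> V" by (rule valuation_subring_closed(5)[OF _ inverse_in_valuation_subring[OF assms(2)]])
  moreover have "b \<noteq> 0" using assms(2) valuation_subring_closed(1) by auto
  ultimately show False using assms(1) by (simp add: mult.assoc)
qed

lemma prod_notin_valuation_subring:
  assumes "finite A" "A \<noteq> {}" "\<And>i. i \<in> A \<Longrightarrow> g i \<notin> V"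
  shows "prod g A \<notin> V"
  using assms by (induction A rule: finite_ne_induct) (simp_all add: mult_notin_valuation_subring)

lemma power_in_valuation_subringD:
  assumes "a ^ n \<in> V" "n \<ge> 1"
  shows "a \<in> V"
  using prod_notin_valuation_subring[of "{..<n}" "\<lambda>_. a"] assms by (auto simp: lessThan_empty_iff)

text \<open>
  For the absolute value attached to the valuation ring, \<open>z / w \<in> V\<close> means that \<open>|z| \<le> |w|\<close>.
\<close>
lemma exists_largest_wrt_valuation_subring:
  assumes "finite S" "S \<noteq> {}" "0 \<notin> S"
  shows "\<exists>w\<in>S. \<forall>z\<in>S. z / w \<in> V"
  using assms
proof (induction S rule: finite_ne_induct)
  case (singleton a)
  thus ?case using valuation_subring_closed(2) by auto
next
  case (insert a S)
  then obtain w where w: "w \<in> S" "\<And>z. z \<in> S \<Longrightarrow> z / w \<in> V" by auto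
  have nz: "a \<noteq> 0" "w \<noteq> 0" using insert w by auto
  show ?case
  proof (cases "a / w \<in> V")
    case True
    thus ?thesis using w by auto
  next
    case False
    hence wa: "w / a \<in> V" using inverse_in_valuation_subring[of "a / w"] by simp
    have "z / a \<in> V" if "z \<in> S" for z
      using valuation_subring_closed(5)[OF w(2)[OF that] wa] nz by simp
    thus ?thesis using nz valuation_subring_closed(2) by auto
  qed
qed

end

section \<open>Integrality of parabolic parameters\<close>

text \<open>
  The point 0 has multiplier \<open>c\<close>, so let the cycle consist of other points.
  Write \<open>|a| \<le> |b|\<close> for \<open>a / b \<in> V\<close>, where \<open>V\<close> is a valuation ring with \<open>|d c| > 1\<close>; then \<open>|c| > 1\<close> too.
  At the largest point \<open>w\<close> of a cycle, \<open>|w\<^sup>d + c| = |f w / w| \<le> 1\<close>, so \<open>|z|\<^sup>d \<le> |c|\<close> for all points \<open>z\<close> of the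
  cycle. If \<open>|f' z| \<le> 1\<close>, then \<open>|z|\<^sup>d \<ge> |c|\<close>, since otherwise \<open>c\<close> dominates \<open>f' z = (d + 1) z\<^sup>d + c\<close>. So
  \<open>|f z| \<le> |z|\<close>, that is \<open>|z\<^sup>d + c| \<le> 1\<close>, and \<open>d c = (d + 1) (z\<^sup>d + c) - f' z\<close> gives \<open>|d c| \<le> 1\<close>.
\<close>
theorem algebraic_int_parabolic_parameter:
  assumes d: "d \<ge> 1" and par: "parabolic_periodic_point (fmap d c) \<alpha>"
  shows "algebraic_int (of_nat d * c)"
proof (rule ccontr)
  assume "\<not> ?thesis"
  then obtain V where V: "valuation_subring V" and dc: "of_nat d * c \<notin> V"
    using not_algebraic_int_imp_valuation_subring by blast
  note cl = valuation_subring_closed[OF V]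
  define f where "f = fmap d c"
  have f: "f z = z * (z ^ d + c)" for z by (simp add: f_def fmap_def algebra_simps)
  have c: "c \<notin> V" using dc cl(5,8) by blast
  hence c0: "c \<noteq> 0" using cl(1) by auto
  have ic: "1 / c \<in> V" using inverse_in_valuation_subring[OF V c] by (simp add: divide_inverse)
  obtain m n where m: "m \<ge> 1" "(f ^^ m) \<alpha> = \<alpha>" and n: "n \<ge> 1" "(deriv (f ^^ m) \<alpha>) ^ n = 1"
    using par unfolding parabolic_periodic_point_def root_of_unity_def f_def by blast
  define S where "S = (\<lambda>i. (f ^^ i) \<alpha>) ` {..<m}"
  have S: "finite S" "S \<noteq> {}" using m by (auto simp: S_def lessThan_empty_iff)
  have fS: "f z \<in> S" if z: "z \<in> S" for z
  proof -
    obtain i where i: "i < m" "z = (f ^^ i) \<alpha>" using z unfolding S_def by blast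
    show ?thesis
    proof (cases "Suc i = m")
      case True
      hence "f z = (f ^^ 0) \<alpha>" using m(2) i by auto
      thus ?thesis unfolding S_def using m(1) by (intro image_eqI[of _ _ 0]) auto
    next
      case False
      thus ?thesis unfolding S_def using i by (intro image_eqI[of _ _ "Suc i"]) auto
    qed
  qed
  have "deriv f z \<notin> V" if z: "z \<in> S" for z
  proof (cases "0 \<in> S")
    case True
    then obtain i where i: "i < m" "(f ^^ i) \<alpha> = 0" by (auto simp: S_def)
    have f0: "(f ^^ k) 0 = 0" for k by (induction k) (auto simp: f)
    have "(f ^^ ((m - i) + i)) \<alpha> = 0"
      by (simp only: funpow_add o_apply i(2) f0)
    hence "\<alpha> = 0" using i(1) m(2) by simp
    hence "z = 0" using z f0 by (auto simp: S_def)
    thus ?thesis using c d by (simp add: f_def deriv_fmap power_0_left)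
  next
    case False
    obtain w where w: "w \<in> S" "\<And>z. z \<in> S \<Longrightarrow> z / w \<in> V"
      using exists_largest_wrt_valuation_subring[OF V S False] by blast
    have w0: "w \<noteq> 0" and z0: "z \<noteq> 0" using w(1) z False by auto
    have "w ^ d + c \<in> V" using w(2)[OF fS[OF w(1)]] w0 by (simp add: f)
    hence "(w ^ d + c) * (1 / c) - 1 \<in> V" by (rule cl(3)[OF cl(5)[OF _ ic] cl(2)])
    hence wc: "w ^ d / c \<in> V" using c0 by (simp add: field_simps)
    have zc: "z' ^ d / c \<in> V" if "z' \<in> S" for z'
    proof -
      have "(z' / w) ^ d * (w ^ d / c) \<in> V" using w(2)[OF that] wc by (intro cl)
      thus ?thesis using w0 by (simp add: power_divide)
    qed
    show ?thesis
    proof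
      assume "deriv f z \<in> V"
      hence D: "of_nat (d + 1) * z ^ d + c \<in> V" by (simp add: f_def deriv_fmap)
      have "c / z ^ d \<in> V"
      proof (rule ccontr)
        assume *: "c / z ^ d \<notin> V"
        have "1 / z ^ d \<notin> V"
        proof
          assume "1 / z ^ d \<in> V"
          hence "(of_nat (d + 1) * z ^ d + c) * (1 / z ^ d) - of_nat (d + 1) \<in> V"
            by (rule cl(3)[OF cl(5)[OF D] cl(8)])
          moreover have "(of_nat (d + 1) * z ^ d + c) * (1 / z ^ d) - of_nat (d + 1) = c / z ^ d"
            using z0 by (simp add: field_simps)
          ultimately show False using * by simp
        qed
        hence "z ^ d \<in> V" using inverse_in_valuation_subring[OF V, of "1 / z ^ d"] by simp
        hence "(of_nat (d + 1) * z ^ d + c) - of_nat (d + 1) * z ^ d \<in> V"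
          by (rule cl(3)[OF D cl(5)[OF cl(8)]])
        thus False using c by simp
      qed
      hence "(f z) ^ d / c * (c / z ^ d) \<in> V" by (rule cl(5)[OF zc[OF fS[OF z]]])
      hence "(f z / z) ^ d \<in> V" using c0 by (simp add: power_divide)
      hence "f z / z \<in> V" using power_in_valuation_subringD[OF V _ d] by blast
      hence "z ^ d + c \<in> V" using z0 by (simp add: f)
      hence "of_nat (d + 1) * (z ^ d + c) - (of_nat (d + 1) * z ^ d + c) \<in> V"
        by (rule cl(3)[OF cl(5)[OF cl(8)] D])
      moreover have "of_nat (d + 1) * (z ^ d + c) - (of_nat (d + 1) * z ^ d + c) = of_nat d * c"
        by (simp add: algebra_simps)
      ultimately show False using dc by simp
    qed
  qed
  hence "deriv (f ^^ m) \<alpha> \<notin> V"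
    unfolding deriv_funpow[OF fmap_holomorphic[of d c, folded f_def]]
    using m(1) by (intro prod_notin_valuation_subring[OF V]) (auto simp: S_def lessThan_empty_iff)
  moreover have "deriv (f ^^ m) \<alpha> \<in> V"
    using power_in_valuation_subringD[OF V _ n(1)] n(2) cl(2) by auto
  ultimately show False by contradiction
qed

section \<open>Conjugates of parabolic parameters\<close>

text \<open>
  The iterates of \<open>z\<^bsup>d+1\<^esup> + c z\<close> as polynomials over an arbitrary ring, so that \<open>c\<close> can be a number as
  well as an indeterminate.
\<close>
fun iterate_poly :: "nat \<Rightarrow> 'a::comm_ring_1 \<Rightarrow> nat \<Rightarrow> 'a poly" where
  "iterate_poly d c 0 = [:0, 1:]"
| "iterate_poly d c (Suc k) = iterate_poly d c k ^ (d + 1) + Polynomial.smult c (iterate_poly d c k)"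

lemma iterate_poly_monic:
  fixes c :: "'a::idom"
  assumes "d \<ge> 1"
  shows "degree (iterate_poly d c k) = (d + 1) ^ k" "lead_coeff (iterate_poly d c k) = 1"
proof -
  have "degree (iterate_poly d c k) = (d + 1) ^ k \<and> lead_coeff (iterate_poly d c k) = 1"
  proof (induction k)
    case (Suc k)
    let ?P = "iterate_poly d c k"
    have P0: "?P \<noteq> 0" using Suc by auto
    have deg: "degree (?P ^ (d + 1)) = (d + 1) ^ Suc k"
      using Suc P0 by (simp only: degree_power_eq[OF P0]) simp
    have "degree (Polynomial.smult c ?P) < degree (?P ^ (d + 1))"
    proof -
      have "degree (Polynomial.smult c ?P) \<le> (d + 1) ^ k"
        using Suc degree_smult_le[of c ?P] by simp
      also have "\<dots> < (d + 1) ^ Suc k" using assms by (intro power_strict_increasing) auto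
      finally show ?thesis using deg by simp
    qed
    moreover from this have "lead_coeff (?P ^ (d + 1) + Polynomial.smult c ?P) = lead_coeff ?P ^ (d + 1)"
      by (simp only: degree_add_eq_left coeff_add coeff_eq_0 lead_coeff_power add_0_right)
    moreover have "lead_coeff ?P = 1" using Suc by blast
    ultimately show ?case
      unfolding iterate_poly.simps deg[symmetric] by (metis degree_add_eq_left power_one)
  qed auto
  thus "degree (iterate_poly d c k) = (d + 1) ^ k" "lead_coeff (iterate_poly d c k) = 1" by auto
qed

lemma poly_iterate_poly: "poly (iterate_poly d c k) z = (fmap d c ^^ k) z"
  by (induction k) (auto simp: fmap_def)

lemma map_poly_iterate_poly:
  assumes "comm_ring_hom h"
  shows "map_poly h (iterate_poly d c k) = iterate_poly d (h c) k"
proof -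
  interpret comm_ring_hom h by fact
  interpret mp: map_poly_comm_ring_hom h ..
  show ?thesis
    by (induction k) (simp_all add: hom_distribs)
qed

definition periodic_poly :: "nat \<Rightarrow> nat \<Rightarrow> 'a::idom \<Rightarrow> 'a poly" where
  "periodic_poly d m c = iterate_poly d c m - [:0, 1:]"

definition multiplier_poly :: "nat \<Rightarrow> nat \<Rightarrow> nat \<Rightarrow> 'a::idom \<Rightarrow> 'a poly" where
  "multiplier_poly d m n c = pderiv (iterate_poly d c m) ^ n - 1"

lemma degree_periodic_poly:
  fixes c :: "'a::idom"
  assumes "d \<ge> 1" "m \<ge> 1"
  shows "degree (periodic_poly d m c) = (d + 1) ^ m"
proof -
  have "(1::nat) < (d + 1) ^ m" using assms by (intro one_less_power) auto
  hence "degree (- [:0, 1 :: 'a:]) < degree (iterate_poly d c m)"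
    using iterate_poly_monic(1)[OF assms(1), of c m] by simp
  thus ?thesis
    using iterate_poly_monic(1)[OF assms(1), of c m]
    unfolding periodic_poly_def diff_conv_add_uminus by (simp only: degree_add_eq_left)
qed

lemma degree_multiplier_poly:
  fixes c :: "'a::{idom,ring_char_0}"
  assumes "d \<ge> 1" "m \<ge> 1" "n \<ge> 1"
  shows "degree (multiplier_poly d m n c) = n * ((d + 1) ^ m - 1)"
proof -
  let ?Q = "pderiv (iterate_poly d c m)"
  have D: "degree ?Q = (d + 1) ^ m - 1"
    by (simp only: degree_pderiv iterate_poly_monic(1)[OF assms(1)])
  have pos: "(1::nat) < (d + 1) ^ m" using assms by (intro one_less_power) auto
  hence Q0: "?Q \<noteq> 0" using D by auto
  have "degree (?Q ^ n) = n * ((d + 1) ^ m - 1)"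
    by (simp only: degree_power_eq[OF Q0] D mult.commute)
  moreover from this have "degree (- (1 :: 'a poly)) < degree (?Q ^ n)"
    using pos assms(3) by simp
  ultimately show ?thesis
    unfolding multiplier_poly_def diff_conv_add_uminus by (simp only: degree_add_eq_left)
qed

text \<open>
  Specialization of the indeterminate parameter.
\<close>
lemma map_poly_periodic_multiplier_poly:
  assumes "comm_ring_hom h"
  shows "map_poly h (periodic_poly d m c) = periodic_poly d m (h c)"
    "map_poly h (multiplier_poly d m n c) = multiplier_poly d m n (h c)"
proof -
  interpret comm_ring_hom h by fact
  interpret mp: map_poly_comm_ring_hom h ..
  have pd: "map_poly h (pderiv p) = pderiv (map_poly h p)" for p
    by (rule poly_eqI) (simp add: coeff_pderiv coeff_map_poly hom_distribs)
  show "map_poly h (periodic_poly d m c) = periodic_poly d m (h c)"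
    "map_poly h (multiplier_poly d m n c) = multiplier_poly d m n (h c)"
    unfolding periodic_poly_def multiplier_poly_def
    by (simp_all add: mp.hom_minus mp.hom_power pd map_poly_iterate_poly[OF assms] map_poly_pCons_hom)
qed

definition parabolic_resultant :: "nat \<Rightarrow> nat \<Rightarrow> nat \<Rightarrow> int poly" where
  "parabolic_resultant d m n =
     resultant (periodic_poly d m [:0, 1:]) (multiplier_poly d m n [:0, 1:])"

text \<open>
  The degrees of both polynomials do not depend on \<open>c\<close>, so the resultant commutes with the
  specialization of the parameter, and it vanishes if and only if there is a common root.
\<close>
lemma poly_parabolic_resultant_eq_0_iff:
  fixes c :: complex
  assumes "d \<ge> 1" "m \<ge> 1" "n \<ge> 1"
  shows "poly (map_poly of_int (parabolic_resultant d m n)) c = 0 \<longleftrightarrow>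
           (\<exists>z. (fmap d c ^^ m) z = z \<and> deriv (fmap d c ^^ m) z ^ n = 1)"
proof -
  define h where "h = (\<lambda>q :: int poly. poly (map_poly of_int q) c)"
  have h: "comm_ring_hom h"
    unfolding h_def by unfold_locales (simp_all add: of_int_poly_hom.hom_mult of_int_poly_hom.hom_add)
  interpret h: comm_ring_hom h by (rule h)
  have hX: "h [:0, 1:] = c" by (simp add: h_def)
  define F where "F = periodic_poly d m c"
  define G where "G = multiplier_poly d m n c"
  have "h (parabolic_resultant d m n) = resultant F G"
    unfolding parabolic_resultant_def
    by (subst h.resultant_map_poly[symmetric])
       (simp_all only: map_poly_periodic_multiplier_poly[OF h] hX degree_periodic_poly[OF assms(1,2)]
          degree_multiplier_poly[OF assms] F_def G_def)
  hence "h (parabolic_resultant d m n) = 0 \<longleftrightarrow> degree (gcd F G) \<noteq> 0"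
    by (simp add: resultant_0_gcd)
  also have "\<dots> \<longleftrightarrow> (\<exists>z. poly F z = 0 \<and> poly G z = 0)"
  proof
    assume "degree (gcd F G) \<noteq> 0"
    then obtain z where "poly (gcd F G) z = 0"
      using Fundamental_Theorem_Algebra.fundamental_theorem_of_algebra[of "gcd F G"] by (auto simp: constant_degree)
    thus "\<exists>z. poly F z = 0 \<and> poly G z = 0"
      by (meson dvd_trans gcd_dvd1 gcd_dvd2 poly_eq_0_iff_dvd)
  next
    assume "\<exists>z. poly F z = 0 \<and> poly G z = 0"
    then obtain z where "[:-z, 1:] dvd gcd F G" by (auto simp: poly_eq_0_iff_dvd)
    moreover have "degree F \<noteq> 0"
      unfolding F_def degree_periodic_poly[OF assms(1,2)] by simp
    hence "gcd F G \<noteq> 0" by auto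
    ultimately show "degree (gcd F G) \<noteq> 0"
      using dvd_imp_degree_le[of "[:-z, 1:]" "gcd F G"] by auto
  qed
  finally have "h (parabolic_resultant d m n) = 0 \<longleftrightarrow> (\<exists>z. poly F z = 0 \<and> poly G z = 0)" .
  moreover have "poly F z = (fmap d c ^^ m) z - z" for z
    by (simp add: F_def periodic_poly_def poly_iterate_poly)
  moreover have "poly G z = deriv (fmap d c ^^ m) z ^ n - 1" for z
  proof -
    have "deriv (\<lambda>z. poly (iterate_poly d c m) z) z = poly (pderiv (iterate_poly d c m)) z"
      by (intro DERIV_imp_deriv poly_DERIV)
    thus ?thesis by (simp add: G_def multiplier_poly_def poly_iterate_poly[abs_def])
  qed
  ultimately show ?thesis by (simp add: h_def)
qed

section \<open>Powers modulo a monic polynomial\<close>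

text \<open>
  The remainder of \<open>X\<^sup>k\<close> modulo a monic \<open>p\<close> of positive degree, with the recursion made explicit: it shows in
  which ring the coefficients lie, and how fast they grow with \<open>k\<close>.
\<close>
primrec power_mod_poly :: "'a::comm_ring_1 poly \<Rightarrow> nat \<Rightarrow> 'a poly" where
  "power_mod_poly p 0 = 1"
| "power_mod_poly p (Suc k) =
     pCons 0 (power_mod_poly p k) - Polynomial.smult (coeff (power_mod_poly p k) (degree p - 1)) p"

lemma degree_power_mod_poly:
  assumes "lead_coeff p = 1" "degree p \<ge> 1"
  shows "degree (power_mod_poly p k) < degree p"
proof -
  have "degree (power_mod_poly p k) \<le> degree p - 1"
  proof (induction k)
    case (Suc k)
    let ?r = "power_mod_poly p k"
    have "coeff (power_mod_poly p (Suc k)) i = 0" if i: "i > degree p - 1" for i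
    proof (cases "i = degree p")
      case True
      thus ?thesis using assms by (auto simp: coeff_pCons split: nat.split)
    next
      case False
      hence "i - 1 > degree p - 1" "i > degree p" using i assms(2) by auto
      hence "coeff ?r (i - 1) = 0" "coeff p i = 0" using Suc by (auto intro: coeff_eq_0)
      thus ?thesis using i by (cases i) (auto simp: coeff_pCons)
    qed
    thus ?case by (intro degree_le) auto
  qed auto
  thus ?thesis using assms(2) by linarith
qed

lemma poly_power_mod_poly:
  assumes "poly p x = 0"
  shows "poly (power_mod_poly p k) x = x ^ k"
  by (induction k) (simp_all add: assms)

lemma coeff_power_mod_poly_in_subring:
  assumes "is_subring B" "\<And>i. coeff p i \<in> B"
  shows "coeff (power_mod_poly p k) i \<in> B"
proof (induction k arbitrary: i)
  case 0
  show ?case using is_subringD(1,2)[OF assms(1)] by simp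
next
  case (Suc k)
  have "coeff (pCons 0 (power_mod_poly p k)) i \<in> B"
    using Suc is_subringD(1)[OF assms(1)] by (cases i) auto
  thus ?case
    unfolding power_mod_poly.simps coeff_diff coeff_smult
    by (intro is_subringD(3,5)[OF assms(1)] Suc assms(2))
qed

text \<open>
  The remainders grow no faster than the powers of the largest root, up to a factor that any \<open>C' > C\<close>
  absorbs. One root is split off at a time.
\<close>
lemma norm_coeff_power_mod_poly_le:
  fixes p :: "complex poly"
  assumes "lead_coeff p = 1" "degree p \<ge> 1" "\<And>z. poly p z = 0 \<Longrightarrow> norm z \<le> C" "0 \<le> C" "C < C'"
  shows "\<exists>A\<ge>0. \<forall>k i. norm (coeff (power_mod_poly p k) i) \<le> A * C' ^ k"
  using assms(1-3)
proof (induction "degree p" arbitrary: p)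
  case 0
  thus ?case by simp
next
  case (Suc n)
  obtain \<beta> where \<beta>: "poly p \<beta> = 0"
    using Fundamental_Theorem_Algebra.fundamental_theorem_of_algebra[of p] Suc.prems(2) by (auto simp: constant_degree)
  then obtain q where q: "p = q * [:-\<beta>, 1:]"
    by (metis dvdE mult.commute poly_eq_0_iff_dvd)
  have \<beta>C: "norm \<beta> \<le> C" using Suc.prems(3) \<beta> by blast
  have "p \<noteq> 0" using Suc.prems(2) by auto
  hence q0: "q \<noteq> 0" unfolding q by (rule contrapos_nn) simp
  have linear_nz: "[:-\<beta>, 1:] \<noteq> 0" by simp
  have degp: "degree p = Suc (degree q)"
    unfolding q degree_mult_eq[OF q0 linear_nz] by simp
  have "lead_coeff p = lead_coeff q * lead_coeff [:-\<beta>, 1:]" unfolding q by (rule lead_coeff_mult)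
  hence lq: "lead_coeff q = 1" unfolding Suc.prems(1) by simp
  show ?case
  proof (cases "degree q = 0")
    case True
    then obtain a where "q = [:a:]" by (rule degree_eq_zeroE)
    moreover from this have "a = 1" using lq by simp
    ultimately have "q = 1" by simp
    hence p: "p = [:-\<beta>, 1:]" by (simp add: q)
    have r: "power_mod_poly p k = [:\<beta> ^ k:]" for k
      by (induction k) (simp_all add: p)
    have "norm (\<beta> ^ k) \<le> C' ^ k" for k
      unfolding norm_power using \<beta>C assms by (intro power_mono) auto
    hence "norm (coeff (power_mod_poly p k) i) \<le> 1 * C' ^ k" for k i
      using assms by (auto simp: r coeff_pCons split: nat.split)
    thus ?thesis by (intro exI[of _ 1]) auto
  next
    case False
    have "\<exists>A\<ge>0. \<forall>k i. norm (coeff (power_mod_poly q k) i) \<le> A * C' ^ k"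
      using Suc.hyps(1)[of q] Suc.hyps(2) Suc.prems(3) degp lq False by (auto simp: q)
    then obtain A where A: "A \<ge> 0" "\<And>k i. norm (coeff (power_mod_poly q k) i) \<le> A * C' ^ k"
      by blast
    define t where "t = (\<lambda>k. coeff (power_mod_poly q k) (degree q - 1))"
    define e where "e = rec_nat 0 (\<lambda>k e. \<beta> * e + t k)"
    have e: "e 0 = 0" "e (Suc k) = \<beta> * e k + t k" for k by (simp_all add: e_def)
    \<comment> \<open>dividing X^k by p instead of by q leaves the additional multiple e k of q\<close>
    have r: "power_mod_poly p k = power_mod_poly q k + Polynomial.smult (e k) q" for k
    proof (induction k)
      case 0
      show ?case by (simp add: e)
    next
      case (Suc k)
      have "degree (power_mod_poly q k) < degree q"
        using degree_power_mod_poly[OF lq] False by simp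
      hence lead: "coeff (power_mod_poly p k) (degree p - 1) = e k"
        unfolding Suc degp using lq by (simp add: coeff_eq_0)
      have "power_mod_poly p (Suc k) =
          pCons 0 (power_mod_poly q k) + Polynomial.smult (e k) (pCons 0 q - p)"
        unfolding power_mod_poly.simps lead unfolding Suc
        by (simp add: smult_diff_right)
      also have "pCons 0 q - p = Polynomial.smult \<beta> q"
        by (simp add: q mult.commute[of q])
      also have "pCons 0 (power_mod_poly q k) = power_mod_poly q (Suc k) + Polynomial.smult (t k) q"
        by (simp add: t_def)
      finally show ?case by (simp add: e smult_add_left add.commute mult.commute)
    qed
    define E where "E = A / (C' - C)"
    have E0: "E \<ge> 0" using A assms by (simp add: E_def)
    have eE: "norm (e k) \<le> E * C' ^ k" for k
    proof (induction k)
      case 0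
      thus ?case using E0 by (simp add: e)
    next
      case (Suc k)
      have "norm (e (Suc k)) \<le> norm \<beta> * norm (e k) + norm (t k)"
        unfolding e by (rule order_trans[OF norm_triangle_ineq]) (simp add: norm_mult)
      also have "\<dots> \<le> C * (E * C' ^ k) + A * C' ^ k"
        using Suc \<beta>C A(2) assms unfolding t_def by (intro add_mono mult_mono) auto
      also have "\<dots> = (C * E + A) * C' ^ k" by (simp add: algebra_simps)
      also have "C * E + A = E * C'" using assms by (simp add: E_def field_simps)
      finally show ?case by (simp add: mult_ac)
    qed
    define M where "M = (\<Sum>i\<le>degree q. norm (coeff q i))"
    have M: "norm (coeff q i) \<le> M" for i
    proof (cases "i \<le> degree q")
      case True
      thus ?thesis unfolding M_def by (intro member_le_sum) auto
    qed (auto simp: coeff_eq_0 M_def intro: sum_nonneg)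
    have C'0: "C' ^ k \<ge> 0" for k using assms by simp
    have "norm (coeff (power_mod_poly p k) i) \<le> (A + E * M) * C' ^ k" for k i
    proof -
      have "norm (coeff (power_mod_poly p k) i)
          \<le> norm (coeff (power_mod_poly q k) i) + norm (e k) * norm (coeff q i)"
        unfolding r coeff_add coeff_smult
        by (rule order_trans[OF norm_triangle_ineq]) (simp add: norm_mult)
      also have "\<dots> \<le> A * C' ^ k + (E * C' ^ k) * M"
        using A(2) eE M E0 C'0 by (intro add_mono mult_mono) auto
      finally show ?thesis by (simp add: algebra_simps)
    qed
    moreover have "A + E * M \<ge> 0" using A E0 by (auto simp: M_def intro!: add_nonneg_nonneg mult_nonneg_nonneg sum_nonneg)
    ultimately show ?thesis by blast
  qed
qed

section \<open>Absolute values on subfields of the complex numbers\<close>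

lemma le_if_power_le_mult_power:
  fixes t B A :: real
  assumes "0 \<le> t" "0 < B" "\<And>k::nat. t ^ k \<le> A * B ^ k"
  shows "t \<le> B"
proof (rule ccontr)
  assume "\<not> t \<le> B"
  hence "1 < t / B" using assms by simp
  then obtain k where "A < (t / B) ^ k" using real_arch_pow by blast
  hence "A * B ^ k < t ^ k" using assms(2) by (simp add: power_divide pos_less_divide_eq)
  thus False using assms(3)[of k] by simp
qed

text \<open>
  Subfields of \<open>\<complex>\<close> are described by closure properties, since the absolute values are functions on \<open>\<complex>\<close>.
\<close>
locale valued_subfield =
  fixes K :: "complex set" and v :: "complex \<Rightarrow> real"
  assumes subring: "is_subring K"
    and inverse_closed: "x \<in> K \<Longrightarrow> inverse x \<in> K"
    and absolute_value: "absolute_value_on K v"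
begin

lemmas K_closed = is_subringD[OF subring]

lemma divide_closed: "x \<in> K \<Longrightarrow> y \<in> K \<Longrightarrow> x / y \<in> K"
  by (simp add: divide_inverse K_closed inverse_closed)

lemma of_int_closed: "of_int n \<in> K"
  by (cases n rule: int_cases2) (auto intro: K_closed)

lemma Rats_subset: "\<rat> \<subseteq> K"
  by (auto elim!: Rats_cases' intro!: divide_closed of_int_closed)

lemma sum_closed: "(\<And>i. i \<in> A \<Longrightarrow> g i \<in> K) \<Longrightarrow> sum g A \<in> K"
  by (rule is_subring_sum[OF subring])

lemma v_nonneg: "x \<in> K \<Longrightarrow> 0 \<le> v x"
  and v_eq_0_iff: "x \<in> K \<Longrightarrow> v x = 0 \<longleftrightarrow> x = 0"
  and v_mult: "x \<in> K \<Longrightarrow> y \<in> K \<Longrightarrow> v (x * y) = v x * v y"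
  and v_add: "x \<in> K \<Longrightarrow> y \<in> K \<Longrightarrow> v (x + y) \<le> v x + v y"
  using absolute_value by (auto simp: absolute_value_on_def)

lemma v_0 [simp]: "v 0 = 0"
  using v_eq_0_iff[of 0] K_closed(1) by simp

lemma v_1 [simp]: "v 1 = 1"
proof -
  have "v 1 * v 1 = v 1" using v_mult[of 1 1] K_closed(2) by simp
  thus ?thesis using v_eq_0_iff[of 1] K_closed(2) by simp
qed

lemma v_minus: "x \<in> K \<Longrightarrow> v (- x) = v x"
proof -
  assume x: "x \<in> K"
  have m: "- 1 \<in> K" by (intro K_closed)
  have "v (-1) * v (-1) = 1" using v_mult[OF m m] by simp
  hence "v (-1) = 1" using v_nonneg[OF m] by (simp add: square_eq_1_iff)
  thus ?thesis using v_mult[OF m x] by simp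
qed

lemma v_diff: "x \<in> K \<Longrightarrow> y \<in> K \<Longrightarrow> v (x - y) \<le> v x + v y"
  using v_add[of x "- y"] v_minus[of y] K_closed(6) by simp

lemma v_power: "x \<in> K \<Longrightarrow> v (x ^ n) = v x ^ n"
  by (induction n) (auto simp: v_mult K_closed)

lemma v_inverse: "x \<in> K \<Longrightarrow> v (inverse x) = inverse (v x)"
proof (cases "x = 0")
  case False
  assume x: "x \<in> K"
  have "v x * v (inverse x) = 1"
    using v_mult[OF x inverse_closed[OF x]] False by simp
  thus ?thesis by (metis inverse_unique)
qed simp

lemma v_divide: "x \<in> K \<Longrightarrow> y \<in> K \<Longrightarrow> v (x / y) = v x / v y"
  by (simp add: divide_inverse v_mult v_inverse inverse_closed)

lemma v_sum: "(\<And>i. i \<in> A \<Longrightarrow> g i \<in> K) \<Longrightarrow> v (sum g A) \<le> (\<Sum>i\<in>A. v (g i))"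
proof (induction A rule: infinite_finite_induct)
  case (insert a A)
  have "v (sum g (insert a A)) \<le> v (g a) + v (sum g A)"
    using insert by (simp add: v_add sum_closed)
  also have "\<dots> \<le> v (g a) + (\<Sum>i\<in>A. v (g i))" using insert by simp
  finally show ?case using insert by simp
qed auto

text \<open>
  \<open>x\<^sup>k\<close> is the value at \<open>x\<close> of the remainder of \<open>X\<^sup>k\<close>, whose degree is bounded. So \<open>|x|\<^sup>k\<close> grows no faster than the
  coefficients, and \<open>k\<close>-th roots give the claim. As only the triangle inequality enters, this serves
  for all places.
\<close>
lemma v_le_if_power_mod_poly_bounded:
  assumes x: "x \<in> K" and p: "poly p x = 0" "lead_coeff p = 1" "degree p \<ge> 1" "\<And>i. coeff p i \<in> K"
    and bound: "\<And>k i. v (coeff (power_mod_poly p k) i) \<le> A * B ^ k" "A \<ge> 0" "B > 0"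
  shows "v x \<le> B"
proof (rule le_if_power_le_mult_power)
  define S where "S = (\<Sum>i\<le>degree p. v x ^ i)"
  have cK: "coeff (power_mod_poly p k) i \<in> K" for k i
    by (rule coeff_power_mod_poly_in_subring[OF subring p(4)])
  show "v x ^ k \<le> (A * S) * B ^ k" for k
  proof -
    have deg: "degree (power_mod_poly p k) \<le> degree p"
      using degree_power_mod_poly[OF p(2,3), of k] by simp
    have "v x ^ k = v (poly (power_mod_poly p k) x)"
      using x by (simp add: poly_power_mod_poly[OF p(1)] v_power)
    also have "\<dots> = v (\<Sum>i\<le>degree p. coeff (power_mod_poly p k) i * x ^ i)"
      by (subst poly_as_sum_of_monoms'[OF deg, symmetric]) (simp only: poly_sum poly_monom)
    also have "\<dots> \<le> (\<Sum>i\<le>degree p. v (coeff (power_mod_poly p k) i * x ^ i))"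
      by (intro v_sum K_closed cK x)
    also have "\<dots> = (\<Sum>i\<le>degree p. v (coeff (power_mod_poly p k) i) * v x ^ i)"
      by (simp add: v_mult v_power K_closed cK x)
    also have "\<dots> \<le> (\<Sum>i\<le>degree p. (A * B ^ k) * v x ^ i)"
      by (intro sum_mono mult_right_mono bound zero_le_power v_nonneg x)
    also have "\<dots> = (A * S) * B ^ k" by (simp add: S_def sum_distrib_left mult_ac)
    finally show ?thesis .
  qed
qed (use bound v_nonneg x in auto)

lemma v_algebraic_int_le_1:
  assumes "\<And>n. v (of_int n) \<le> 1" "algebraic_int x" "x \<in> K"
  shows "v x \<le> 1"
proof -
  obtain p where p: "lead_coeff p = 1" "\<And>i. coeff p i \<in> \<int>" "poly p x = 0"
    using assms(2) by (auto simp: algebraic_int.simps)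
  have deg: "degree p \<ge> 1"
  proof (rule ccontr)
    assume "\<not> degree p \<ge> 1"
    then obtain a where "p = [:a:]" by (metis degree_eq_zeroE less_one not_le)
    thus False using p by simp
  qed
  have sub: "is_subring (\<int> :: complex set)" by (auto simp: is_subring_def)
  have "\<int> \<subseteq> K" by (auto elim!: Ints_cases intro: of_int_closed)
  have "v a \<le> 1" if "a \<in> \<int>" for a using that assms(1) by (auto elim!: Ints_cases)
  from this[OF coeff_power_mod_poly_in_subring[OF sub p(2)]] show ?thesis
    using p(2) \<open>\<int> \<subseteq> K\<close>
    by (intro v_le_if_power_mod_poly_bounded[OF assms(3) p(3,1) deg, of 1 1]) auto
qed

text \<open>
  The remainders of \<open>X\<^sup>k\<close> have rational coefficients, on which \<open>v\<close> is the usual absolute value, so their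
  growth is controlled by the complex roots of \<open>p\<close>. This takes the place of the theorem that an archimedean absolute value comes from a complex embedding.
\<close>
lemma v_le_if_conjugates_le:
  assumes rat: "\<And>q. v (of_rat q) = \<bar>of_rat q\<bar>" and x: "x \<in> K"
    and p: "poly p x = 0" "p \<noteq> 0" "\<And>i. coeff p i \<in> \<rat>"
    and C: "\<And>z. poly p z = 0 \<Longrightarrow> norm z \<le> C"
  shows "v x \<le> C"
proof (rule dense_ge)
  fix C' assume C': "C < C'"
  have C0: "C \<ge> 0" using C[OF p(1)] norm_ge_zero order_trans by blast
  define q where "q = Polynomial.smult (inverse (lead_coeff p)) p"
  have lq: "lead_coeff q = 1" using p(2) by (simp add: q_def)
  have qx: "poly q x = 0" using p(1) by (simp add: q_def)
  have deg: "degree q \<ge> 1"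
  proof (rule ccontr)
    assume "\<not> degree q \<ge> 1"
    then obtain a where "q = [:a:]" by (metis degree_eq_zeroE less_one not_le)
    thus False using lq qx by simp
  qed
  have qQ: "coeff q i \<in> \<rat>" for i using p(3) by (auto simp: q_def intro!: Rats_mult)
  have sub: "is_subring (\<rat> :: complex set)" by (auto simp: is_subring_def)
  obtain A where A: "A \<ge> 0" "\<And>k i. norm (coeff (power_mod_poly q k) i) \<le> A * C' ^ k"
    using norm_coeff_power_mod_poly_le[OF lq deg _ C0 C'] C p(2) by (auto simp: q_def)
  have vQ: "v a = norm a" if a: "a \<in> \<rat>" for a
  proof -
    obtain r where r: "a = of_rat r" using a by (rule Rats_cases)
    have "a = of_real (of_rat r)" unfolding r by (cases r) (simp add: of_rat_rat)
    thus ?thesis using rat[of r] r by (simp only: norm_of_real real_norm_def)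
  qed
  show "v x \<le> C'"
    using qQ Rats_subset A C0 C'
    by (intro v_le_if_power_mod_poly_bounded[OF x qx lq deg _ _ A(1)])
       (auto simp: vQ[OF coeff_power_mod_poly_in_subring[OF sub qQ]])
qed

end

section \<open>Bounds for parabolic parameters at each place\<close>

text \<open>
  All roots of the resultant are parabolic parameters and hence bounded. For the same reason the
  resultant is not zero: otherwise every complex number would be such a root.
\<close>
theorem archimedean_abs_parabolic_parameter_le:
  assumes "valued_subfield K v" "\<And>q. v (of_rat q) = \<bar>of_rat q\<bar>" "c \<in> K" "d \<ge> 1"
    and par: "parabolic_periodic_point (fmap d c) z"
  shows "v c \<le> (2 * real d + 2) powr (1 / real d) * (real d + 1) / real d" (is "_ \<le> ?C")
proof -
  interpret valued_subfield K v by fact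
  obtain m n where mn: "m \<ge> 1" "n \<ge> 1" "(fmap d c ^^ m) z = z" "(deriv (fmap d c ^^ m) z) ^ n = 1"
    using par unfolding parabolic_periodic_point_def root_of_unity_def by blast
  define p :: "complex poly" where "p = map_poly of_int (parabolic_resultant d m n)"
  have root: "norm w \<le> ?C" if w: "poly p w = 0" for w
  proof -
    obtain y where "(fmap d w ^^ m) y = y" "(deriv (fmap d w ^^ m) y) ^ n = 1"
      using w poly_parabolic_resultant_eq_0_iff[OF assms(4) mn(1,2)] unfolding p_def by blast
    hence "parabolic_periodic_point (fmap d w) y"
      unfolding parabolic_periodic_point_def root_of_unity_def using mn by blast
    thus ?thesis using norm_parabolic_parameter_le assms(4) by blast
  qed
  have "p \<noteq> 0"
  proof
    assume "p = 0"
    hence "norm (of_real (?C + 1) :: complex) \<le> ?C" by (intro root) simp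
    thus False by (simp only: norm_of_real)
  qed
  moreover have "poly p c = 0"
    using poly_parabolic_resultant_eq_0_iff[OF assms(4) mn(1,2)] mn unfolding p_def by blast
  ultimately show ?thesis
    using root by (intro v_le_if_conjugates_le[OF assms(2,3), of p]) (auto simp: p_def coeff_map_poly)
qed

lemma padic_abs_of_int:
  "padic_abs p (of_int n) = (if n = 0 then 0 else 1 / real p ^ multiplicity (int p) n)"
  by (simp add: padic_abs_def)

lemma multiplicity_of_nat:
  assumes "Factorial_Ring.prime p" "d > 0"
  shows "multiplicity (int p) (int d) = multiplicity p d"
proof (rule multiplicity_eqI)
  have "p ^ multiplicity p d dvd d" by (rule multiplicity_dvd)
  thus "int p ^ multiplicity p d dvd int d" by (simp flip: of_nat_power)
  have "\<not> p ^ Suc (multiplicity p d) dvd d"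
    using assms prime_elem_multiplicity_eq_zero_iff by (subst power_dvd_iff_le_multiplicity) auto
  thus "\<not> int p ^ Suc (multiplicity p d) dvd int d"
    by (simp only: of_nat_power[symmetric] of_nat_dvd_iff) simp
qed

text \<open>
  The right-hand side is the inverse of the \<open>p\<close>-adic absolute value of \<open>d\<close>, and \<open>d c\<close> is an algebraic integer.
\<close>
theorem padic_abs_parabolic_parameter_le:
  assumes "valued_subfield K v" "Factorial_Ring.prime p" "\<And>q. v (of_rat q) = padic_abs p q" "c \<in> K" "d \<ge> 1"
    and par: "parabolic_periodic_point (fmap d c) z"
  shows "v c \<le> real p ^ multiplicity p d"
proof -
  interpret valued_subfield K v by fact
  have p1: "real p \<ge> 1" "p > 0" using assms(2) prime_ge_1_nat[of p] by (simp_all add: prime_gt_0_nat)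
  have vZ: "v (of_int n) = padic_abs p (of_int n)" for n
    using assms(3)[of "of_int n"] by simp
  have "v (of_int n) \<le> 1" for n
    using p1 by (simp add: vZ padic_abs_of_int)
  hence "v (of_nat d * c) \<le> 1"
    by (intro v_algebraic_int_le_1[OF _ algebraic_int_parabolic_parameter[OF assms(5) par]]
          K_closed(5)[OF K_closed(8) assms(4)])
  moreover have "v (of_nat d) = 1 / real p ^ multiplicity p d"
    using vZ[of "int d"] padic_abs_of_int[of p "int d"] assms(2,5) by (simp add: multiplicity_of_nat)
  ultimately have "v c / real p ^ multiplicity p d \<le> 1"
    using assms(4) by (simp add: v_mult K_closed)
  thus ?thesis using p1 by (simp add: divide_le_eq)
qed

section \<open>Independent Cauchy sequences\<close>

text \<open>
  Linear independence in the completion of \<open>K\<close> over the completion of \<open>\<rat>\<close>, expressed by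
  representing sequences.
\<close>
definition cauchy_independent ::
    "complex set \<Rightarrow> (complex \<Rightarrow> real) \<Rightarrow> 'i set \<Rightarrow> ('i \<Rightarrow> nat \<Rightarrow> complex) \<Rightarrow> bool" where
  "cauchy_independent K v J s \<longleftrightarrow>
     (\<forall>j\<in>J. s j \<in> cauchy_seqs K v) \<and>
     (\<forall>q. (\<forall>j\<in>J. q j \<in> cauchy_seqs \<rat> v) \<longrightarrow> (\<lambda>n. \<Sum>j\<in>J. q j n * s j n) \<in> null_seqs K v
        \<longrightarrow> (\<forall>j\<in>J. q j \<in> null_seqs K v))"

context valued_subfield
begin

lemma cauchy_seqs_uniform:
  assumes "finite J" "\<And>j. j \<in> J \<Longrightarrow> s j \<in> cauchy_seqs K v" "e > 0"
  shows "\<exists>N. \<forall>j\<in>J. \<forall>m\<ge>N. \<forall>n\<ge>N. v (s j m - s j n) < e"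
  using assms(1,2)
proof (induction J rule: finite_induct)
  case (insert a J)
  then obtain N where N: "\<forall>j\<in>J. \<forall>m\<ge>N. \<forall>n\<ge>N. v (s j m - s j n) < e" by auto
  obtain M where M: "\<forall>m\<ge>M. \<forall>n\<ge>M. v (s a m - s a n) < e"
    using insert.prems[of a] assms(3) by (auto simp: cauchy_seqs_def)
  show ?case using N M by (intro exI[of _ "max N M"]) auto
qed auto

lemma cauchy_independent_subset:
  assumes "cauchy_independent K v J s" "finite J" "L \<subseteq> J"
  shows "cauchy_independent K v L s"
  unfolding cauchy_independent_def
proof (intro conjI allI impI ballI)
  show "s j \<in> cauchy_seqs K v" if "j \<in> L" for j
    using assms that by (auto simp: cauchy_independent_def)
  fix q j
  assume q: "\<forall>j\<in>L. q j \<in> cauchy_seqs \<rat> v" "(\<lambda>n. \<Sum>j\<in>L. q j n * s j n) \<in> null_seqs K v"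
    and j: "j \<in> L"
  define q' where "q' = (\<lambda>j. if j \<in> L then q j else (\<lambda>_. 0))"
  have "(\<lambda>_. 0) \<in> cauchy_seqs \<rat> v" by (simp add: cauchy_seqs_def)
  hence "\<forall>j\<in>J. q' j \<in> cauchy_seqs \<rat> v" using q(1) by (simp add: q'_def)
  moreover have "(\<Sum>j\<in>J. q' j n * s j n) = (\<Sum>j\<in>L. q j n * s j n)" for n
    using assms(2,3) by (intro sum.mono_neutral_cong_right) (auto simp: q'_def)
  ultimately have "\<forall>j\<in>J. q' j \<in> null_seqs K v"
    using assms(1) q(2) unfolding cauchy_independent_def by simp
  hence "q' j \<in> null_seqs K v" using j assms(3) by blast
  thus "q j \<in> null_seqs K v" using j by (simp add: q'_def)
qed

text \<open>
  The equivalence of norms on a finite-dimensional space over a complete field, for rational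
  coefficients, and with the vectors replaced by late terms of their representing sequences.
  If it fails, there are combinations that tend to 0 although one fixed coefficient is 1 and the others are
  bounded by 1. By induction, applied to differences of such combinations, the other coefficients form
  Cauchy sequences, and in the limit they give a nontrivial relation.
\<close>
lemma cauchy_independent_lower_bound:
  assumes "finite J" "cauchy_independent K v J s"
  shows "\<exists>\<delta>>0. \<exists>N. \<forall>i\<ge>N. \<forall>c. (\<forall>j\<in>J. c j \<in> \<rat>) \<longrightarrow>
           (\<forall>j\<in>J. \<delta> * v (c j) \<le> v (\<Sum>j\<in>J. c j * s j i))"
  using assms
proof (induction J rule: finite_psubset_induct)
  case (psubset J)
  have sK: "s j n \<in> K" if "j \<in> J" for j n
    using psubset.prems that by (auto simp: cauchy_independent_def cauchy_seqs_def)
  have QK: "c \<in> K" if "c \<in> \<rat>" for c using that Rats_subset by auto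
  note fin = psubset.hyps
  show ?case
  proof (rule ccontr)
    assume neg: "\<not> ?thesis"
    have bad: "\<exists>j\<in>J. \<exists>i\<ge>m. \<exists>c. (\<forall>l\<in>J. c l \<in> \<rat> \<and> v (c l) \<le> v (c j)) \<and>
        v (\<Sum>l\<in>J. c l * s l i) < v (c j) / real (Suc m)" for m
    proof -
      have "1 / real (Suc m) > 0" by simp
      hence "\<not> (\<forall>i\<ge>m. \<forall>c. (\<forall>j\<in>J. c j \<in> \<rat>) \<longrightarrow>
          (\<forall>j\<in>J. 1 / real (Suc m) * v (c j) \<le> v (\<Sum>j\<in>J. c j * s j i)))"
        using neg by blast
      then obtain i c where i0: "i \<ge> m" "\<forall>l\<in>J. c l \<in> \<rat>"
          "\<not> (\<forall>j\<in>J. 1 / real (Suc m) * v (c j) \<le> v (\<Sum>j\<in>J. c j * s j i))"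
        unfolding not_all not_imp by (elim exE conjE)
      then obtain j0 where "j0 \<in> J" "\<not> 1 / real (Suc m) * v (c j0) \<le> v (\<Sum>j\<in>J. c j * s j i)"
        by blast
      hence i: "i \<ge> m" "\<forall>l\<in>J. c l \<in> \<rat>" "j0 \<in> J"
        "v (\<Sum>l\<in>J. c l * s l i) < 1 / real (Suc m) * v (c j0)"
        using i0 by (simp_all only: not_le)
      obtain j where j: "j \<in> J" "\<And>l. l \<in> J \<Longrightarrow> v (c l) \<le> v (c j)"
      proof -
        let ?M = "Max ((\<lambda>l. v (c l)) ` J)"
        have "?M \<in> (\<lambda>l. v (c l)) ` J" using fin i(3) by (intro Max_in) auto
        then obtain j where "j \<in> J" "v (c j) = ?M" by auto
        thus ?thesis using fin by (intro that[of j]) auto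
      qed
      have "1 / real (Suc m) * v (c j0) \<le> 1 / real (Suc m) * v (c j)"
        using j(2)[OF i(3)] by (intro mult_left_mono) auto
      hence "v (\<Sum>l\<in>J. c l * s l i) < v (c j) / real (Suc m)" using i(4) by simp
      thus ?thesis using i j by blast
    qed
    have "\<forall>m. \<exists>j. j \<in> J \<and> (\<exists>i\<ge>m. \<exists>c. (\<forall>l\<in>J. c l \<in> \<rat> \<and> v (c l) \<le> v (c j)) \<and>
        v (\<Sum>l\<in>J. c l * s l i) < v (c j) / real (Suc m))"
      using bad unfolding Bex_def by (rule allI)
    from choice[OF this] obtain jj where jj: "\<And>m. jj m \<in> J"
      "\<And>m. \<exists>i\<ge>m. \<exists>c. (\<forall>l\<in>J. c l \<in> \<rat> \<and> v (c l) \<le> v (c (jj m))) \<and>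
        v (\<Sum>l\<in>J. c l * s l i) < v (c (jj m)) / real (Suc m)"
      by blast
    \<comment> \<open>one index j attains the maximum for infinitely many m\<close>
    have "\<exists>j\<in>J. \<forall>m. \<exists>m'\<ge>m. jj m' = j"
    proof (rule ccontr)
      assume "\<not> ?thesis"
      then obtain b where b: "\<And>j m'. j \<in> J \<Longrightarrow> m' \<ge> b j \<Longrightarrow> jj m' \<noteq> j" by metis
      define m where "m = Max (b ` J)"
      have "b (jj m) \<le> m" unfolding m_def using fin jj(1) by (intro Max_ge) auto
      thus False using b[OF jj(1)[of m]] by blast
    qed
    then obtain j where j: "j \<in> J" "\<And>m. \<exists>m'\<ge>m. jj m' = j" by blast
    have "\<exists>i\<ge>m. \<exists>c. c j = 1 \<and> (\<forall>l\<in>J. c l \<in> \<rat> \<and> v (c l) \<le> 1) \<and>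
        v (\<Sum>l\<in>J. c l * s l i) < 1 / real (Suc m)" for m
    proof -
      obtain m' where m': "m' \<ge> m" "jj m' = j" using j(2) by blast
      obtain i c where c: "i \<ge> m'" "\<And>l. l \<in> J \<Longrightarrow> c l \<in> \<rat> \<and> v (c l) \<le> v (c j)"
        "v (\<Sum>l\<in>J. c l * s l i) < v (c j) / real (Suc m')"
        using jj(2)[of m'] unfolding m'(2) by blast
      have sumK: "(\<Sum>l\<in>J. c l * s l i) \<in> K" using c(2) QK sK by (intro sum_closed K_closed) auto
      have vcj: "v (c j) > 0"
      proof -
        have "0 < v (c j) / real (Suc m')" using v_nonneg[OF sumK] c(3) by linarith
        thus ?thesis by (simp add: zero_less_divide_iff)
      qed
      have cK: "c l \<in> K" if "l \<in> J" for l using c(2) QK that by blast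
      have cj0: "c j \<noteq> 0" using vcj by auto
      define c' where "c' = (\<lambda>l. c l / c j)"
      have "c' j = 1" using cj0 by (simp add: c'_def)
      moreover have "c' l \<in> \<rat> \<and> v (c' l) \<le> 1" if "l \<in> J" for l
        using c(2)[OF that] c(2)[OF j(1)] cK[OF that] cK[OF j(1)] vcj
        by (simp add: c'_def v_divide)
      moreover have "v (\<Sum>l\<in>J. c' l * s l i) < 1 / real (Suc m)"
      proof -
        have "(\<Sum>l\<in>J. c' l * s l i) = (\<Sum>l\<in>J. c l * s l i) / c j"
          by (simp add: c'_def sum_divide_distrib)
        hence "v (\<Sum>l\<in>J. c' l * s l i) = v (\<Sum>l\<in>J. c l * s l i) / v (c j)"
          using v_divide[OF sumK cK[OF j(1)]] by simp
        also have "\<dots> < 1 / real (Suc m')"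
          using c(3) vcj by (simp add: pos_divide_less_eq mult.commute)
        also have "\<dots> \<le> 1 / real (Suc m)" using m'(1) by (intro divide_left_mono) auto
        finally show ?thesis .
      qed
      ultimately show ?thesis using c(1) m'(1) by (meson order_trans)
    qed
    then obtain I where "\<And>m. I m \<ge> m \<and> (\<exists>c. c j = 1 \<and> (\<forall>l\<in>J. c l \<in> \<rat> \<and> v (c l) \<le> 1) \<and>
        v (\<Sum>l\<in>J. c l * s l (I m)) < 1 / real (Suc m))" by metis
    then obtain C where I: "\<And>m. I m \<ge> m" and C: "\<And>m. C m j = 1" "\<And>m l. l \<in> J \<Longrightarrow> C m l \<in> \<rat>"
      "\<And>m l. l \<in> J \<Longrightarrow> v (C m l) \<le> 1" "\<And>m. v (\<Sum>l\<in>J. C m l * s l (I m)) < 1 / real (Suc m)"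
      by metis
    define A where "A = (\<lambda>m. \<Sum>l\<in>J. C m l * s l (I m))"
    have CK: "C m l \<in> K" if "l \<in> J" for m l using C(2) QK that by blast
    have AK: "A m \<in> K" for m unfolding A_def by (intro sum_closed K_closed CK sK)
    have Asmall: "\<exists>N. \<forall>m\<ge>N. v (A m) < e" if e: "e > 0" for e
    proof -
      obtain N where N: "1 / real (Suc N) < e" using e nat_approx_posE by blast
      have "v (A m) < e" if m: "m \<ge> N" for m
      proof -
        have "1 / real (Suc m) \<le> 1 / real (Suc N)" using m by (intro divide_left_mono) auto
        thus ?thesis using C(4)[of m] N unfolding A_def by linarith
      qed
      thus ?thesis by blast
    qed
    have sC: "s l \<in> cauchy_seqs K v" if "l \<in> J" for l
      using psubset.prems that by (auto simp: cauchy_independent_def)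
    \<comment> \<open>moving a combination with bounded coefficients from one index of the sequences to another\<close>
    have move: "v (\<Sum>l\<in>J. C m l * (s l i - s l i')) \<le> real (card J) * e"
      if small: "\<And>l. l \<in> J \<Longrightarrow> v (s l i - s l i') < e" for m i i' e
    proof -
      have "v (\<Sum>l\<in>J. C m l * (s l i - s l i')) \<le> (\<Sum>l\<in>J. v (C m l * (s l i - s l i')))"
        by (intro v_sum K_closed CK sK)
      also have "\<dots> \<le> (\<Sum>l\<in>J. 1 * e)"
      proof (intro sum_mono)
        fix l assume l: "l \<in> J"
        have d: "s l i - s l i' \<in> K" using sK[OF l] by (intro K_closed)
        show "v (C m l * (s l i - s l i')) \<le> 1 * e"
          unfolding v_mult[OF CK[OF l] d]
          using C(3)[OF l] small[OF l] v_nonneg[OF d] v_nonneg[OF CK[OF l]]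
          by (intro mult_mono) auto
      qed
      finally show ?thesis by simp
    qed
    define L where "L = J - {j}"
    have "L \<subset> J" using j(1) by (auto simp: L_def)
    hence "cauchy_independent K v L s"
      by (intro cauchy_independent_subset[OF psubset.prems fin]) auto
    from psubset.IH[OF \<open>L \<subset> J\<close> this] obtain \<delta> N0 where \<delta>1: "\<delta> > 0"
      and \<delta>2: "\<forall>i\<ge>N0. \<forall>c. (\<forall>j\<in>L. c j \<in> \<rat>) \<longrightarrow> (\<forall>j\<in>L. \<delta> * v (c j) \<le> v (\<Sum>j\<in>L. c j * s j i))"
      by blast
    have \<delta>: "\<delta> > 0" "\<And>i c l. i \<ge> N0 \<Longrightarrow> (\<And>l. l \<in> L \<Longrightarrow> c l \<in> \<rat>) \<Longrightarrow> l \<in> L \<Longrightarrow>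
        \<delta> * v (c l) \<le> v (\<Sum>l\<in>L. c l * s l i)"
      using \<delta>1 \<delta>2 by simp_all
    have qC: "(\<lambda>m. C m l) \<in> cauchy_seqs \<rat> v" if l: "l \<in> J" for l
    proof (cases "l = j")
      case True
      thus ?thesis by (simp add: C(1) cauchy_seqs_def)
    next
      case False
      hence lL: "l \<in> L" using l by (simp add: L_def)
      have "\<exists>N. \<forall>m\<ge>N. \<forall>n\<ge>N. v (C m l - C n l) < e" if e: "e > 0" for e
      proof -
        define e' where "e' = \<delta> * e / (real (card J) + 2)"
        have e': "e' > 0" using e \<delta>(1) by (simp add: e'_def)
        obtain N1 where N1: "\<forall>m\<ge>N1. v (A m) < e'" using Asmall[OF e'] by blast
        obtain N2 where N2: "\<forall>l\<in>J. \<forall>m\<ge>N2. \<forall>n\<ge>N2. v (s l m - s l n) < e'"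
          using cauchy_seqs_uniform[of J s e', OF fin sC e'] by blast
        define N where "N = max N0 (max N1 N2)"
        have "v (C m l - C n l) < e" if mn: "m \<ge> N" "n \<ge> N" for m n
        proof -
          have big: "I m \<ge> N0" "I m \<ge> N2" "I n \<ge> N2" "m \<ge> N1" "n \<ge> N1"
            using mn I[of m] I[of n] by (auto simp: N_def)
          have eq: "(\<Sum>l\<in>L. (C m l - C n l) * s l (I m))
              = (A m - A n) + (\<Sum>l\<in>J. C n l * (s l (I n) - s l (I m)))"
          proof -
            have "(\<Sum>l\<in>L. (C m l - C n l) * s l (I m)) = (\<Sum>l\<in>J. (C m l - C n l) * s l (I m))"
              using j(1) fin by (intro sum.mono_neutral_left) (auto simp: L_def C(1))
            also have "\<dots> = (A m - A n) + (\<Sum>l\<in>J. C n l * (s l (I n) - s l (I m)))"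
              unfolding A_def by (simp add: algebra_simps sum.distrib sum_subtractf)
            finally show ?thesis .
          qed
          have K1: "A m - A n \<in> K" using AK by (intro K_closed)
          have K2: "(\<Sum>l\<in>J. C n l * (s l (I n) - s l (I m))) \<in> K"
            by (intro sum_closed K_closed CK sK)
          have "\<delta> * v (C m l - C n l) \<le> v (\<Sum>l\<in>L. (C m l - C n l) * s l (I m))"
            using \<delta>(2)[OF big(1), of "\<lambda>l. C m l - C n l" l] C(2) lL by (auto simp: L_def)
          also have "\<dots> \<le> v (A m) + v (A n) + v (\<Sum>l\<in>J. C n l * (s l (I n) - s l (I m)))"
            unfolding eq using v_add[OF K1 K2] v_diff[OF AK AK, of m n] by linarith
          also have "\<dots> < e' + e' + real (card J) * e'"
          proof -
            have "v (\<Sum>l\<in>J. C n l * (s l (I n) - s l (I m))) \<le> real (card J) * e'"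
              using N2 big by (intro move) auto
            thus ?thesis using N1 big by (intro add_less_le_mono add_strict_mono) auto
          qed
          also have "\<dots> = (real (card J) + 2) * e'" by (simp add: algebra_simps)
          also have "\<dots> = \<delta> * e" by (simp add: e'_def)
          finally show ?thesis using \<delta>(1) by simp
        qed
        thus ?thesis by blast
      qed
      thus ?thesis using C(2)[OF l] by (simp add: cauchy_seqs_def)
    qed
    have null: "(\<lambda>m. \<Sum>l\<in>J. C m l * s l m) \<in> null_seqs K v"
      unfolding null_seqs_def
    proof (intro CollectI conjI allI impI)
      show "(\<Sum>l\<in>J. C m l * s l m) \<in> K" for m by (intro sum_closed K_closed CK sK)
      fix e :: real assume e: "e > 0"
      define e' where "e' = e / (real (card J) + 1)"
      have e': "e' > 0" using e by (simp add: e'_def)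
      obtain N1 where N1: "\<forall>m\<ge>N1. v (A m) < e'" using Asmall[OF e'] by blast
      obtain N2 where N2: "\<forall>l\<in>J. \<forall>m\<ge>N2. \<forall>n\<ge>N2. v (s l m - s l n) < e'"
        using cauchy_seqs_uniform[of J s e', OF fin sC e'] by blast
      have "v (\<Sum>l\<in>J. C m l * s l m) < e" if m: "m \<ge> max N1 N2" for m
      proof -
        have eq: "(\<Sum>l\<in>J. C m l * s l m) = A m + (\<Sum>l\<in>J. C m l * (s l m - s l (I m)))"
          unfolding A_def by (simp add: algebra_simps sum_subtractf)
        have "v (\<Sum>l\<in>J. C m l * s l m) \<le> v (A m) + v (\<Sum>l\<in>J. C m l * (s l m - s l (I m)))"
          unfolding eq by (intro v_add AK sum_closed K_closed CK sK)
        also have "\<dots> < e' + real (card J) * e'"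
        proof -
          have "v (\<Sum>l\<in>J. C m l * (s l m - s l (I m))) \<le> real (card J) * e'"
            using N2 m I[of m] by (intro move) auto
          thus ?thesis using N1 m by (intro add_less_le_mono) auto
        qed
        also have "\<dots> = (real (card J) + 1) * e'" by (simp add: algebra_simps)
        also have "\<dots> = e" by (simp add: e'_def)
        finally show ?thesis .
      qed
      thus "\<exists>N. \<forall>m\<ge>N. v (\<Sum>l\<in>J. C m l * s l m) < e" by blast
    qed
    have "(\<lambda>m. C m j) \<in> null_seqs K v"
      using conjunct2[OF psubset.prems[unfolded cauchy_independent_def], rule_format, of "\<lambda>l m. C m l" j]
        qC null j(1) by blast
    hence "\<forall>e>0. \<exists>N. \<forall>m\<ge>N. v (C m j) < e" by (simp add: null_seqs_def)
    from this[rule_format, of 1] obtain N where "\<forall>m\<ge>N. v (C m j) < 1" by auto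
    from this[rule_format, of N] show False by (simp add: C(1))
  qed
qed

end

section \<open>Weak approximation\<close>

context valued_subfield
begin

text \<open>
  The sequence \<open>x\<^sup>n / (1 + x\<^sup>n)\<close> of Artin and Whaples separates the absolute values with \<open>|x| > 1\<close> from those
  with \<open>|x| < 1\<close>.
\<close>
lemma v_power_quotient_tendsto_1:
  assumes "x \<in> K" "1 < v x"
  shows "(\<lambda>n. v (x ^ n / (1 + x ^ n) - 1)) \<longlonglongrightarrow> 0"
proof (rule tendsto_sandwich[of "\<lambda>_. 0" _ _ "\<lambda>n. 1 / (v x ^ n - 1)"])
  have ge: "v x ^ n - 1 \<le> v (1 + x ^ n)" for n
  proof -
    have "v (x ^ n) = v ((1 + x ^ n) - 1)" by simp
    also have "\<dots> \<le> v (1 + x ^ n) + v 1" using assms(1) by (intro v_diff K_closed)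
    finally show ?thesis by (simp add: v_power[OF assms(1)])
  qed
  have gt: "1 < v x ^ n" if "n \<ge> 1" for n using assms(2) that by (intro one_less_power) auto
  have "v (x ^ n / (1 + x ^ n) - 1) \<le> 1 / (v x ^ n - 1)" if n: "n \<ge> 1" for n
  proof -
    have pos: "v (1 + x ^ n) > 0" using ge[of n] gt[OF n] by linarith
    hence nz: "1 + x ^ n \<noteq> 0" by (metis less_irrefl v_0)
    have "x ^ n / (1 + x ^ n) - 1 = - (1 / (1 + x ^ n))" using nz by (simp add: field_simps)
    hence "v (x ^ n / (1 + x ^ n) - 1) = 1 / v (1 + x ^ n)"
      using assms(1) by (simp add: v_minus v_divide divide_closed K_closed)
    also have "\<dots> \<le> 1 / (v x ^ n - 1)"
      using ge[of n] gt[OF n] pos by (intro divide_left_mono) auto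
    finally show ?thesis .
  qed
  thus "\<forall>\<^sub>F n in sequentially. v (x ^ n / (1 + x ^ n) - 1) \<le> 1 / (v x ^ n - 1)"
    unfolding eventually_sequentially by blast
  have "filterlim (\<lambda>n. v x ^ n) at_infinity sequentially"
    using assms(2) by (intro filterlim_realpow_sequentially_gt1) simp
  hence "filterlim (\<lambda>n. (-1) + v x ^ n) at_infinity sequentially"
    by (rule tendsto_add_filterlim_at_infinity[OF tendsto_const])
  hence "((\<lambda>n. 1 / (-1 + v x ^ n)) \<longlonglongrightarrow> 0)"
    by (rule tendsto_divide_0[OF tendsto_const])
  thus "(\<lambda>n. 1 / (v x ^ n - 1)) \<longlonglongrightarrow> 0" by simp
  show "\<forall>\<^sub>F n in sequentially. 0 \<le> v (x ^ n / (1 + x ^ n) - 1)"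
    using assms(1) by (intro always_eventually allI v_nonneg K_closed divide_closed)
qed auto

lemma v_power_quotient_tendsto_0:
  assumes "x \<in> K" "v x < 1"
  shows "(\<lambda>n. v (x ^ n / (1 + x ^ n))) \<longlonglongrightarrow> 0"
proof (rule tendsto_sandwich[of "\<lambda>_. 0" _ _ "\<lambda>n. v x ^ n / (1 - v x ^ n)"])
  have x0: "0 \<le> v x" by (rule v_nonneg[OF assms(1)])
  have ge: "1 - v x ^ n \<le> v (1 + x ^ n)" for n
  proof -
    have "v 1 = v ((1 + x ^ n) - x ^ n)" by simp
    also have "\<dots> \<le> v (1 + x ^ n) + v (x ^ n)" using assms(1) by (intro v_diff K_closed)
    finally show ?thesis by (simp add: v_power[OF assms(1)])
  qed
  have lt: "v x ^ n < 1" if "n \<ge> 1" for n using assms(2) that x0 by (simp add: power_less_one_iff)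
  have "v (x ^ n / (1 + x ^ n)) \<le> v x ^ n / (1 - v x ^ n)" if n: "n \<ge> 1" for n
  proof -
    have pos: "v (1 + x ^ n) > 0" using ge[of n] lt[OF n] by linarith
    have "v (x ^ n / (1 + x ^ n)) = v x ^ n / v (1 + x ^ n)"
      using assms(1) by (simp add: v_divide v_power K_closed)
    also have "\<dots> \<le> v x ^ n / (1 - v x ^ n)"
      using ge[of n] lt[OF n] pos x0 by (intro divide_left_mono) auto
    finally show ?thesis .
  qed
  thus "\<forall>\<^sub>F n in sequentially. v (x ^ n / (1 + x ^ n)) \<le> v x ^ n / (1 - v x ^ n)"
    unfolding eventually_sequentially by blast
  have p0: "(\<lambda>n. v x ^ n) \<longlonglongrightarrow> 0" using assms(2) x0 by (intro LIMSEQ_power_zero) auto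
  have "(\<lambda>n. v x ^ n / (1 - v x ^ n)) \<longlonglongrightarrow> 0 / (1 - 0)"
    by (rule tendsto_divide[OF p0 tendsto_diff[OF tendsto_const p0]]) simp
  thus "(\<lambda>n. v x ^ n / (1 - v x ^ n)) \<longlonglongrightarrow> 0" by simp
  show "\<forall>\<^sub>F n in sequentially. 0 \<le> v (x ^ n / (1 + x ^ n))"
    using assms(1) by (intro always_eventually allI v_nonneg K_closed divide_closed)
qed auto

end

text \<open>
  As both absolute values agree on \<open>\<rat>\<close>, they can be separated by dividing a high power of \<open>x\<close> by a
  rational number whose absolute value lies between \<open>|x|\<^sup>k\<close> for the one and \<open>|x|\<^sup>k\<close> for the other.
\<close>
lemma separate_two_absolute_values:
  assumes "valued_subfield K v" "valued_subfield K w"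
    and Q: "\<And>q. v (of_rat q) = w (of_rat q)" and t: "1 < v (of_rat t)"
    and x: "x \<in> K" "v x < w x"
  shows "\<exists>y\<in>K. v y < 1 \<and> 1 < w y"
proof -
  interpret v: valued_subfield K v by fact
  interpret w: valued_subfield K w by fact
  define \<tau> where "\<tau> = v (of_rat t)"
  have tK: "of_rat t \<in> K" using v.Rats_subset by auto
  have t0: "of_rat t \<noteq> (0::complex)" using t by auto
  show ?thesis
  proof (cases "x = 0")
    case True
    thus ?thesis using x(2) by simp
  next
    case False
    have vx: "v x > 0" using v.v_nonneg[OF x(1)] v.v_eq_0_iff[OF x(1)] False by linarith
    \<comment> \<open>a power k so large that the gap between the k-th powers contains a power of t\<close>
    have "1 < w x / v x" using x(2) vx by simp
    then obtain k where "\<tau> < (w x / v x) ^ k" using real_arch_pow by blast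
    hence k: "\<tau> * v x ^ k < w x ^ k" using vx by (simp add: power_divide pos_less_divide_eq)
    define j where "j = \<lfloor>log \<tau> (v x ^ k)\<rfloor> + 1"
    have \<tau>: "\<tau> > 1" using t by (simp add: \<tau>_def)
    have pw: "\<tau> powr log \<tau> (v x ^ k) = v x ^ k" using \<tau> vx by simp
    have lo: "v x ^ k < \<tau> powr j"
    proof -
      have "log \<tau> (v x ^ k) < real_of_int j" unfolding j_def by linarith
      hence "\<tau> powr log \<tau> (v x ^ k) < \<tau> powr j" using \<tau> by (intro powr_less_mono)
      thus ?thesis by (simp only: pw)
    qed
    have hi: "\<tau> powr j \<le> \<tau> * v x ^ k"
    proof -
      have "\<tau> powr j \<le> \<tau> powr (1 + log \<tau> (v x ^ k))"
        using \<tau> by (intro powr_mono) (auto simp: j_def)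
      also have "\<dots> = \<tau> * v x ^ k" unfolding powr_add pw using \<tau> by simp
      finally show ?thesis .
    qed
    define q where "q = t powi j"
    have powi: "u (of_rat q) = \<tau> powr j" if u: "valued_subfield K u" "u (of_rat t) = \<tau>" for u
    proof -
      interpret u: valued_subfield K u by fact
      have "u (of_rat q) = u (of_rat t) powi j"
        by (cases "j \<ge> 0") (auto simp: q_def power_int_def of_rat_power of_rat_inverse u.v_power
            u.v_inverse tK u.K_closed power_inverse)
      also have "\<dots> = \<tau> powr j" using u(2) \<tau> by (simp add: powr_real_of_int')
      finally show ?thesis .
    qed
    have vq: "v (of_rat q) = \<tau> powr j" "w (of_rat q) = \<tau> powr j"
      using powi[OF assms(1)] powi[OF assms(2)] Q by (simp_all add: \<tau>_def)
    have qK: "of_rat q \<in> K" using v.Rats_subset by auto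
    have pos: "\<tau> powr j > 0" using \<tau> by simp
    define y where "y = x ^ k / of_rat q"
    have "y \<in> K" unfolding y_def by (intro v.divide_closed v.K_closed x qK)
    moreover have "v y < 1"
      using lo pos x(1) qK by (simp add: y_def v.v_divide v.v_power v.K_closed vq)
    moreover have "1 < w y"
      using hi k pos x(1) qK by (simp add: y_def w.v_divide w.v_power w.K_closed vq)
    ultimately show ?thesis by blast
  qed
qed

text \<open>
  Induction on \<open>W\<close>: let \<open>y\<close> work for all of \<open>W\<close> and \<open>z\<close> for the new absolute value \<open>u\<close>. If \<open>|y|\<^sub>u \<le> 1\<close>, then \<open>y\<^sup>n z\<close>
  works for large \<open>n\<close>, otherwise \<open>y\<^sup>n / (1 + y\<^sup>n) \<cdot> z\<close>.
\<close>
lemma separate_one_absolute_value: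
  assumes "finite W" "valued_subfield K v" "\<And>w. w \<in> W \<Longrightarrow> valued_subfield K w"
    and "\<And>w. w \<in> W \<Longrightarrow> \<exists>y\<in>K. w y < 1 \<and> 1 < v y" and "\<exists>y\<in>K. 1 < v y"
  shows "\<exists>y\<in>K. 1 < v y \<and> (\<forall>w\<in>W. w y < 1)"
  using assms(1,3,4)
proof (induction W rule: finite_induct)
  case empty
  thus ?case using assms(5) by auto
next
  case (insert u W)
  interpret v: valued_subfield K v by fact
  interpret u: valued_subfield K u using insert.prems by simp
  obtain y where y: "y \<in> K" "1 < v y" "\<And>w. w \<in> W \<Longrightarrow> w y < 1" using insert by auto
  obtain z where z: "z \<in> K" "u z < 1" "1 < v z" using insert.prems by auto
  have W: "valued_subfield K w" if "w \<in> W" for w using insert.prems that by simp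
  show ?case
  proof (cases "u y \<le> 1")
    case True
    have "\<forall>\<^sub>F n in sequentially. \<forall>w\<in>W. w y ^ n * w z < 1"
    proof (intro eventually_ball_finite[OF insert.hyps(1)] ballI)
      fix w assume w: "w \<in> W"
      interpret w: valued_subfield K w using W[OF w] .
      have "(\<lambda>n. w y ^ n) \<longlonglongrightarrow> 0" using y(3)[OF w] w.v_nonneg[OF y(1)] by (intro LIMSEQ_power_zero) auto
      hence "(\<lambda>n. w y ^ n * w z) \<longlonglongrightarrow> 0 * w z" by (rule tendsto_mult[OF _ tendsto_const])
      thus "\<forall>\<^sub>F n in sequentially. w y ^ n * w z < 1" by (intro order_tendstoD(2)) auto
    qed
    from eventually_happens'[OF sequentially_bot this]
    obtain n where n: "\<And>w. w \<in> W \<Longrightarrow> w y ^ n * w z < 1" by blast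
    have "y ^ n * z \<in> K" by (intro v.K_closed y z)
    moreover have "1 < v (y ^ n * z)"
    proof -
      have "1 \<le> v y ^ n" using y(2) by (simp add: one_le_power)
      hence "1 * v z \<le> v y ^ n * v z" using z(3) by (intro mult_right_mono) auto
      hence "1 < v y ^ n * v z" using z(3) by linarith
      thus ?thesis using z y by (simp add: v.v_mult v.v_power v.K_closed)
    qed
    moreover have "u (y ^ n * z) < 1"
    proof -
      have "u y ^ n \<le> 1" using True u.v_nonneg[OF y(1)] by (simp add: power_le_one)
      hence "u y ^ n * u z \<le> 1 * u z" using u.v_nonneg[OF z(1)] by (intro mult_right_mono) auto
      hence "u y ^ n * u z < 1" using z(2) by linarith
      thus ?thesis using z y by (simp add: u.v_mult u.v_power u.K_closed)
    qed
    moreover have "w (y ^ n * z) < 1" if w: "w \<in> W" for w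
    proof -
      interpret w: valued_subfield K w using W[OF w] .
      show ?thesis using n[OF w] z y by (simp add: w.v_mult w.v_power w.K_closed)
    qed
    ultimately show ?thesis by auto
  next
    case False
    define e where "e = (\<lambda>n. y ^ n / (1 + y ^ n))"
    have eK: "e n \<in> K" for n unfolding e_def by (intro v.divide_closed v.K_closed y)
    have near: "(\<lambda>n. f (e n * z)) \<longlonglongrightarrow> f z" if f: "valued_subfield K f" "1 < f y" for f
    proof -
      interpret f: valued_subfield K f by fact
      have "(\<lambda>n. f (e n - 1) * f z) \<longlonglongrightarrow> 0 * f z"
        unfolding e_def by (rule tendsto_mult[OF f.v_power_quotient_tendsto_1[OF y(1) f(2)] tendsto_const])
      hence 0: "(\<lambda>n. f (e n - 1) * f z) \<longlonglongrightarrow> 0" by simp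
      have dK: "e n - 1 \<in> K" "e n * z \<in> K" for n using eK z(1) by (auto intro: v.K_closed)
      have "\<bar>f (e n * z) - f z\<bar> \<le> f (e n - 1) * f z" for n
      proof -
        have pK: "(e n - 1) * z \<in> K" by (rule v.K_closed(5)[OF dK(1) z(1)])
        have p: "f ((e n - 1) * z) = f (e n - 1) * f z" by (rule f.v_mult[OF dK(1) z(1)])
        have "f (e n * z) \<le> f ((e n - 1) * z) + f z"
          using f.v_add[OF pK z(1)] by (simp add: algebra_simps)
        moreover have "f z \<le> f (e n * z) + f ((e n - 1) * z)"
          using f.v_diff[OF dK(2)[of n] pK] by (simp add: algebra_simps)
        ultimately show ?thesis using p by linarith
      qed
      hence "(\<lambda>n. f (e n * z) - f z) \<longlonglongrightarrow> 0"
        by (intro Lim_null_comparison[OF _ 0]) auto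
      thus ?thesis by (simp add: LIM_zero_iff)
    qed
    have "\<forall>\<^sub>F n in sequentially. \<forall>w\<in>W. w (e n * z) < 1"
    proof (intro eventually_ball_finite[OF insert.hyps(1)] ballI)
      fix w assume w: "w \<in> W"
      interpret w: valued_subfield K w using W[OF w] .
      have "(\<lambda>n. w (e n) * w z) \<longlonglongrightarrow> 0 * w z"
        unfolding e_def by (rule tendsto_mult[OF w.v_power_quotient_tendsto_0[OF y(1) y(3)[OF w]] tendsto_const])
      thus "\<forall>\<^sub>F n in sequentially. w (e n * z) < 1"
        using order_tendstoD(2)[of "\<lambda>n. w (e n) * w z" 0 sequentially 1]
        by (simp add: w.v_mult[OF eK z(1)])
    qed
    moreover have "\<forall>\<^sub>F n in sequentially. 1 < v (e n * z)"
      using near[OF assms(2) y(2)] z(3) by (rule order_tendstoD(1))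
    moreover have "\<forall>\<^sub>F n in sequentially. u (e n * z) < 1"
      using near[OF u.valued_subfield_axioms] False z(2) by (intro order_tendstoD(2)) auto
    ultimately have "\<forall>\<^sub>F n in sequentially. 1 < v (e n * z) \<and> u (e n * z) < 1 \<and> (\<forall>w\<in>W. w (e n * z) < 1)"
      by eventually_elim blast
    from eventually_happens'[OF sequentially_bot this]
    obtain n where "1 < v (e n * z) \<and> u (e n * z) < 1 \<and> (\<forall>w\<in>W. w (e n * z) < 1)"
      by blast
    thus ?thesis using v.K_closed(5)[OF eK z(1)] by (intro bexI[of _ "e n * z"]) auto
  qed
qed

lemma weak_approximation_idempotent:
  assumes "finite W" "valued_subfield K v" "\<And>w. w \<in> W \<Longrightarrow> valued_subfield K w"
    and "\<And>w. w \<in> W \<Longrightarrow> \<exists>y\<in>K. w y < 1 \<and> 1 < v y" and "\<exists>y\<in>K. 1 < v y" and "\<epsilon> > 0"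
  shows "\<exists>e\<in>K. v (e - 1) < \<epsilon> \<and> (\<forall>w\<in>W. w e < \<epsilon>)"
proof -
  interpret v: valued_subfield K v by fact
  obtain y where y: "y \<in> K" "1 < v y" "\<And>w. w \<in> W \<Longrightarrow> w y < 1"
    using separate_one_absolute_value[OF assms(1-5)] by blast
  define e where "e = (\<lambda>n. y ^ n / (1 + y ^ n))"
  have "\<forall>\<^sub>F n in sequentially. v (e n - 1) < \<epsilon>"
    unfolding e_def using v.v_power_quotient_tendsto_1[OF y(1,2)] assms(6) by (rule order_tendstoD(2))
  moreover have "\<forall>\<^sub>F n in sequentially. \<forall>w\<in>W. w (e n) < \<epsilon>"
  proof (intro eventually_ball_finite[OF assms(1)] ballI)
    fix w assume w: "w \<in> W"
    show "\<forall>\<^sub>F n in sequentially. w (e n) < \<epsilon>"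
      unfolding e_def
      using valued_subfield.v_power_quotient_tendsto_0[OF assms(3)[OF w] y(1) y(3)[OF w]] assms(6)
      by (rule order_tendstoD(2))
  qed
  ultimately have "\<forall>\<^sub>F n in sequentially. v (e n - 1) < \<epsilon> \<and> (\<forall>w\<in>W. w (e n) < \<epsilon>)"
    by eventually_elim blast
  from eventually_happens'[OF sequentially_bot this]
  obtain n where "v (e n - 1) < \<epsilon> \<and> (\<forall>w\<in>W. w (e n) < \<epsilon>)"
    by blast
  moreover have "e n \<in> K" unfolding e_def by (intro v.divide_closed v.K_closed y)
  ultimately show ?thesis by blast
qed

section \<open>Independent Cauchy sequences at several places\<close>

text \<open>
  Let \<open>e v\<close> be close to 1 at \<open>v\<close> and close to 0 at the other places. The elements \<open>e v * s v j I\<close>, for a late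
  index \<open>I\<close>, approximate the given vectors at \<open>v\<close> and are small elsewhere. In a rational relation between
  them, take a place \<open>v\<close> and a coefficient of largest absolute value: at \<open>v\<close> the relation makes a combination of the
  terms \<open>s v j I\<close> smaller than \<open>cauchy_independent_lower_bound\<close> allows.
\<close>
lemma rationally_independent_from_cauchy_independent:
  fixes N :: "(complex \<Rightarrow> real) \<Rightarrow> nat"
  assumes S: "finite S" "\<And>v. v \<in> S \<Longrightarrow> valued_subfield K v"
    and Q: "\<And>v q. v \<in> S \<Longrightarrow> v (of_rat q) = a q" and t: "1 < a t"
    and diff: "\<And>v w. v \<in> S \<Longrightarrow> w \<in> S \<Longrightarrow> v \<noteq> w \<Longrightarrow> \<exists>x\<in>K. v x \<noteq> w x"
    and ind: "\<And>v. v \<in> S \<Longrightarrow> cauchy_independent K v {..<N v} (s v)"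
  shows "\<exists>x. (\<forall>v\<in>S. \<forall>j<N v. x v j \<in> K) \<and>
           (\<forall>c. (\<forall>v\<in>S. \<forall>j<N v. c v j \<in> \<rat>) \<longrightarrow> (\<Sum>v\<in>S. \<Sum>j<N v. c v j * x v j) = 0 \<longrightarrow>
              (\<forall>v\<in>S. \<forall>j<N v. c v j = 0))"
proof (cases "S = {}")
  case False
  have "\<forall>v\<in>S. \<exists>\<delta>. \<delta> > 0 \<and> (\<exists>I. \<forall>i\<ge>I. \<forall>c. (\<forall>j\<in>{..<N v}. c j \<in> \<rat>) \<longrightarrow>
           (\<forall>j\<in>{..<N v}. \<delta> * v (c j) \<le> v (\<Sum>j<N v. c j * s v j i)))"
    by (intro ballI valued_subfield.cauchy_independent_lower_bound[OF S(2) finite_lessThan ind,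
          unfolded Bex_def])
  from bchoice[OF this] obtain \<delta>f where \<delta>f: "\<And>v. v \<in> S \<Longrightarrow> \<delta>f v > 0"
    "\<forall>v\<in>S. \<exists>I. \<forall>i\<ge>I. \<forall>c. (\<forall>j\<in>{..<N v}. c j \<in> \<rat>) \<longrightarrow>
           (\<forall>j\<in>{..<N v}. \<delta>f v * v (c j) \<le> v (\<Sum>j<N v. c j * s v j i))"
    by blast
  from bchoice[OF \<delta>f(2)] obtain If where If: "\<forall>v\<in>S. \<forall>i\<ge>If v. \<forall>c. (\<forall>j\<in>{..<N v}. c j \<in> \<rat>) \<longrightarrow>
           (\<forall>j\<in>{..<N v}. \<delta>f v * v (c j) \<le> v (\<Sum>j<N v. c j * s v j i))"
    by blast
  define \<delta> where "\<delta> = Min (\<delta>f ` S)"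
  define I where "I = Max (If ` S)"
  have \<delta>: "\<delta> > 0" using S(1) False \<delta>f(1) by (auto simp: \<delta>_def)
  have vs: "v (of_rat q) = a q" if "v \<in> S" for v q using Q that by blast
  have sK: "s v j i \<in> K" if "v \<in> S" "j < N v" for v j i
    using ind[OF that(1)] that(2) by (auto simp: cauchy_independent_def cauchy_seqs_def)
  have QK: "c \<in> K" if "c \<in> \<rat>" for c
    using False S(2) valued_subfield.Rats_subset that by blast
  obtain v0 where v0: "v0 \<in> S" using False by blast
  have vQ: "v c = v0 c" if "v \<in> S" "c \<in> \<rat>" for v c
    using that(2) vs[OF that(1)] vs[OF v0] by (auto elim!: Rats_cases)
  have low: "\<delta> * v0 (c j) \<le> v (\<Sum>j<N v. c j * s v j I)"
    if v: "v \<in> S" and c: "\<And>j. j < N v \<Longrightarrow> c j \<in> \<rat>" and j: "j < N v" for v c j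
  proof -
    interpret valued_subfield K v using S(2)[OF v] .
    have "\<delta> \<le> \<delta>f v" "If v \<le> I" using S(1) v by (auto simp: \<delta>_def I_def)
    hence "\<delta> * v (c j) \<le> \<delta>f v * v (c j)"
      using v_nonneg[OF QK[OF c[OF j]]] by (intro mult_right_mono)
    also have "\<dots> \<le> v (\<Sum>j<N v. c j * s v j I)" using If v c j \<open>If v \<le> I\<close> by simp
    finally show ?thesis using vQ[OF v c[OF j]] by simp
  qed
  define M where "M = 1 + (\<Sum>v\<in>S. \<Sum>w\<in>S. \<Sum>j<N w. v (s w j I))"
  have Mv: "v (s w j I) \<le> M" and M0: "M > 0" if "v \<in> S" "w \<in> S" "j < N w" for v w j
  proof -
    have nn: "0 \<le> v (s w j I)" if "v \<in> S" "w \<in> S" "j < N w" for v w j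
      using valued_subfield.v_nonneg[OF S(2) sK] that by blast
    have "v (s w j I) \<le> (\<Sum>j<N w. v (s w j I))"
      using that nn by (intro member_le_sum) auto
    also have "\<dots> \<le> (\<Sum>w\<in>S. \<Sum>j<N w. v (s w j I))"
      using that nn S(1) by (intro member_le_sum[of w S "\<lambda>w. \<Sum>j<N w. v (s w j I)"]) (auto intro!: sum_nonneg)
    also have "\<dots> \<le> (\<Sum>v\<in>S. \<Sum>w\<in>S. \<Sum>j<N w. v (s w j I))"
      using that nn S(1)
      by (intro member_le_sum[of v S "\<lambda>v. \<Sum>w\<in>S. \<Sum>j<N w. v (s w j I)"]) (auto intro!: sum_nonneg)
    finally show "v (s w j I) \<le> M" by (simp add: M_def)
    thus "M > 0" unfolding M_def using nn by (auto intro!: add_pos_nonneg sum_nonneg)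
  qed
  define T where "T = (\<Sum>v\<in>S. real (N v))"
  have T0: "T \<ge> 0" by (simp add: T_def sum_nonneg)
  \<comment> \<open>the total error of the T approximations stays below the lower bound \<delta>\<close>
  define \<epsilon> where "\<epsilon> = \<delta> / ((T + 1) * max 1 M)"
  have \<epsilon>: "\<epsilon> > 0" unfolding \<epsilon>_def using \<delta> T0 by (auto intro!: divide_pos_pos mult_pos_pos)
  have "\<forall>v\<in>S. \<exists>e. e \<in> K \<and> v (e - 1) < \<epsilon> \<and> (\<forall>w\<in>S - {v}. w e < \<epsilon>)"
  proof
    fix v assume v: "v \<in> S"
    interpret v: valued_subfield K v using S(2)[OF v] .
    have "\<exists>y\<in>K. w y < 1 \<and> 1 < v y" if w: "w \<in> S - {v}" for w
    proof -
      interpret w: valued_subfield K w using S(2) w by blast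
      have eq: "v (of_rat q) = w (of_rat q)" for q using vs[OF v, of q] vs[of w q] w by simp
      have tv: "1 < v (of_rat t)" "1 < w (of_rat t)" using t vs[OF v, of t] vs[of w t] w by simp_all
      obtain x where x: "x \<in> K" "v x \<noteq> w x" using diff v w by blast
      show ?thesis
      proof (cases "w x < v x")
        case True
        show ?thesis
          by (rule separate_two_absolute_values[OF w.valued_subfield_axioms v.valued_subfield_axioms
                eq[symmetric] tv(2) x(1) True])
      next
        case False
        hence "v x < w x" using x(2) by simp
        from separate_two_absolute_values[OF v.valued_subfield_axioms w.valued_subfield_axioms
                eq tv(1) x(1) this]
        obtain y where y: "y \<in> K" "v y < 1" "1 < w y" by blast
        have "y \<noteq> 0" using y(3) by auto
        hence "0 < v y" using v.v_nonneg[OF y(1)] v.v_eq_0_iff[OF y(1)] by linarith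
        hence "1 < v (inverse y)" using y by (simp add: v.v_inverse one_less_inverse)
        moreover have "w (inverse y) < 1" using y by (simp add: w.v_inverse inverse_less_1_iff)
        ultimately show ?thesis using v.inverse_closed[OF y(1)] by blast
      qed
    qed
    moreover have "\<exists>y\<in>K. 1 < v y" using t vs[OF v] v.Rats_subset by (intro bexI[of _ "of_rat t"]) auto
    ultimately show "\<exists>e. e \<in> K \<and> v (e - 1) < \<epsilon> \<and> (\<forall>w\<in>S - {v}. w e < \<epsilon>)"
      using weak_approximation_idempotent[of "S - {v}" K v \<epsilon>] S \<epsilon> v.valued_subfield_axioms
      by (simp add: Bex_def)
  qed
  from bchoice[OF this] obtain e where e: "\<And>v. v \<in> S \<Longrightarrow> e v \<in> K" "\<And>v. v \<in> S \<Longrightarrow> v (e v - 1) < \<epsilon>"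
    "\<And>v w. v \<in> S \<Longrightarrow> w \<in> S \<Longrightarrow> w \<noteq> v \<Longrightarrow> w (e v) < \<epsilon>"
    by blast
  define x where "x = (\<lambda>v j. e v * s v j I)"
  have xK: "x v j \<in> K" if "v \<in> S" "j < N v" for v j
    unfolding x_def using valued_subfield.K_closed(5)[OF S(2)[OF v0] e(1)[OF that(1)] sK[OF that]] .
  have "c v1 j1 = 0" if c: "\<And>v j. v \<in> S \<Longrightarrow> j < N v \<Longrightarrow> c v j \<in> \<rat>"
    and sum0: "(\<Sum>v\<in>S. \<Sum>j<N v. c v j * x v j) = 0" and v1: "v1 \<in> S" "j1 < N v1" for c v1 j1
  proof (rule ccontr)
    assume c1: "c v1 j1 \<noteq> 0"
    interpret v0: valued_subfield K v0 using S(2)[OF v0] .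
    define P where "P = (SIGMA v:S. {..<N v})"
    define B where "B = Max ((\<lambda>(v, j). v0 (c v j)) ` P)"
    have P: "finite P" "P \<noteq> {}" using S(1) v1 by (auto simp: P_def)
    have "B \<in> (\<lambda>(v, j). v0 (c v j)) ` P" unfolding B_def using P by (intro Max_in) auto
    then obtain v j where v: "v \<in> S" and j: "j < N v" and B: "B = v0 (c v j)" by (auto simp: P_def)
    have Bmax: "v0 (c w l) \<le> B" if "w \<in> S" "l < N w" for w l
      unfolding B_def using P that by (intro Max_ge) (auto simp: P_def)
    have "0 < v0 (c v1 j1)"
      using v0.v_nonneg[OF QK[OF c[OF v1]]] v0.v_eq_0_iff[OF QK[OF c[OF v1]]] c1 by linarith
    hence B0: "B > 0" using Bmax[OF v1] by linarith
    interpret valued_subfield K v using S(2)[OF v] .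
    have M0': "M > 0" using M0[OF v v j] .
    \<comment> \<open>the errors of the approximations at the place v\<close>
    define y where "y = (\<lambda>w l. x w l - (if w = v then s v l I else 0))"
    have yK: "y w l \<in> K" if "w \<in> S" "l < N w" for w l
      unfolding y_def using xK[OF that] sK[OF that] by (auto intro: K_closed)
    have vy: "v (y w l) \<le> \<epsilon> * M" if wl: "w \<in> S" "l < N w" for w l
    proof -
      define e' where "e' = (if w = v then e v - 1 else e w)"
      have e'K: "e' \<in> K" using e(1) wl v by (auto simp: e'_def intro: K_closed)
      have "y w l = e' * s w l I" by (auto simp: y_def x_def e'_def algebra_simps)
      hence "v (y w l) = v e' * v (s w l I)" using v_mult[OF e'K sK[OF wl]] by simp
      also have "\<dots> \<le> \<epsilon> * M"
        using e(2)[OF v] e(3)[OF wl(1) v] Mv[OF v wl] v_nonneg[OF e'K] v_nonneg[OF sK[OF wl]] \<epsilon>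
        by (intro mult_mono) (auto simp: e'_def)
      finally show ?thesis .
    qed
    have "(\<Sum>w\<in>S. \<Sum>l<N w. c w l * y w l)
        = (\<Sum>w\<in>S. \<Sum>l<N w. c w l * x w l) - (\<Sum>w\<in>S. if w = v then \<Sum>l<N v. c v l * s v l I else 0)"
      unfolding sum_subtractf[symmetric] by (intro sum.cong) (auto simp: y_def algebra_simps sum_subtractf)
    hence eq: "(\<Sum>l<N v. c v l * s v l I) = - (\<Sum>w\<in>S. \<Sum>l<N w. c w l * y w l)"
      using S(1) v sum0 by (simp add: sum.delta)
    have cyK: "c w l * y w l \<in> K" if "w \<in> S" "l < N w" for w l
      using K_closed(5)[OF QK[OF c[OF that]] yK[OF that]] .
    have "\<delta> * B \<le> v (\<Sum>l<N v. c v l * s v l I)"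
      unfolding B using c[OF v] j by (intro low[OF v]) auto
    also have "\<dots> = v (\<Sum>w\<in>S. \<Sum>l<N w. c w l * y w l)"
      unfolding eq by (intro v_minus sum_closed cyK) auto
    also have "\<dots> \<le> (\<Sum>w\<in>S. v (\<Sum>l<N w. c w l * y w l))"
      by (intro v_sum sum_closed cyK) auto
    also have "\<dots> \<le> (\<Sum>w\<in>S. \<Sum>l<N w. v (c w l * y w l))"
      by (intro sum_mono v_sum cyK) auto
    also have "\<dots> \<le> (\<Sum>w\<in>S. \<Sum>l<N w. B * (\<epsilon> * M))"
    proof (intro sum_mono)
      fix w l assume wl': "w \<in> S" "l \<in> {..<N w}"
      hence wl: "w \<in> S" "l < N w" by auto
      show "v (c w l * y w l) \<le> B * (\<epsilon> * M)"
        unfolding v_mult[OF QK[OF c[OF wl]] yK[OF wl]] vQ[OF v c[OF wl]]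
        using Bmax[OF wl] vy[OF wl] v_nonneg[OF yK[OF wl]] B0 by (intro mult_mono) auto
    qed
    also have "\<dots> = B * (T * \<epsilon> * M)" by (simp add: T_def sum_distrib_left sum_distrib_right mult_ac)
    also have "\<dots> < B * \<delta>"
    proof -
      have \<epsilon>M: "\<epsilon> * max 1 M = \<delta> / (T + 1)" by (simp add: \<epsilon>_def)
      have "T * \<epsilon> * M \<le> T * \<epsilon> * max 1 M" using T0 \<epsilon> by (intro mult_left_mono) auto
      also have "\<dots> = \<delta> * (T / (T + 1))" using \<epsilon>M by (simp add: mult.assoc)
      also have "\<dots> < \<delta> * 1" using \<delta> T0 by (intro mult_strict_left_mono) auto
      finally show ?thesis using B0 by simp
    qed
    finally show False by (simp add: mult.commute)
  qed
  thus ?thesis using xK by (intro exI[of _ x]) blast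
qed auto

abbreviation complex_ring :: "complex ring" where
  "complex_ring \<equiv> ring_of_type_algebra"

lemma complex_ring_simps [simp]:
  "carrier complex_ring = UNIV" "x \<otimes>\<^bsub>complex_ring\<^esub> y = x * y" "x \<oplus>\<^bsub>complex_ring\<^esub> y = x + y"
  "\<one>\<^bsub>complex_ring\<^esub> = 1" "\<zero>\<^bsub>complex_ring\<^esub> = 0"
  by (simp_all add: ring_of_type_algebra_def)

interpretation complex_ring: cring complex_ring
  by (rule cring_from_type_algebra)

lemma complex_ring_minus [simp]: "\<ominus>\<^bsub>complex_ring\<^esub> x = - x"
  by (rule complex_ring.minus_equality) simp_all

lemma complex_ring_inv:
  assumes "x \<noteq> 0"
  shows "inv\<^bsub>complex_ring\<^esub> x = inverse x"
  using assms by (intro complex_ring.comm_inv_char) auto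

lemma Rats_subfield: "subfield \<rat> complex_ring"
proof (rule field.subfieldI'[OF field_from_type_algebra])
  show "subring \<rat> complex_ring" by (rule complex_ring.subringI) auto
qed (auto simp: complex_ring_inv)

lemma combine_complex_ring:
  "complex_ring.combine Ks Us = (\<Sum>i<min (length Ks) (length Us). Ks ! i * Us ! i)"
proof (induction Ks Us rule: complex_ring.combine.induct)
  case (1 k Ks u Us)
  thus ?case by (simp add: lessThan_Suc_eq_insert_0 sum.insert sum.reindex zero_notin_Suc_image del: sum.lessThan_Suc)
qed auto

lemma number_field_subring:
  assumes "number_field K"
  shows "is_subring K" "x \<in> K \<Longrightarrow> inverse x \<in> K"
proof -
  have K: "subfield K complex_ring" using assms by (simp add: number_field_def)
  note E = subringE[OF subfieldE(1)[OF K], simplified]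
  have "a - b \<in> K" if "a \<in> K" "b \<in> K" for a b
    using E(7)[OF that(1) E(5)[OF that(2)]] by simp
  thus "is_subring K" using E(3,6) by (auto simp: is_subring_def)
  show "inverse x \<in> K" if "x \<in> K"
  proof (cases "x = 0")
    case False
    thus ?thesis using complex_ring.subfield_m_inv(1)[OF K, of x] that by (simp add: complex_ring_inv)
  qed (use that in simp)
qed

lemma card_le_field_degree:
  assumes K: "number_field K" and J: "finite J" and x: "\<And>j. j \<in> J \<Longrightarrow> x j \<in> K"
    and ind: "\<And>c. (\<And>j. j \<in> J \<Longrightarrow> c j \<in> \<rat>) \<Longrightarrow> (\<Sum>j\<in>J. c j * x j) = 0 \<Longrightarrow> (\<And>j. j \<in> J \<Longrightarrow> c j = 0)"
  shows "card J \<le> field_degree K"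
proof -
  obtain g where g: "bij_betw g {..<card J} J"
    using ex_bij_betw_nat_finite[OF J] by (auto simp: atLeast0LessThan)
  define Us where "Us = map (\<lambda>i. x (g i)) [0..<card J]"
  have len: "length Us = card J" by (simp add: Us_def)
  have gJ: "g i \<in> J" if "i < card J" for i using g that by (auto simp: bij_betw_def)
  have "complex_ring.independent \<rat> Us"
  proof (rule complex_ring.trivial_combine_imp_independent[OF Rats_subfield])
    fix Ks assume Ks: "set Ks \<subseteq> \<rat>" "complex_ring.combine Ks Us = \<zero>\<^bsub>complex_ring\<^esub>"
    define c where "c = (\<lambda>j. let i = the_inv_into {..<card J} g j in if i < length Ks then Ks ! i else 0)"
    have cg: "c (g i) = (if i < length Ks then Ks ! i else 0)" if "i < card J" for i
      using g that by (simp add: c_def Let_def the_inv_into_f_f bij_betw_def)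
    have cJ: "c j \<in> \<rat>" for j
      using Ks(1) by (auto simp: c_def Let_def)
    have "(\<Sum>j\<in>J. c j * x j) = (\<Sum>i<card J. c (g i) * x (g i))"
      using sum.reindex_bij_betw[OF g, of "\<lambda>j. c j * x j"] by simp
    also have "\<dots> = (\<Sum>i<min (length Ks) (length Us). Ks ! i * Us ! i)"
      unfolding len by (intro sum.mono_neutral_cong_right) (auto simp: cg Us_def)
    also have "\<dots> = 0" using Ks(2) by (simp add: combine_complex_ring)
    finally have "c j = 0" if "j \<in> J" for j using ind[of c] cJ that by blast
    hence "Ks ! i = 0" if "i < card J" "i < length Ks" for i
      using cg[OF that(1)] gJ[OF that(1)] that by simp
    thus "set (take (length Us) Ks) \<subseteq> {\<zero>\<^bsub>complex_ring\<^esub>}"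
      by (auto simp: len in_set_conv_nth)
  qed auto
  moreover have "complex_ring.dimension (field_degree K) \<rat> K"
    using complex_ring.finite_dimensionE[OF Rats_subfield, of K] K
    by (simp add: number_field_def field_degree_def over_def)
  moreover have "set Us \<subseteq> K" using x gJ by (auto simp: Us_def)
  ultimately have "length Us \<le> field_degree K"
    using complex_ring.independent_length_le_dimension[OF Rats_subfield] by blast
  thus ?thesis by (simp add: len)
qed

lemma sum_card_cauchy_independent_le_field_degree:
  fixes N :: "(complex \<Rightarrow> real) \<Rightarrow> nat"
  assumes K: "number_field K" and S: "finite S" "\<And>v. v \<in> S \<Longrightarrow> valued_subfield K v"
    and Q: "\<And>v q. v \<in> S \<Longrightarrow> v (of_rat q) = a q" and t: "1 < a t"
    and diff: "\<And>v w. v \<in> S \<Longrightarrow> w \<in> S \<Longrightarrow> v \<noteq> w \<Longrightarrow> \<exists>x\<in>K. v x \<noteq> w x"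
    and ind: "\<And>v. v \<in> S \<Longrightarrow> cauchy_independent K v {..<N v} (s v)"
  shows "(\<Sum>v\<in>S. N v) \<le> field_degree K"
proof -
  have "\<exists>x. (\<forall>v\<in>S. \<forall>j<N v. x v j \<in> K) \<and>
           (\<forall>c. (\<forall>v\<in>S. \<forall>j<N v. c v j \<in> \<rat>) \<longrightarrow> (\<Sum>v\<in>S. \<Sum>j<N v. c v j * x v j) = 0 \<longrightarrow>
              (\<forall>v\<in>S. \<forall>j<N v. c v j = 0))"
    by (rule rationally_independent_from_cauchy_independent[of S K a t N s])
       (fact S(1), fact S(2), fact Q, fact t, fact diff, fact ind)
  then obtain x where x: "\<And>v j. v \<in> S \<Longrightarrow> j < N v \<Longrightarrow> x v j \<in> K"
    "\<And>c. (\<forall>v\<in>S. \<forall>j<N v. c v j \<in> \<rat>) \<Longrightarrow> (\<Sum>v\<in>S. \<Sum>j<N v. c v j * x v j) = 0 \<Longrightarrow>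
              (\<forall>v\<in>S. \<forall>j<N v. c v j = 0)"
    by blast
  define J where "J = (SIGMA v:S. {..<N v})"
  have "card J \<le> field_degree K"
  proof (rule card_le_field_degree[OF K, where x = "\<lambda>(v, j). x v j"])
    show "finite J" using S(1) by (auto simp: J_def)
    show "(case p of (v, j) \<Rightarrow> x v j) \<in> K" if "p \<in> J" for p using x(1) that by (auto simp: J_def)
    fix c p
    assume c: "\<And>j. j \<in> J \<Longrightarrow> c j \<in> \<rat>" "(\<Sum>p\<in>J. c p * (case p of (v, j) \<Rightarrow> x v j)) = 0" "p \<in> J"
    have "(\<Sum>v\<in>S. \<Sum>j<N v. c (v, j) * x v j) = (\<Sum>p\<in>J. c p * (case p of (v, j) \<Rightarrow> x v j))"
      unfolding J_def using S(1) by (subst sum.Sigma) (auto simp: case_prod_unfold)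
    hence "\<forall>v\<in>S. \<forall>j<N v. c (v, j) = 0"
      using x(2)[of "\<lambda>v j. c (v, j)"] c(1,2) by (auto simp: J_def)
    thus "c p = 0" using c(3) by (auto simp: J_def)
  qed
  thus ?thesis using S(1) by (simp add: J_def)
qed

section \<open>Completions\<close>

context valued_subfield
begin

abbreviation "Rc \<equiv> cauchy_ring K v"

lemma cauchy_seqs_iff:
  "s \<in> cauchy_seqs K v \<longleftrightarrow> (\<forall>n. s n \<in> K) \<and> (\<forall>e>0. \<exists>N. \<forall>m\<ge>N. \<forall>n\<ge>N. v (s m - s n) < e)"
  by (simp add: cauchy_seqs_def)

lemma null_seqs_iff: "s \<in> null_seqs K v \<longleftrightarrow> (\<forall>n. s n \<in> K) \<and> (\<forall>e>0. \<exists>N. \<forall>n\<ge>N. v (s n) < e)"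
  by (simp add: null_seqs_def)

lemma const_in_cauchy_seqs: "x \<in> K \<Longrightarrow> (\<lambda>n. x) \<in> cauchy_seqs K v"
  by (simp add: cauchy_seqs_iff)

lemma cauchy_seqs_bounded:
  assumes s: "s \<in> cauchy_seqs K v"
  shows "\<exists>B>0. \<forall>n. v (s n) \<le> B"
proof -
  have sK: "s n \<in> K" for n using s by (simp add: cauchy_seqs_iff)
  have "\<forall>e>0. \<exists>N. \<forall>m\<ge>N. \<forall>n\<ge>N. v (s m - s n) < e" using s by (simp add: cauchy_seqs_iff)
  from this[rule_format, of 1] obtain N where N: "\<forall>m\<ge>N. \<forall>n\<ge>N. v (s m - s n) < 1" by auto
  define B where "B = 1 + (\<Sum>i\<le>N. v (s i))"
  have le: "v (s i) \<le> (\<Sum>i\<le>N. v (s i))" if "i \<le> N" for i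
    using that v_nonneg[OF sK] by (intro member_le_sum) auto
  have "v (s n) \<le> B" for n
  proof (cases "n \<le> N")
    case True
    thus ?thesis using le[OF True] by (simp add: B_def)
  next
    case False
    have "v (s n) \<le> v (s n - s N) + v (s N)"
      using v_add[of "s n - s N" "s N"] sK K_closed(3) by simp
    thus ?thesis using N[rule_format, of n N] False le[of N] by (simp add: B_def)
  qed
  moreover have "B > 0" unfolding B_def using v_nonneg[OF sK] by (auto intro!: add_pos_nonneg sum_nonneg)
  ultimately show ?thesis by blast
qed

lemma cauchy_seqs_add:
  assumes "s \<in> cauchy_seqs K v" "t \<in> cauchy_seqs K v"
  shows "(\<lambda>n. s n + t n) \<in> cauchy_seqs K v"
  unfolding cauchy_seqs_iff
proof (intro conjI allI impI)
  have K: "s n \<in> K" "t n \<in> K" for n using assms by (auto simp: cauchy_seqs_iff)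
  show "s n + t n \<in> K" for n by (intro K_closed K)
  fix e :: real assume "e > 0"
  hence e: "e / 2 > 0" by simp
  obtain N M where N: "\<forall>m\<ge>N. \<forall>n\<ge>N. v (s m - s n) < e / 2" and M: "\<forall>m\<ge>M. \<forall>n\<ge>M. v (t m - t n) < e / 2"
    using assms e unfolding cauchy_seqs_iff by meson
  have "v (s m + t m - (s n + t n)) < e" if "m \<ge> max N M" "n \<ge> max N M" for m n
  proof -
    have "v (s m + t m - (s n + t n)) = v ((s m - s n) + (t m - t n))" by (simp add: algebra_simps)
    also have "\<dots> \<le> v (s m - s n) + v (t m - t n)" by (intro v_add K_closed K)
    finally show ?thesis using N[rule_format, of m n] M[rule_format, of m n] that by simp
  qed
  thus "\<exists>N. \<forall>m\<ge>N. \<forall>n\<ge>N. v (s m + t m - (s n + t n)) < e" by blast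
qed

lemma cauchy_seqs_mult:
  assumes "s \<in> cauchy_seqs K v" "t \<in> cauchy_seqs K v"
  shows "(\<lambda>n. s n * t n) \<in> cauchy_seqs K v"
  unfolding cauchy_seqs_iff
proof (intro conjI allI impI)
  have K: "s n \<in> K" "t n \<in> K" for n using assms by (auto simp: cauchy_seqs_iff)
  show "s n * t n \<in> K" for n by (intro K_closed K)
  fix e :: real assume e: "e > 0"
  obtain A B where A: "A > 0" "\<And>n. v (s n) \<le> A" and B: "B > 0" "\<And>n. v (t n) \<le> B"
    using cauchy_seqs_bounded assms by meson
  have "e / (2 * B) > 0" "e / (2 * A) > 0" using e A B by auto
  then obtain N M where N: "\<forall>m\<ge>N. \<forall>n\<ge>N. v (s m - s n) < e / (2 * B)"
      and M: "\<forall>m\<ge>M. \<forall>n\<ge>M. v (t m - t n) < e / (2 * A)"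
    using assms unfolding cauchy_seqs_iff by meson
  have "v (s m * t m - s n * t n) < e" if mn: "m \<ge> max N M" "n \<ge> max N M" for m n
  proof -
    have d: "s m - s n \<in> K" "t m - t n \<in> K" by (intro K_closed K)+
    have "s m * t m - s n * t n = s m * (t m - t n) + (s m - s n) * t n"
      by (simp add: algebra_simps)
    also have "v \<dots> \<le> v (s m * (t m - t n)) + v ((s m - s n) * t n)"
      by (intro v_add K_closed d K)
    also have "\<dots> = v (s m) * v (t m - t n) + v (s m - s n) * v (t n)"
      by (simp add: v_mult d K)
    also have "\<dots> \<le> A * v (t m - t n) + v (s m - s n) * B"
      using A B v_nonneg d K by (intro add_mono mult_mono) auto
    also have "\<dots> < A * (e / (2 * A)) + (e / (2 * B)) * B"
      using N M mn A(1) B(1) by (intro add_strict_mono mult_strict_left_mono mult_strict_right_mono) auto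
    also have "\<dots> = e" using A(1) B(1) by simp
    finally show ?thesis .
  qed
  thus "\<exists>N. \<forall>m\<ge>N. \<forall>n\<ge>N. v (s m * t m - s n * t n) < e" by blast
qed

lemma cauchy_seqs_minus:
  assumes "s \<in> cauchy_seqs K v"
  shows "(\<lambda>n. - s n) \<in> cauchy_seqs K v"
  using cauchy_seqs_mult[OF const_in_cauchy_seqs[of "-1"] assms] K_closed(2,6) by simp

lemma null_seqs_add:
  assumes "s \<in> null_seqs K v" "t \<in> null_seqs K v"
  shows "(\<lambda>n. s n + t n) \<in> null_seqs K v"
  unfolding null_seqs_iff
proof (intro conjI allI impI)
  have K: "s n \<in> K" "t n \<in> K" for n using assms by (auto simp: null_seqs_iff)
  show "s n + t n \<in> K" for n by (intro K_closed K)
  fix e :: real assume "e > 0"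
  hence e: "e / 2 > 0" by simp
  obtain N M where N: "\<forall>n\<ge>N. v (s n) < e / 2" and M: "\<forall>n\<ge>M. v (t n) < e / 2"
    using assms e unfolding null_seqs_iff by meson
  have "v (s n + t n) < e" if "n \<ge> max N M" for n
    using v_add[OF K, of n n] N[rule_format, of n] M[rule_format, of n] that by simp
  thus "\<exists>N. \<forall>n\<ge>N. v (s n + t n) < e" by blast
qed

lemma null_seqs_mult:
  assumes "s \<in> cauchy_seqs K v" "t \<in> null_seqs K v"
  shows "(\<lambda>n. s n * t n) \<in> null_seqs K v"
  unfolding null_seqs_iff
proof (intro conjI allI impI)
  have K: "s n \<in> K" "t n \<in> K" for n using assms by (auto simp: cauchy_seqs_iff null_seqs_iff)
  show "s n * t n \<in> K" for n by (intro K_closed K)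
  fix e :: real assume e: "e > 0"
  obtain A where A: "A > 0" "\<And>n. v (s n) \<le> A" using cauchy_seqs_bounded assms(1) by meson
  have "e / A > 0" using e A by simp
  then obtain N where N: "\<forall>n\<ge>N. v (t n) < e / A"
    using assms(2) unfolding null_seqs_iff by meson
  have "v (s n * t n) < e" if n: "n \<ge> N" for n
  proof -
    have "v (s n * t n) \<le> A * v (t n)"
      unfolding v_mult[OF K] using A(2) v_nonneg[OF K(2)] by (intro mult_right_mono)
    also have "\<dots> < A * (e / A)" using N n A(1) by (intro mult_strict_left_mono) auto
    finally show ?thesis using A(1) by simp
  qed
  thus "\<exists>N. \<forall>n\<ge>N. v (s n * t n) < e" by blast
qed

lemma null_seqs_subset: "null_seqs K v \<subseteq> cauchy_seqs K v"
proof
  fix s assume s: "s \<in> null_seqs K v"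
  have K: "s n \<in> K" for n using s by (auto simp: null_seqs_iff)
  have "\<exists>N. \<forall>m\<ge>N. \<forall>n\<ge>N. v (s m - s n) < e" if "e > 0" for e
  proof -
    obtain N where N: "\<forall>n\<ge>N. v (s n) < e / 2"
      using s \<open>e > 0\<close> unfolding null_seqs_iff by (meson half_gt_zero)
    have "v (s m - s n) < e" if "m \<ge> N" "n \<ge> N" for m n
      using v_diff[OF K K, of m n] N[rule_format, of n] N[rule_format, of m] that by simp
    thus ?thesis by blast
  qed
  thus "s \<in> cauchy_seqs K v" using K by (simp add: cauchy_seqs_iff)
qed

text \<open>
  A Cauchy sequence that does not tend to 0 is bounded away from 0 from some index on.
\<close>
lemma cauchy_seqs_inverse:
  assumes s: "s \<in> cauchy_seqs K v" "s \<notin> null_seqs K v"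
  shows "\<exists>t\<in>cauchy_seqs K v. (\<lambda>n. s n * t n - 1) \<in> null_seqs K v"
proof -
  have K: "s n \<in> K" for n using s by (auto simp: cauchy_seqs_iff)
  obtain \<delta> where \<delta>: "\<delta> > 0" "\<And>N. \<exists>n\<ge>N. \<delta> \<le> v (s n)"
    using s K unfolding null_seqs_iff by (meson not_less)
  have "\<delta> / 2 > 0" using \<delta> by simp
  then obtain N where N: "\<forall>m\<ge>N. \<forall>n\<ge>N. v (s m - s n) < \<delta> / 2"
    using s(1) unfolding cauchy_seqs_iff by meson
  have low: "\<delta> / 2 \<le> v (s n)" if n: "n \<ge> N" for n
  proof -
    obtain m where m: "m \<ge> N" "\<delta> \<le> v (s m)" using \<delta>(2) by blast
    have "v (s m) \<le> v (s m - s n) + v (s n)"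
      using v_add[of "s m - s n" "s n"] K K_closed(3) by simp
    thus ?thesis using N[rule_format, of m n] m n by simp
  qed
  \<comment> \<open>early terms of s may vanish\<close>
  define t where "t = (\<lambda>n. if n \<ge> N then inverse (s n) else 1)"
  have tK: "t n \<in> K" for n using K inverse_closed K_closed(2) by (simp add: t_def)
  have s0: "s n \<noteq> 0" if "n \<ge> N" for n using low[OF that] \<delta>(1) by auto
  have "t \<in> cauchy_seqs K v"
    unfolding cauchy_seqs_iff
  proof (intro conjI allI impI tK)
    fix e :: real assume e: "e > 0"
    have "e * (\<delta> / 2)\<^sup>2 > 0" using e \<delta>(1) by simp
    then obtain M where M: "\<forall>m\<ge>M. \<forall>n\<ge>M. v (s m - s n) < e * (\<delta> / 2)\<^sup>2"
      using s(1) unfolding cauchy_seqs_iff by meson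
    have "v (t m - t n) < e" if mn: "m \<ge> max N M" "n \<ge> max N M" for m n
    proof -
      have nz: "s m \<noteq> 0" "s n \<noteq> 0" using s0 mn by auto
      have lo: "\<delta> / 2 \<le> v (s m)" "\<delta> / 2 \<le> v (s n)" using low mn by auto
      have "t m - t n = (s n - s m) / (s m * s n)"
        using mn nz by (simp add: t_def field_simps)
      hence "v (t m - t n) = v (s n - s m) / (v (s m) * v (s n))"
        by (simp add: v_divide v_mult K_closed K)
      also have "\<dots> \<le> v (s n - s m) / (\<delta> / 2)\<^sup>2"
        unfolding power2_eq_square
        using lo \<delta>(1) v_nonneg K K_closed(3) by (intro divide_left_mono mult_mono mult_pos_pos) auto
      also have "\<dots> < e"
        using M mn \<delta>(1) by (simp add: pos_divide_less_eq)
      finally show ?thesis .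
    qed
    thus "\<exists>N. \<forall>m\<ge>N. \<forall>n\<ge>N. v (t m - t n) < e" by blast
  qed
  moreover have "s n * t n - 1 = 0" if "n \<ge> N" for n using that s0 by (simp add: t_def)
  hence "v (s n * t n - 1) < e" if "n \<ge> N" "e > 0" for n e using that by simp
  hence "(\<lambda>n. s n * t n - 1) \<in> null_seqs K v"
    unfolding null_seqs_iff using tK K K_closed(2,3,5) by blast
  ultimately show ?thesis by blast
qed

lemma cauchy_ring_simps [simp]:
  "carrier Rc = cauchy_seqs K v" "\<one>\<^bsub>Rc\<^esub> = (\<lambda>n. 1)" "\<zero>\<^bsub>Rc\<^esub> = (\<lambda>n. 0)"
  "s \<otimes>\<^bsub>Rc\<^esub> t = (\<lambda>n. s n * t n)" "s \<oplus>\<^bsub>Rc\<^esub> t = (\<lambda>n. s n + t n)"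
  by (simp_all add: cauchy_ring_def)

lemma cauchy_ring_cring: "cring Rc"
proof (rule cringI)
  show "abelian_group Rc"
  proof (rule abelian_groupI)
    show "\<exists>y\<in>carrier Rc. y \<oplus>\<^bsub>Rc\<^esub> x = \<zero>\<^bsub>Rc\<^esub>" if "x \<in> carrier Rc" for x
      using cauchy_seqs_minus[of x] that by (intro bexI[of _ "\<lambda>n. - x n"]) auto
  qed (auto simp: cauchy_seqs_add const_in_cauchy_seqs K_closed(1) algebra_simps)
  show "comm_monoid Rc"
    by (rule comm_monoidI) (auto simp: cauchy_seqs_mult const_in_cauchy_seqs K_closed(2) algebra_simps)
qed (auto simp: algebra_simps)

lemma null_seqs_ideal: "ideal (null_seqs K v) Rc"
proof (rule idealI)
  interpret R: cring Rc by (rule cauchy_ring_cring)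
  show "ring Rc" by (rule R.ring_axioms)
  have zero: "(\<lambda>n. 0) \<in> null_seqs K v" by (auto simp: null_seqs_iff K_closed(1))
  have m1: "(\<lambda>n. - 1) \<in> cauchy_seqs K v" by (intro const_in_cauchy_seqs K_closed)
  show "subgroup (null_seqs K v) (add_monoid Rc)"
  proof (rule R.add.subgroupI)
    show "\<ominus>\<^bsub>Rc\<^esub> s \<in> null_seqs K v" if "s \<in> null_seqs K v" for s
    proof -
      have c: "s \<in> cauchy_seqs K v" using that null_seqs_subset by blast
      have "\<ominus>\<^bsub>Rc\<^esub> s = (\<lambda>n. - s n)"
        by (rule R.minus_equality) (use c cauchy_seqs_minus[OF c] in auto)
      moreover have "(\<lambda>n. - s n) \<in> null_seqs K v" using null_seqs_mult[OF m1 that] by simp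
      ultimately show ?thesis by simp
    qed
  qed (use null_seqs_subset zero null_seqs_add in auto)
  show "x \<otimes>\<^bsub>Rc\<^esub> a \<in> null_seqs K v" "a \<otimes>\<^bsub>Rc\<^esub> x \<in> null_seqs K v"
    if "a \<in> null_seqs K v" "x \<in> carrier Rc" for a x
    using null_seqs_mult[of x a] that by (simp_all add: mult.commute)
qed

abbreviation "to_completion \<equiv> (\<lambda>s. null_seqs K v +>\<^bsub>Rc\<^esub> s)"

lemma to_completion_hom: "ring_hom_cring Rc (completion K v) to_completion"
  unfolding completion_def
  by (rule ideal.rcos_ring_hom_cring[OF null_seqs_ideal cauchy_ring_cring])

lemma zero_completion: "\<zero>\<^bsub>completion K v\<^esub> = null_seqs K v"
  by (simp add: completion_def FactRing_def)

lemma to_completion_eq_0_iff: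
  assumes "s \<in> cauchy_seqs K v"
  shows "to_completion s = \<zero>\<^bsub>completion K v\<^esub> \<longleftrightarrow> s \<in> null_seqs K v"
  unfolding zero_completion
proof
  interpret R: cring Rc by (rule cauchy_ring_cring)
  show "s \<in> null_seqs K v" if "to_completion s = null_seqs K v"
    using ideal.rcos_const_imp_mem[OF null_seqs_ideal, of s] assms that by simp
  show "to_completion s = null_seqs K v" if "s \<in> null_seqs K v"
    using abelian_subgroup.a_rcos_const[OF abelian_subgroupI3[OF ideal.axioms(1)[OF null_seqs_ideal]
        R.is_abelian_group] that] .
qed

lemma completion_carrier: "carrier (completion K v) = to_completion ` cauchy_seqs K v"
  by (auto simp: completion_def FactRing_def A_RCOSETS_def')

lemma Rats_valued_subfield: "valued_subfield \<rat> v"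
proof
  have QK: "x \<in> K" if "x \<in> \<rat>" for x using that Rats_subset by blast
  show "absolute_value_on \<rat> v"
    unfolding absolute_value_on_def by (simp add: QK v_nonneg v_eq_0_iff v_mult v_add)
qed (auto simp: is_subring_def)

lemma Rats_cauchy_seqs_subset: "cauchy_seqs \<rat> v \<subseteq> cauchy_seqs K v"
  using Rats_subset by (auto simp: cauchy_seqs_def)

lemma Rats_null_seqs: "s \<in> cauchy_seqs \<rat> v \<Longrightarrow> s \<in> null_seqs K v \<longleftrightarrow> s \<in> null_seqs \<rat> v"
  using Rats_subset by (auto simp: cauchy_seqs_def null_seqs_def)

lemma to_completion_inverse:
  assumes s: "s \<in> cauchy_seqs K v" and t: "t \<in> cauchy_seqs K v" "(\<lambda>n. s n * t n - 1) \<in> null_seqs K v"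
  shows "to_completion s \<otimes>\<^bsub>completion K v\<^esub> to_completion t = \<one>\<^bsub>completion K v\<^esub>"
proof -
  interpret h: ring_hom_cring Rc "completion K v" to_completion by (rule to_completion_hom)
  have st: "(\<lambda>n. s n * t n) \<in> cauchy_seqs K v" by (rule cauchy_seqs_mult[OF s t(1)])
  have d: "(\<lambda>n. s n * t n - 1) \<in> cauchy_seqs K v" using t(2) null_seqs_subset by blast
  have "to_completion s \<otimes>\<^bsub>completion K v\<^esub> to_completion t = to_completion (\<lambda>n. s n * t n)"
    using h.hom_mult[of s t] s t(1) by simp
  also have "(\<lambda>n. s n * t n) = (\<lambda>n. s n * t n - 1) \<oplus>\<^bsub>Rc\<^esub> \<one>\<^bsub>Rc\<^esub>" by simp
  also have "to_completion \<dots> = to_completion (\<lambda>n. s n * t n - 1) \<oplus>\<^bsub>completion K v\<^esub> \<one>\<^bsub>completion K v\<^esub>"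
    using h.hom_add[of "\<lambda>n. s n * t n - 1" "\<one>\<^bsub>Rc\<^esub>"] h.hom_one d const_in_cauchy_seqs[OF K_closed(2)] by simp
  also have "\<dots> = \<one>\<^bsub>completion K v\<^esub>"
    using to_completion_eq_0_iff[OF d] t(2) by simp
  finally show ?thesis .
qed

lemma completion_field: "field (completion K v)"
proof -
  interpret h: ring_hom_cring Rc "completion K v" to_completion by (rule to_completion_hom)
  show ?thesis
  proof (rule h.S.cring_fieldI, rule equalityI)
    have "to_completion (\<lambda>n. 1) \<noteq> \<zero>\<^bsub>completion K v\<^esub>"
    proof
      assume "to_completion (\<lambda>n. 1) = \<zero>\<^bsub>completion K v\<^esub>"
      hence "(\<lambda>n. 1) \<in> null_seqs K v"
        using to_completion_eq_0_iff[OF const_in_cauchy_seqs[OF K_closed(2)]] by simp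
      hence small: "\<forall>e>0. \<exists>N::nat. \<forall>n\<ge>N. v 1 < e" unfolding null_seqs_iff by (elim conjE)
      from small[rule_format, of 1] show False by auto
    qed
    hence ne: "\<one>\<^bsub>completion K v\<^esub> \<noteq> \<zero>\<^bsub>completion K v\<^esub>" using h.hom_one by simp
    show "Units (completion K v) \<subseteq> carrier (completion K v) - {\<zero>\<^bsub>completion K v\<^esub>}"
    proof
      fix x assume x: "x \<in> Units (completion K v)"
      have "x \<noteq> \<zero>\<^bsub>completion K v\<^esub>"
        using h.S.Units_r_inv[OF x] h.S.l_null[OF h.S.Units_inv_closed[OF x]] ne by auto
      thus "x \<in> carrier (completion K v) - {\<zero>\<^bsub>completion K v\<^esub>}" using h.S.Units_closed[OF x] by simp
    qed
    show "carrier (completion K v) - {\<zero>\<^bsub>completion K v\<^esub>} \<subseteq> Units (completion K v)"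
    proof
      fix x assume x: "x \<in> carrier (completion K v) - {\<zero>\<^bsub>completion K v\<^esub>}"
      then obtain s where s: "s \<in> cauchy_seqs K v" "x = to_completion s" unfolding completion_carrier by auto
      hence "s \<notin> null_seqs K v" using x to_completion_eq_0_iff by auto
      then obtain t where t: "t \<in> cauchy_seqs K v" "(\<lambda>n. s n * t n - 1) \<in> null_seqs K v"
        using cauchy_seqs_inverse s(1) by blast
      have tc: "to_completion t \<in> carrier (completion K v)" using t(1) by (simp add: completion_carrier)
      have "x \<otimes>\<^bsub>completion K v\<^esub> to_completion t = \<one>\<^bsub>completion K v\<^esub>"
        unfolding s(2) by (rule to_completion_inverse[OF s(1) t])
      thus "x \<in> Units (completion K v)"
        using x tc h.S.m_comm unfolding Units_def by (auto intro!: bexI[of _ "to_completion t"])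
    qed
  qed
qed

lemma rat_completion_subfield: "subfield (rat_completion K v) (completion K v)"
proof -
  interpret Q: valued_subfield \<rat> v by (rule Rats_valued_subfield)
  interpret h: ring_hom_cring Rc "completion K v" to_completion by (rule to_completion_hom)
  have carr: "to_completion s \<in> rat_completion K v" if "s \<in> cauchy_seqs \<rat> v" for s
    using that by (auto simp: rat_completion_def)
  have QC: "s \<in> cauchy_seqs K v" if "s \<in> cauchy_seqs \<rat> v" for s using that Rats_cauchy_seqs_subset by blast
  show ?thesis
  proof (rule field.subfieldI'[OF completion_field])
    show "subring (rat_completion K v) (completion K v)"
    proof (rule h.S.subringI)
      show "rat_completion K v \<subseteq> carrier (completion K v)"
        unfolding rat_completion_def completion_carrier using Rats_cauchy_seqs_subset by blast
      show "\<one>\<^bsub>completion K v\<^esub> \<in> rat_completion K v"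
        using carr[OF Q.const_in_cauchy_seqs[OF Q.K_closed(2)]] h.hom_one by simp
      show "\<ominus>\<^bsub>completion K v\<^esub> x \<in> rat_completion K v" if x: "x \<in> rat_completion K v" for x
      proof -
        obtain s where s: "s \<in> cauchy_seqs \<rat> v" "x = to_completion s" using x by (auto simp: rat_completion_def)
        have m: "(\<lambda>n. - s n) \<in> cauchy_seqs \<rat> v" by (rule Q.cauchy_seqs_minus[OF s(1)])
        have "\<ominus>\<^bsub>completion K v\<^esub> x = to_completion (\<lambda>n. - s n)"
          using h.hom_add[of "\<lambda>n. - s n" s] h.hom_zero s QC[OF m] QC[OF s(1)]
          by (intro h.S.minus_equality) (auto simp: completion_carrier)
        thus ?thesis using carr[OF m] by simp
      qed
      show "x \<otimes>\<^bsub>completion K v\<^esub> y \<in> rat_completion K v"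
        "x \<oplus>\<^bsub>completion K v\<^esub> y \<in> rat_completion K v"
        if xy: "x \<in> rat_completion K v" "y \<in> rat_completion K v" for x y
      proof -
        obtain s t where s: "s \<in> cauchy_seqs \<rat> v" "x = to_completion s"
          and t: "t \<in> cauchy_seqs \<rat> v" "y = to_completion t"
          using xy by (auto simp: rat_completion_def)
        show "x \<otimes>\<^bsub>completion K v\<^esub> y \<in> rat_completion K v"
          using h.hom_mult[of s t] s t QC carr[OF Q.cauchy_seqs_mult[OF s(1) t(1)]] by simp
        show "x \<oplus>\<^bsub>completion K v\<^esub> y \<in> rat_completion K v"
          using h.hom_add[of s t] s t QC carr[OF Q.cauchy_seqs_add[OF s(1) t(1)]] by simp
      qed
    qed
    fix x assume x: "x \<in> rat_completion K v - {\<zero>\<^bsub>completion K v\<^esub>}"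
    then obtain s where s: "s \<in> cauchy_seqs \<rat> v" "x = to_completion s" by (auto simp: rat_completion_def)
    hence "s \<notin> null_seqs \<rat> v" using x to_completion_eq_0_iff[OF QC[OF s(1)]] Rats_null_seqs[OF s(1)] by auto
    then obtain t where t: "t \<in> cauchy_seqs \<rat> v" "(\<lambda>n. s n * t n - 1) \<in> null_seqs \<rat> v"
      using Q.cauchy_seqs_inverse s(1) by blast
    have "(\<lambda>n. s n * t n - 1) \<in> null_seqs K v" using t(2) Rats_subset by (auto simp: null_seqs_def)
    hence "x \<otimes>\<^bsub>completion K v\<^esub> to_completion t = \<one>\<^bsub>completion K v\<^esub>"
      unfolding s(2) by (intro to_completion_inverse QC s t)
    hence "inv\<^bsub>completion K v\<^esub> x = to_completion t"
      using QC[OF s(1)] QC[OF t(1)] unfolding s(2) by (intro h.S.comm_inv_char) (auto simp: completion_carrier)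
    thus "inv\<^bsub>completion K v\<^esub> x \<in> rat_completion K v" using carr[OF t(1)] by simp
  qed
qed

lemma combine_to_completion:
  assumes "\<And>j. j \<in> set js \<Longrightarrow> q j \<in> cauchy_seqs K v" "\<And>j. j \<in> set js \<Longrightarrow> s j \<in> cauchy_seqs K v"
  shows "ring.combine (completion K v) (map (\<lambda>j. to_completion (q j)) js) (map (\<lambda>j. to_completion (s j)) js)
      = to_completion (\<lambda>n. \<Sum>j\<leftarrow>js. q j n * s j n) \<and> (\<lambda>n. \<Sum>j\<leftarrow>js. q j n * s j n) \<in> cauchy_seqs K v"
  using assms
proof (induction js)
  interpret h: ring_hom_cring Rc "completion K v" to_completion by (rule to_completion_hom)
  case Nil
  show ?case using h.hom_zero const_in_cauchy_seqs[OF K_closed(1)] by simp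
next
  interpret h: ring_hom_cring Rc "completion K v" to_completion by (rule to_completion_hom)
  case (Cons j js)
  have qs: "(\<lambda>n. q j n * s j n) \<in> cauchy_seqs K v" using Cons.prems by (intro cauchy_seqs_mult) auto
  have IH: "h.S.combine (map (\<lambda>j. to_completion (q j)) js) (map (\<lambda>j. to_completion (s j)) js)
      = to_completion (\<lambda>n. \<Sum>j\<leftarrow>js. q j n * s j n)" "(\<lambda>n. \<Sum>j\<leftarrow>js. q j n * s j n) \<in> cauchy_seqs K v"
    using Cons by simp_all
  show ?case
    using h.hom_add[of "\<lambda>n. q j n * s j n" "\<lambda>n. \<Sum>j\<leftarrow>js. q j n * s j n"] h.hom_mult[of "q j" "s j"]
      cauchy_seqs_add[OF qs IH(2)] qs IH Cons.prems by simp
qed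

text \<open>
  A relation between the representing sequences, up to a null sequence, is a relation between their
  classes.
\<close>
lemma independent_imp_cauchy_independent:
  assumes "ring.independent (completion K v) (rat_completion K v) Us"
  shows "\<exists>s. cauchy_independent K v {..<length Us} s"
proof -
  interpret C: field "completion K v" by (rule completion_field)
  have "set Us \<subseteq> carrier (completion K v)" by (rule C.independent_in_carrier[OF assms])
  hence "\<forall>j\<in>{..<length Us}. \<exists>s. s \<in> cauchy_seqs K v \<and> Us ! j = to_completion s"
    unfolding completion_carrier by (metis imageE lessThan_iff nth_mem subsetD)
  from bchoice[OF this] obtain s where s: "\<And>j. j < length Us \<Longrightarrow> s j \<in> cauchy_seqs K v"
    "\<And>j. j < length Us \<Longrightarrow> Us ! j = to_completion (s j)" by blast
  have Us: "Us = map (\<lambda>j. to_completion (s j)) [0..<length Us]"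
    using s(2) by (intro nth_equalityI) auto
  have "cauchy_independent K v {..<length Us} s"
    unfolding cauchy_independent_def
  proof (intro conjI allI impI ballI)
    show "s j \<in> cauchy_seqs K v" if "j \<in> {..<length Us}" for j using s(1) that by simp
    fix q j
    assume q: "\<forall>j\<in>{..<length Us}. q j \<in> cauchy_seqs \<rat> v"
      and null: "(\<lambda>n. \<Sum>j<length Us. q j n * s j n) \<in> null_seqs K v" and j: "j \<in> {..<length Us}"
    have qK: "q j \<in> cauchy_seqs K v" if "j < length Us" for j
      using q that Rats_cauchy_seqs_subset by auto
    define Ks where "Ks = map (\<lambda>j. to_completion (q j)) [0..<length Us]"
    have sl: "(\<lambda>n. \<Sum>j\<leftarrow>[0..<length Us]. q j n * s j n) = (\<lambda>n. \<Sum>j<length Us. q j n * s j n)"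
      by (simp add: interv_sum_list_conv_sum_set_nat atLeast0LessThan)
    have "C.combine Ks Us = to_completion (\<lambda>n. \<Sum>j<length Us. q j n * s j n)"
      unfolding Ks_def using combine_to_completion[of "[0..<length Us]" q s] s(1) qK Us
      by (simp add: sl)
    also have "\<dots> = \<zero>\<^bsub>completion K v\<^esub>"
      using to_completion_eq_0_iff null null_seqs_subset by blast
    finally have "set (take (length Us) Ks) \<subseteq> {\<zero>\<^bsub>completion K v\<^esub>}"
      using q by (intro C.independent_imp_trivial_combine[OF rat_completion_subfield assms])
        (auto simp: Ks_def rat_completion_def)
    moreover have "to_completion (q j) \<in> set (take (length Us) Ks)"
      using j by (simp add: Ks_def)
    ultimately have "to_completion (q j) = \<zero>\<^bsub>completion K v\<^esub>" by blast
    thus "q j \<in> null_seqs K v" using to_completion_eq_0_iff[OF qK] j by simp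
  qed
  thus ?thesis by blast
qed

end

section \<open>Sums of local degrees\<close>

text \<open>
  An independent list of maximal length is a basis.
\<close>
lemma (in ring) dimension_of_bounded_space:
  assumes K: "subfield K R" and bound: "\<And>Us. independent K Us \<Longrightarrow> length Us \<le> n"
  shows "\<exists>Us. independent K Us \<and> dim K (carrier R) = length Us"
proof -
  have "\<exists>Us. independent K Us \<and> (\<forall>Vs. independent K Vs \<longrightarrow> length Vs \<le> length Us)"
    using ex_has_greatest_nat[of "independent K" "[]" length "Suc n"] bound by (auto simp: less_Suc_eq_le)
  then obtain Us where Us: "independent K Us" "\<And>Vs. independent K Vs \<Longrightarrow> length Vs \<le> length Us"
    by blast
  have sub: "set Us \<subseteq> carrier R" using independent_in_carrier[OF Us(1)] .
  have "Span K Us = carrier R"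
  proof
    show "Span K Us \<subseteq> carrier R" using Span_in_carrier[OF subfieldE(3)[OF K] sub] .
    show "carrier R \<subseteq> Span K Us"
    proof
      fix u assume u: "u \<in> carrier R"
      show "u \<in> Span K Us"
      proof (rule ccontr)
        assume "u \<notin> Span K Us"
        hence "independent K (u # Us)" using u Us(1) by (intro li_Cons)
        from Us(2)[OF this] show False by simp
      qed
    qed
  qed
  hence "dimension (length Us) K (carrier R)" using dimensionI[OF K Us(1)] by simp
  hence "dim K (carrier R) = length Us" using dimI[OF K] by (simp add: over_def)
  thus ?thesis using Us(1) by blast
qed

lemma abs_values_valued_subfield:
  assumes "number_field K" "v \<in> abs_values K"
  shows "valued_subfield K v"
  using number_field_subring[OF assms(1)] assms(2) by unfold_locales (auto simp: abs_values_def)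

text \<open>
  For a single place, the bound shows that the completion has finite dimension, so that its local degree is the length of an
  independent list. The bound for all places can then be applied to these lists.
\<close>
lemma sum_local_degree_le_field_degree:
  assumes K: "number_field K" and S: "finite S" "S \<subseteq> abs_values K"
    and Q: "\<And>v q. v \<in> S \<Longrightarrow> v (of_rat q) = a q" and t: "1 < a t"
  shows "(\<Sum>v\<in>S. local_degree K v) \<le> field_degree K"
proof -
  have vs: "valued_subfield K v" if "v \<in> S" for v
    using abs_values_valued_subfield[OF K] S(2) that by blast
  have diff: "\<exists>x\<in>K. v x \<noteq> w x" if "v \<in> S" "w \<in> S" "v \<noteq> w" for v w
  proof (rule ccontr)
    assume "\<not> ?thesis"
    moreover have "v \<in> extensional K" "w \<in> extensional K" using S(2) that by (auto simp: abs_values_def)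
    ultimately have "v = w" by (intro extensionalityI[of v K w]) auto
    thus False using that(3) by contradiction
  qed
  have bound: "length Us \<le> field_degree K"
    if v: "v \<in> S" and Us: "ring.independent (completion K v) (rat_completion K v) Us" for v Us
  proof -
    interpret valued_subfield K v using vs[OF v] .
    obtain s where s: "cauchy_independent K v {..<length Us} s"
      using independent_imp_cauchy_independent[OF Us] by blast
    have "(\<Sum>v\<in>{v}. length Us) \<le> field_degree K"
      by (rule sum_card_cauchy_independent_le_field_degree[of K "{v}" a t _ "\<lambda>_. s"])
         (use K vs v Q t s in auto)
    thus ?thesis by simp
  qed
  have "\<forall>v\<in>S. \<exists>s. cauchy_independent K v {..<local_degree K v} s"
  proof
    fix v assume v: "v \<in> S"
    interpret valued_subfield K v using vs[OF v] .
    interpret C: field "completion K v" by (rule completion_field)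
    obtain Us where "C.independent (rat_completion K v) Us" "local_degree K v = length Us"
      using C.dimension_of_bounded_space[OF rat_completion_subfield bound[OF v]]
      unfolding local_degree_def by blast
    thus "\<exists>s. cauchy_independent K v {..<local_degree K v} s"
      using independent_imp_cauchy_independent by simp
  qed
  from bchoice[OF this] obtain s where
    s: "\<And>v. v \<in> S \<Longrightarrow> cauchy_independent K v {..<local_degree K v} (s v)" by blast
  show ?thesis
    by (rule sum_card_cauchy_independent_le_field_degree[of K S a t _ s])
       (fact K, fact S(1), fact vs, fact Q, fact t, fact diff, fact s)
qed

section \<open>The height bound\<close>

lemma prod_normalized_abs_le:
  assumes K: "number_field K" and S: "finite S" "S \<subseteq> abs_values K"
    and Q: "\<And>v q. v \<in> S \<Longrightarrow> v (of_rat q) = a q" and t: "1 < a t"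
    and c: "c \<in> K" and B: "1 \<le> B" "\<And>v. v \<in> S \<Longrightarrow> v c \<le> B"
  shows "(\<Prod>v\<in>S. max 1 (normalized_abs K v c)) \<le> B ^ field_degree K"
proof -
  have "(\<Prod>v\<in>S. max 1 (normalized_abs K v c)) \<le> (\<Prod>v\<in>S. B ^ local_degree K v)"
  proof (intro prod_mono conjI)
    fix v assume v: "v \<in> S"
    interpret valued_subfield K v using abs_values_valued_subfield[OF K] S(2) v by blast
    have "v c ^ local_degree K v \<le> B ^ local_degree K v"
      using B(2)[OF v] v_nonneg[OF c] by (intro power_mono) auto
    thus "max 1 (normalized_abs K v c) \<le> B ^ local_degree K v"
      using B(1) by (simp add: normalized_abs_def one_le_power)
  qed auto
  also have "\<dots> = B ^ (\<Sum>v\<in>S. local_degree K v)" by (simp add: power_sum)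
  also have "\<dots> \<le> B ^ field_degree K"
  proof (rule power_increasing[OF _ B(1)])
    show "(\<Sum>v\<in>S. local_degree K v) \<le> field_degree K"
      by (rule sum_local_degree_le_field_degree[of K S a t]) (fact K, fact S(1), fact S(2), fact Q, fact t)
  qed
  finally show ?thesis .
qed

lemma prod_Un_le:
  fixes f :: "'a \<Rightarrow> real"
  assumes "finite A" "finite B" "\<And>x. 1 \<le> f x"
  shows "prod f (A \<union> B) \<le> prod f A * prod f B"
proof -
  have "prod f (A \<union> B) * 1 \<le> prod f (A \<union> B) * prod f (A \<inter> B)"
    using assms(3) by (intro mult_left_mono prod_ge_1 prod_nonneg) (auto intro: order_trans[OF zero_le_one])
  thus ?thesis using prod.union_inter[OF assms(1,2), of f] by simp
qed

lemma prod_UN_le: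
  fixes f :: "'a \<Rightarrow> real"
  assumes "finite I" "\<And>i. i \<in> I \<Longrightarrow> finite (A i)" "\<And>x. 1 \<le> f x"
  shows "prod f (\<Union>i\<in>I. A i) \<le> (\<Prod>i\<in>I. prod f (A i))"
  using assms(1,2)
proof (induction I rule: finite_induct)
  case (insert i I)
  have "prod f (\<Union>i\<in>insert i I. A i) \<le> prod f (A i) * prod f (\<Union>i\<in>I. A i)"
    using insert prod_Un_le[of "A i" "\<Union>i\<in>I. A i" f] assms(3) by simp
  also have "\<dots> \<le> prod f (A i) * (\<Prod>i\<in>I. prod f (A i))"
    using insert assms(3) by (intro mult_left_mono prod_nonneg) (auto intro: order_trans[OF zero_le_one])
  finally show ?case using insert by simp
qed simp

lemma padic_abs_inverse_prime:
  assumes "Factorial_Ring.prime p"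
  shows "padic_abs p (1 / of_nat p) = real p"
proof -
  have p: "p > 0" using assms by (simp add: prime_gt_0_nat)
  have q: "quotient_of (1 / of_nat p) = (1, int p)"
    using p quotient_of_Fract[of 1 "int p"] by (simp add: Fract_of_int_quotient normalize_stable)
  have "multiplicity (int p) (int p) = 1"
    using assms p by (simp add: multiplicity_of_nat multiplicity_self)
  thus ?thesis using p by (simp add: padic_abs_def q)
qed

text \<open>
  Above a prime that does not divide \<open>d\<close> all factors of the height are 1. So the product splits into the
  archimedean part and the parts above the prime factors of \<open>d\<close>, and the bounds of the latter multiply
  to a power of \<open>d\<close>.
\<close>
theorem height_le_if_abs_values_le:
  assumes K: "number_field K" and c: "c \<in> K" and d: "d \<ge> 1" and C: "1 \<le> C"
    and arch: "\<And>v. v \<in> abs_values K \<Longrightarrow> (\<And>q. v (of_rat q) = \<bar>of_rat q\<bar>) \<Longrightarrow> v c \<le> C"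
    and padic: "\<And>v p. v \<in> abs_values K \<Longrightarrow> Factorial_Ring.prime p \<Longrightarrow> (\<And>q. v (of_rat q) = padic_abs p q) \<Longrightarrow>
                  v c \<le> real p ^ multiplicity p d"
  shows "height K c \<le> C * real d"
proof -
  have Cd: "1 \<le> C * real d" using mult_mono[of 1 C 1 "real d"] C d by simp
  define f where "f = (\<lambda>v. max 1 (normalized_abs K v c))"
  define V where "V = {v \<in> abs_values K. f v \<noteq> 1}"
  define n where "n = field_degree K"
  have "prod f V \<le> (C * real d) ^ n"
  proof (cases "finite V")
    \<comment> \<open>a product over an infinite set is 1\<close>
    case False
    thus ?thesis using Cd by (simp add: one_le_power)
  next
    case True
    define V0 where "V0 = {v \<in> V. \<forall>q. v (of_rat q) = \<bar>of_rat q\<bar>}"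
    define Vp where "Vp = (\<lambda>p. {v \<in> V. \<forall>q. v (of_rat q) = padic_abs p q})"
    have fin: "finite V0" "finite (Vp p)" for p using True by (auto simp: V0_def Vp_def)
    have f1: "1 \<le> f v" for v by (simp add: f_def)
    have "V = V0 \<union> (\<Union>p\<in>prime_factors d. Vp p)"
    proof (intro equalityI subsetI)
      fix v assume v: "v \<in> V"
      hence va: "v \<in> abs_values K" by (simp add: V_def)
      show "v \<in> V0 \<union> (\<Union>p\<in>prime_factors d. Vp p)"
      proof (cases "v \<in> V0")
        case False
        then obtain p where p: "Factorial_Ring.prime p" "\<And>q. v (of_rat q) = padic_abs p q"
          using va v unfolding abs_values_def V0_def by blast
        interpret valued_subfield K v by (rule abs_values_valued_subfield[OF K va])
        have "p dvd d"
        proof (rule ccontr)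
          assume "\<not> p dvd d"
          hence "v c \<le> 1" using padic[OF va p] by (simp add: not_dvd_imp_multiplicity_0)
          hence "f v = 1" using v_nonneg[OF c] by (simp add: f_def normalized_abs_def power_le_one)
          thus False using v by (simp add: V_def)
        qed
        hence "p \<in> prime_factors d" using p(1) d by (simp add: in_prime_factors_iff)
        thus ?thesis using v p(2) by (auto simp: Vp_def)
      qed simp
    qed (auto simp: V0_def Vp_def)
    hence "prod f V \<le> prod f V0 * prod f (\<Union>p\<in>prime_factors d. Vp p)"
      using prod_Un_le[of V0 "\<Union>p\<in>prime_factors d. Vp p" f] fin f1 by simp
    also have "\<dots> \<le> prod f V0 * (\<Prod>p\<in>prime_factors d. prod f (Vp p))"
      using f1 fin by (intro mult_left_mono prod_UN_le prod_nonneg) (auto intro: order_trans[OF zero_le_one])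
    also have "\<dots> \<le> C ^ n * (\<Prod>p\<in>prime_factors d. (real p ^ multiplicity p d) ^ n)"
    proof (intro mult_mono prod_mono conjI)
      show "prod f V0 \<le> C ^ n"
        unfolding f_def n_def
        by (rule prod_normalized_abs_le[OF K fin(1), where a = "\<lambda>q. \<bar>of_rat q\<bar>" and t = 2])
           (auto simp: V0_def V_def c C intro!: arch)
      fix p assume "p \<in> prime_factors d"
      hence p: "Factorial_Ring.prime p" by auto
      have p1: "real p > 1" using prime_gt_1_nat[OF p] by simp
      show "prod f (Vp p) \<le> (real p ^ multiplicity p d) ^ n"
        unfolding f_def n_def
        by (rule prod_normalized_abs_le[OF K fin(2), where a = "padic_abs p" and t = "1 / of_nat p"])
           (use p p1 in \<open>auto simp: Vp_def V_def c padic_abs_inverse_prime one_le_power intro!: padic\<close>)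
    qed (use f1 C in \<open>auto intro!: prod_nonneg intro: order_trans[OF zero_le_one]\<close>)
    also have "(\<Prod>p\<in>prime_factors d. (real p ^ multiplicity p d) ^ n) = real d ^ n"
    proof -
      have "(\<Prod>p\<in>prime_factors d. p ^ multiplicity p d) = d"
        using prod_prime_factors[of d] d by simp
      hence "real d = (\<Prod>p\<in>prime_factors d. real p ^ multiplicity p d)"
        by (metis (no_types, lifting) of_nat_power of_nat_prod prod.cong)
      thus ?thesis by (simp add: prod_power_distrib)
    qed
    finally show ?thesis by (simp add: power_mult_distrib)
  qed
  moreover have "0 \<le> prod f V" by (intro prod_nonneg) (auto simp: f_def)
  ultimately have "prod f V powr (1 / real n) \<le> ((C * real d) ^ n) powr (1 / real n)"
    by (intro powr_mono2) auto
  also have "\<dots> \<le> C * real d"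
    using Cd by (cases "n = 0") (auto simp: powr_realpow[symmetric] powr_powr)
  finally show ?thesis by (simp add: height_def V_def f_def n_def)
qed

theorem theorem1p10:
  fixes d :: nat and \<gamma> :: complex
  assumes "d \<ge> 1"
    and "\<exists>\<alpha>. parabolic_periodic_point (fmap d \<gamma>) \<alpha>"
  shows "algebraic \<gamma> \<and>
    (\<forall>K. number_field K \<and> \<gamma> \<in> K \<longrightarrow>
       height K \<gamma> \<le> (2 * real d + 2) powr (1 / real d) * (real d + 1))"
proof (intro conjI allI impI)
  obtain \<alpha> where par: "parabolic_periodic_point (fmap d \<gamma>) \<alpha>" using assms(2) by blast
  define C where "C = (2 * real d + 2) powr (1 / real d) * (real d + 1) / real d"
  have Cd: "C * real d = (2 * real d + 2) powr (1 / real d) * (real d + 1)"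
    using assms(1) by (simp add: C_def)
  have r1: "1 \<le> (2 * real d + 2) powr (1 / real d)" by (intro ge_one_powr_ge_zero) auto
  have r2: "x \<le> (2 * real d + 2) powr (1 / real d) * (real d + 1)" if "x \<le> real d + 1" for x
  proof -
    have "1 * (real d + 1) \<le> (2 * real d + 2) powr (1 / real d) * (real d + 1)"
      by (rule mult_right_mono[OF r1]) simp
    thus ?thesis unfolding mult_1_left by (rule order_trans[OF that])
  qed
  have C1: "1 \<le> C"
  proof -
    have "1 * real d \<le> C * real d" unfolding Cd by (rule r2) simp
    thus ?thesis using assms(1) by simp
  qed
  have "algebraic (of_nat d * \<gamma>)"
    using algebraic_int_parabolic_parameter[OF assms(1) par] by blast
  then obtain p where p: "\<And>i. coeff p i \<in> \<rat>" "p \<noteq> 0" "poly p (of_nat d * \<gamma>) = 0"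
    unfolding algebraic_altdef by blast
  have "poly (pcompose p [:0, of_nat d:]) \<gamma> = 0"
    using p(3) by (simp add: poly_pcompose mult.commute)
  moreover have "pcompose p [:0, of_nat d:] \<noteq> 0"
    using p(2) assms(1) by (simp add: pcompose_eq_0_iff)
  moreover have "coeff (pcompose p [:0, of_nat d:]) i \<in> \<rat>" for i
    using p(1) by (simp add: coeff_pcompose_linear)
  ultimately show "algebraic \<gamma>" unfolding algebraic_altdef by blast
  fix K assume K: "number_field K \<and> \<gamma> \<in> K"
  show "height K \<gamma> \<le> (2 * real d + 2) powr (1 / real d) * (real d + 1)"
    unfolding Cd[symmetric]
  proof (rule height_le_if_abs_values_le)
    show "v \<gamma> \<le> C" if "v \<in> abs_values K" "\<And>q. v (of_rat q) = \<bar>of_rat q\<bar>" for v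
      unfolding C_def using K that assms(1)
      by (intro archimedean_abs_parabolic_parameter_le[OF abs_values_valued_subfield _ _ _ par]) auto
    show "v \<gamma> \<le> real p ^ multiplicity p d"
      if "v \<in> abs_values K" "Factorial_Ring.prime p" "\<And>q. v (of_rat q) = padic_abs p q" for v p
      using K that assms(1)
      by (intro padic_abs_parabolic_parameter_le[OF abs_values_valued_subfield _ _ _ _ par]) auto
  qed (use K C1 assms(1) in auto)
qed

end
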